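(* Let $n\in\mathbb{N}$, $s\in\mathbb{R}$, $I\subseteq\mathbb{N}$, and let $\mathcal{A}_{I,s}=\{\varphi_i:i\in I\}\subset H^s(\mathbb{R}^n)$. Suppose that $E_s(\mathcal{A}_{I,s})=\{T_k\varphi_i:k\in\mathbb{Z}^n,\,i\in I\}$ is a frame (respectively, a Riesz family) for $S_s(\mathcal{A}_{I,s})$ with constants $A,B$. Let $F:S_s(\mathcal{A}_{I,s})\to S_s(\mathcal{A}_{I,s})$ be its frame operator and put $\mathcal{B}_{I,s}=\{\theta_i:\theta_i=F^{-1}\varphi_i,\ i\in I\}$. Then $E_s(\mathcal{B}_{I,s})=\{T_k\theta_i:k\in\mathbb{Z}^n,\,i\in I\}$ is a dual frame (respectively, a dual Riesz family) of $E_s(\mathcal{A}_{I,s})$ with constants $B^{-1},A^{-1}$. Moreover, if $R_s$ denotes the range operator corresponding to the shift-preserving operator $F$, then $$\mathcal{T}_s\theta_i(t)=R_s^{-1}(t)\big(\mathcal{T}_s\varphi_i(t)\big)\quad\text{for a.e. }t\in\mathbb{T}^n,\ i\in I.$$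
   Context: Notation: $\mathbb{T}^n=[-\frac12,\frac12)^n$ and $\mu_s(x)=(1+|x|^2)^{s/2}$ for $x\in\mathbb{R}^n$. The Fourier transform is $\widehat f(t)=\int_{\mathbb{R}^n}f(x)e^{-2\pi\sqrt{-1}\langle x,t\rangle}\,dx$, extended to tempered distributions. The Sobolev space $H^s=H^s(\mathbb{R}^n)$ consists of all $f\in\mathcal{S}'(\mathbb{R}^n)$ with $\widehat f\mu_s\in L^2(\mathbb{R}^n)$, with inner product $\langle f,g\rangle_{H^s}=\int_{\mathbb{R}^n}\widehat f(t)\overline{\widehat g(t)}\mu_s^2(t)\,dt$. The Hilbert space $\ell^2_s=\ell_s^2(\mathbb{Z}^n)$ consists of sequences $c=(c_k)_{k\in\mathbb{Z}^n}$ with $\sum_k|c_k|^2\mu_s^2(k)<\infty$, with inner product $\langle c,d\rangle_{\ell^2_s}=\sum_{k\in\mathbb{Z}^n}c_k\overline{d_k}\mu_s^2(k)$. $H(\mathbb{T}^n,\ell_s^2)$ is the Hilbert space of measurable $F:\mathbb{T}^n\to\ell^2_s$ with $\int_{\mathbb{T}^n}\|F(t)\|^2_{\ell_s^2}\,dt<\infty$ and inner product $\int_{\mathbb{T}^n}\langle F_1(t),F_2(t)\rangle_{\ell_s^2}\,dt$. The map $\mathcal{T}_s:H^s\to H(\mathbb{T}^n,\ell_s^2)$ is the isometric isomorphism defined as follows: for $f=(1-\frac{\Delta}{4\pi^2})^{-s/2}g$ with $g\in L^2(\mathbb{R}^n)$ (i.e. $\widehat g=\mu_s\widehat f$), $\mathcal{T}_sf(t)=\left(\frac{\widehat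 g(t+k)}{\mu_s(k)}\right)_{k\in\mathbb{Z}^n}=\left(\frac{\mu_s(t+k)}{\mu_s(k)}\widehat f(t+k)\right)_{k\in\mathbb{Z}^n}$. For $k\in\mathbb{Z}^n$, $T_kf=f(\cdot-k)$. For a family $\mathcal{A}_{I,s}=\{\varphi_i:i\in I\}\subset H^s$, $E_s(\mathcal{A}_{I,s})=\{T_k\varphi_i:k\in\mathbb{Z}^n,i\in I\}$ (an indexed family) and $S_s(\mathcal{A}_{I,s})=\overline{\mathrm{span}}\,E_s(\mathcal{A}_{I,s})$, closure in $H^s$. Let $0<A\leqslant B<\infty$. $E_s(\mathcal{A}_{I,s})$ is a frame for $S_s(\mathcal{A}_{I,s})$ with constants $A,B$ if $A\|f\|_{H^s}^2\le\sum_{(k,i)\in\mathbb{Z}^n\times I}|\langle f,T_k\varphi_i\rangle_{H^s}|^2\le B\|f\|_{H^s}^2$ for all $f\in S_s(\mathcal{A}_{I,s})$. It is a Riesz family with constants $A,B$ if $A\sum|c_{k,i}|^2\le\big\|\sum c_{k,i}T_k\varphi_i\big\|_{H^s}^2\le B\sum|c_{k,i}|^2$ for all finitely supported scalar families $(c_{k,i})_{(k,i)\in\mathbb{Z}^n\times I}$ (in that case it is also a frame for $S_s(\mathcal{A}_{I,s})$ with constants $A,B$). The frame operator is $Ff=\sum_{(k,i)\in\mathbb{Z}^n\times I}\langle f,T_k\varphi_i\rangle_{H^s}T_k\varphi_i$, $f\in S_s(\mathcal{A}_{I,s})$, with unconditional convergence in $H^s$; it is a bounded invertible operator on $S_s(\mathcal{A}_{I,s})$.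 $E_s(\mathcal{B}_{I,s})$, with $\mathcal{B}_{I,s}=\{\theta_i:i\in I\}\subset S_s(\mathcal{A}_{I,s})$, is a dual frame (dual Riesz family) of $E_s(\mathcal{A}_{I,s})$ with constants $B^{-1},A^{-1}$ if it is a frame (Riesz family) for $S_s(\mathcal{A}_{I,s})$ with constants $B^{-1},A^{-1}$ and $f=\sum_{(k,i)}\langle f,T_k\theta_i\rangle_{H^s}T_k\varphi_i=\sum_{(k,i)}\langle f,T_k\varphi_i\rangle_{H^s}T_k\theta_i$ for all $f\in S_s(\mathcal{A}_{I,s})$, with unconditional convergence in $H^s$. Range operators: put $J_s(t)=\overline{\mathrm{span}}\{\mathcal{T}_s\varphi_i(t):i\in I\}\subset\ell_s^2$ for a.e. $t\in\mathbb{T}^n$; then $S_s(\mathcal{A}_{I,s})=\{\varphi\in H^s:\mathcal{T}_s\varphi(t)\in J_s(t)\text{ for a.e. }t\}$. A bounded linear operator $L$ on $S_s(\mathcal{A}_{I,s})$ is shift-preserving if $LT_k=T_kL$ for all $k\in\mathbb{Z}^n$. To each such $L$ there corresponds a range operator $R_s$, unique up to a.e. equality: a family of bounded linear operators $R_s(t):J_s(t)\to J_s(t)$, defined for a.e. $t\in\mathbb{T}^n$ and measurable (i.e. $t\mapsto\langle R_s(t)P_{J_s}(t)a,b\rangle_{\ell_s^2}$ is measurable for all $a,b\in\ell_s^2$, where $P_{J_s}(t)$ is the orthogonal projection onto $J_s(t)$), such that $\mathcal{T}_s(Lf)(t)=R_s(t)(\mathcal{T}_sf(t))$ for a.e. $t$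 and all $f\in S_s(\mathcal{A}_{I,s})$. The frame operator $F$ is shift-preserving, and $R_s^{-1}(t)$ denotes the inverse of $R_s(t)$ as an operator on $J_s(t)$. *)

theory Defs
  imports "HOL-Analysis.Analysis"
begin

section \<open>Schwartz functions and tempered distributions on R^n\<close>

definition dir_deriv :: "'n \<Rightarrow> (real^'n \<Rightarrow> complex) \<Rightarrow> real^'n::finite \<Rightarrow> complex" where
  "dir_deriv i f = (\<lambda>x. frechet_derivative f (at x) (axis i 1))"

primrec iter_deriv :: "'n list \<Rightarrow> (real^'n \<Rightarrow> complex) \<Rightarrow> real^'n::finite \<Rightarrow> complex" where
  "iter_deriv [] f = f"
| "iter_deriv (i # is) f = dir_deriv i (iter_deriv is f)"

text \<open>Multi-indices are lists of coordinates. All iterated partial derivatives being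
  (Frechet) differentiable everywhere is exactly smoothness.\<close>

definition smooth :: "(real^'n::finite \<Rightarrow> complex) \<Rightarrow> bool" where
  "smooth f \<longleftrightarrow> (\<forall>\<alpha> x. iter_deriv \<alpha> f differentiable (at x))"

definition schwartz :: "(real^'n::finite \<Rightarrow> complex) \<Rightarrow> bool" where
  "schwartz f \<longleftrightarrow> smooth f \<and>
     (\<forall>m \<alpha>. bdd_above (range (\<lambda>x. norm x ^ m * norm (iter_deriv \<alpha> f x))))"

definition schwartz_seminorm :: "nat \<Rightarrow> 'n list \<Rightarrow> (real^'n::finite \<Rightarrow> complex) \<Rightarrow> real" where
  "schwartz_seminorm m \<alpha> f = (SUP x. norm x ^ m * norm (iter_deriv \<alpha> f x))"

text \<open>A distribution is a functional on test functions, extended by 0 to the functions that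
  are not Schwartz functions, so that equality of distributions is equality of functionals.
  Sums and scalar multiples are taken pointwise.\<close>

type_synonym 'n distribution = "(real^'n \<Rightarrow> complex) \<Rightarrow> complex"

text \<open>Continuity for the locally convex topology generated by the Schwartz seminorms.\<close>

definition tempered :: "'n::finite distribution set" where
  "tempered = {u.
     (\<forall>f. \<not> schwartz f \<longrightarrow> u f = 0) \<and>
     (\<forall>f g. schwartz f \<longrightarrow> schwartz g \<longrightarrow> u (\<lambda>x. f x + g x) = u f + u g) \<and>
     (\<forall>c f. schwartz f \<longrightarrow> u (\<lambda>x. c * f x) = c * u f) \<and>
     (\<exists>K C. finite K \<and>
        (\<forall>f. schwartz f \<longrightarrow> norm (u f) \<le> C * (\<Sum>(m, \<alpha>)\<in>K. schwartz_seminorm m \<alpha> f)))}"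

definition fourier :: "(real^'n::finite \<Rightarrow> complex) \<Rightarrow> real^'n \<Rightarrow> complex" where
  "fourier f t = (LINT x|lborel. f x * exp (- 2 * of_real pi * \<i> * of_real (x \<bullet> t)))"

definition fourier_dist :: "'n::finite distribution \<Rightarrow> 'n distribution" where
  "fourier_dist u = (\<lambda>f. if schwartz f then u (fourier f) else 0)"

definition represented_by :: "'n::finite distribution \<Rightarrow> (real^'n \<Rightarrow> complex) \<Rightarrow> bool" where
  "represented_by u h \<longleftrightarrow> h \<in> borel_measurable lborel \<and>
     (\<forall>f. schwartz f \<longrightarrow> integrable lborel (\<lambda>x. h x * f x) \<and> u f = (LINT x|lborel. h x * f x))"

text \<open>The Fourier transform as a function, for distributions whose Fourier transform is
  represented by one; it is determined up to equality almost everywhere.\<close>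

definition fhat :: "'n::finite distribution \<Rightarrow> real^'n \<Rightarrow> complex" where
  "fhat u = (SOME h. represented_by (fourier_dist u) h)"

section \<open>Sobolev spaces and weighted sequence spaces\<close>

definition mu :: "real \<Rightarrow> real^'n::finite \<Rightarrow> real" where
  "mu s x = (1 + (norm x)\<^sup>2) powr (s / 2)"

definition sobolev :: "real \<Rightarrow> 'n::finite distribution set" where
  "sobolev s = {u \<in> tempered. \<exists>h. represented_by (fourier_dist u) h \<and>
     integrable lborel (\<lambda>t. (norm (h t * of_real (mu s t)))\<^sup>2)}"

definition sobolev_inner :: "real \<Rightarrow> 'n::finite distribution \<Rightarrow> 'n distribution \<Rightarrow> complex" where
  "sobolev_inner s f g = (LINT t|lborel. fhat f t * cnj (fhat g t) * of_real ((mu s t)\<^sup>2))"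

definition sobolev_norm :: "real \<Rightarrow> 'n::finite distribution \<Rightarrow> real" where
  "sobolev_norm s f = sqrt (Re (sobolev_inner s f f))"

definition ivec :: "int^'n::finite \<Rightarrow> real^'n" where
  "ivec k = (\<chi> i. real_of_int (k $ i))"

definition l2s :: "real \<Rightarrow> (int^'n::finite \<Rightarrow> complex) set" where
  "l2s s = {c. (\<lambda>k. (norm (c k))\<^sup>2 * (mu s (ivec k))\<^sup>2) summable_on UNIV}"

definition l2s_inner :: "real \<Rightarrow> (int^'n::finite \<Rightarrow> complex) \<Rightarrow> (int^'n \<Rightarrow> complex) \<Rightarrow> complex" where
  "l2s_inner s c d = (\<Sum>\<^sub>\<infinity>k. c k * cnj (d k) * of_real ((mu s (ivec k))\<^sup>2))"

definition l2s_norm :: "real \<Rightarrow> (int^'n::finite \<Rightarrow> complex) \<Rightarrow> real" where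
  "l2s_norm s c = sqrt (Re (l2s_inner s c c))"

text \<open>Elements of both Hilbert spaces are complex-valued functions with pointwise operations,
  so spans and their closures are defined once, for a carrier \<open>H\<close> with norm \<open>N\<close>.\<close>

definition lin_comb :: "('p \<Rightarrow> complex) \<Rightarrow> ('p \<Rightarrow> 'x \<Rightarrow> complex) \<Rightarrow> 'p set \<Rightarrow> 'x \<Rightarrow> complex" where
  "lin_comb c E M = (\<lambda>x. \<Sum>p\<in>M. c p * E p x)"

definition span_of :: "('p \<Rightarrow> 'x \<Rightarrow> complex) \<Rightarrow> 'p set \<Rightarrow> ('x \<Rightarrow> complex) set" where
  "span_of E P = {lin_comb c E M | c M. finite M \<and> M \<subseteq> P}"

definition closed_span ::
  "('x \<Rightarrow> complex) set \<Rightarrow> (('x \<Rightarrow> complex) \<Rightarrow> real) \<Rightarrow> ('p \<Rightarrow> 'x \<Rightarrow> complex) \<Rightarrow> 'p set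
     \<Rightarrow> ('x \<Rightarrow> complex) set" where
  "closed_span H N E P = {f \<in> H. \<forall>\<epsilon>>0. \<exists>g\<in>span_of E P. N (\<lambda>x. f x - g x) < \<epsilon>}"

text \<open>Unconditional convergence in \<open>H^s\<close>: convergence of the net of finite partial sums.\<close>

definition sobolev_has_sum ::
  "real \<Rightarrow> ('p \<Rightarrow> 'n::finite distribution) \<Rightarrow> 'p set \<Rightarrow> 'n distribution \<Rightarrow> bool" where
  "sobolev_has_sum s E P f \<longleftrightarrow> f \<in> sobolev s \<and>
     ((\<lambda>M. sobolev_norm s (\<lambda>\<psi>. f \<psi> - (\<Sum>p\<in>M. E p \<psi>))) \<longlongrightarrow> 0) (finite_subsets_at_top P)"

section \<open>Shift systems, frames and Riesz families\<close>

text \<open>\<open>translate k u\<close> is the distribution \<open>u(. - k)\<close>.\<close>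

definition translate :: "int^'n::finite \<Rightarrow> 'n distribution \<Rightarrow> 'n distribution" where
  "translate k u = (\<lambda>f. if schwartz f then u (\<lambda>x. f (x + ivec k)) else 0)"

definition shifts :: "(nat \<Rightarrow> 'n::finite distribution) \<Rightarrow> (int^'n) \<times> nat \<Rightarrow> 'n distribution" where
  "shifts \<phi> = (\<lambda>(k, i). translate k (\<phi> i))"

definition shift_space :: "real \<Rightarrow> nat set \<Rightarrow> (nat \<Rightarrow> 'n::finite distribution) \<Rightarrow> 'n distribution set" where
  "shift_space s I \<phi> = closed_span (sobolev s) (sobolev_norm s) (shifts \<phi>) (UNIV \<times> I)"

text \<open>The shifts of \<open>\<phi>\<close> form a frame (Riesz family) for \<open>V\<close>; in both cases \<open>V\<close> is their
  closed span.\<close>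

definition is_frame ::
  "real \<Rightarrow> nat set \<Rightarrow> (nat \<Rightarrow> 'n::finite distribution) \<Rightarrow> 'n distribution set \<Rightarrow> real \<Rightarrow> real \<Rightarrow> bool" where
  "is_frame s I \<phi> V A B \<longleftrightarrow> V = shift_space s I \<phi> \<and>
     (\<forall>f\<in>V. (\<lambda>p. (norm (sobolev_inner s f (shifts \<phi> p)))\<^sup>2) summable_on (UNIV \<times> I) \<and>
        A * (sobolev_norm s f)\<^sup>2 \<le> (\<Sum>\<^sub>\<infinity>p\<in>UNIV \<times> I. (norm (sobolev_inner s f (shifts \<phi> p)))\<^sup>2) \<and>
        (\<Sum>\<^sub>\<infinity>p\<in>UNIV \<times> I. (norm (sobolev_inner s f (shifts \<phi> p)))\<^sup>2) \<le> B * (sobolev_norm s f)\<^sup>2)"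

definition is_riesz ::
  "real \<Rightarrow> nat set \<Rightarrow> (nat \<Rightarrow> 'n::finite distribution) \<Rightarrow> 'n distribution set \<Rightarrow> real \<Rightarrow> real \<Rightarrow> bool" where
  "is_riesz s I \<phi> V A B \<longleftrightarrow> V = shift_space s I \<phi> \<and>
     (\<forall>c M. finite M \<longrightarrow> M \<subseteq> UNIV \<times> I \<longrightarrow>
        A * (\<Sum>p\<in>M. (norm (c p))\<^sup>2) \<le> (sobolev_norm s (lin_comb c (shifts \<phi>) M))\<^sup>2 \<and>
        (sobolev_norm s (lin_comb c (shifts \<phi>) M))\<^sup>2 \<le> B * (\<Sum>p\<in>M. (norm (c p))\<^sup>2))"

definition frame_operator ::
  "real \<Rightarrow> nat set \<Rightarrow> (nat \<Rightarrow> 'n::finite distribution) \<Rightarrow> 'n distribution \<Rightarrow> 'n distribution" where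
  "frame_operator s I \<phi> f = (THE g. sobolev_has_sum s
     (\<lambda>p \<psi>. sobolev_inner s f (shifts \<phi> p) * shifts \<phi> p \<psi>) (UNIV \<times> I) g)"

definition dual_expansion ::
  "real \<Rightarrow> nat set \<Rightarrow> (nat \<Rightarrow> 'n::finite distribution) \<Rightarrow> (nat \<Rightarrow> 'n distribution) \<Rightarrow> bool" where
  "dual_expansion s I \<phi> \<theta> \<longleftrightarrow> (\<forall>f\<in>shift_space s I \<phi>.
     sobolev_has_sum s (\<lambda>p \<psi>. sobolev_inner s f (shifts \<theta> p) * shifts \<phi> p \<psi>) (UNIV \<times> I) f \<and>
     sobolev_has_sum s (\<lambda>p \<psi>. sobolev_inner s f (shifts \<phi> p) * shifts \<theta> p \<psi>) (UNIV \<times> I) f)"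

definition is_dual_frame ::
  "real \<Rightarrow> nat set \<Rightarrow> (nat \<Rightarrow> 'n::finite distribution) \<Rightarrow> (nat \<Rightarrow> 'n distribution) \<Rightarrow> real \<Rightarrow> real \<Rightarrow> bool" where
  "is_dual_frame s I \<phi> \<theta> A' B' \<longleftrightarrow> (\<forall>i\<in>I. \<theta> i \<in> shift_space s I \<phi>) \<and>
     is_frame s I \<theta> (shift_space s I \<phi>) A' B' \<and> dual_expansion s I \<phi> \<theta>"

definition is_dual_riesz ::
  "real \<Rightarrow> nat set \<Rightarrow> (nat \<Rightarrow> 'n::finite distribution) \<Rightarrow> (nat \<Rightarrow> 'n distribution) \<Rightarrow> real \<Rightarrow> real \<Rightarrow> bool" where
  "is_dual_riesz s I \<phi> \<theta> A' B' \<longleftrightarrow> (\<forall>i\<in>I. \<theta> i \<in> shift_space s I \<phi>) \<and>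
     is_riesz s I \<theta> (shift_space s I \<phi>) A' B' \<and> dual_expansion s I \<phi> \<theta>"

text \<open>The generators \<open>F\<^sup>-\<^sup>1 \<phi>\<^sub>i\<close>.\<close>

definition canonical_dual ::
  "real \<Rightarrow> nat set \<Rightarrow> (nat \<Rightarrow> 'n::finite distribution) \<Rightarrow> nat \<Rightarrow> 'n distribution" where
  "canonical_dual s I \<phi> i = inv_into (shift_space s I \<phi>) (frame_operator s I \<phi>) (\<phi> i)"

section \<open>Fibers and range operators\<close>

definition torus :: "(real^'n::finite) set" where
  "torus = {t. \<forall>i. - 1/2 \<le> t $ i \<and> t $ i < 1/2}"

text \<open>The map \<open>T\<^sub>s\<close>.\<close>

definition fiber :: "real \<Rightarrow> 'n::finite distribution \<Rightarrow> real^'n \<Rightarrow> int^'n \<Rightarrow> complex" where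
  "fiber s f t = (\<lambda>k. of_real (mu s (t + ivec k) / mu s (ivec k)) * fhat f (t + ivec k))"

definition range_fun ::
  "real \<Rightarrow> nat set \<Rightarrow> (nat \<Rightarrow> 'n::finite distribution) \<Rightarrow> real^'n \<Rightarrow> (int^'n \<Rightarrow> complex) set" where
  "range_fun s I \<phi> t = closed_span (l2s s) (l2s_norm s) (\<lambda>i. fiber s (\<phi> i) t) I"

definition orth_proj ::
  "real \<Rightarrow> (int^'n::finite \<Rightarrow> complex) set \<Rightarrow> (int^'n \<Rightarrow> complex) \<Rightarrow> int^'n \<Rightarrow> complex" where
  "orth_proj s J a = (THE b. b \<in> J \<and> (\<forall>c\<in>J. l2s_inner s (\<lambda>k. a k - b k) c = 0))"

definition bounded_operator_on ::
  "real \<Rightarrow> (int^'n::finite \<Rightarrow> complex) set \<Rightarrow> ((int^'n \<Rightarrow> complex) \<Rightarrow> int^'n \<Rightarrow> complex) \<Rightarrow> bool" where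
  "bounded_operator_on s J T \<longleftrightarrow>
     (\<forall>a\<in>J. T a \<in> J) \<and>
     (\<forall>a\<in>J. \<forall>b\<in>J. T (\<lambda>k. a k + b k) = (\<lambda>k. T a k + T b k)) \<and>
     (\<forall>z. \<forall>a\<in>J. T (\<lambda>k. z * a k) = (\<lambda>k. z * T a k)) \<and>
     (\<exists>C. \<forall>a\<in>J. l2s_norm s (T a) \<le> C * l2s_norm s a)"

text \<open>\<open>R\<close> is a (version of the) range operator corresponding to the operator \<open>L\<close> on the shift
  space. It only matters almost everywhere, hence Lebesgue rather than Borel measurability.\<close>

definition range_operator ::
  "real \<Rightarrow> nat set \<Rightarrow> (nat \<Rightarrow> 'n::finite distribution) \<Rightarrow> ('n distribution \<Rightarrow> 'n distribution)
     \<Rightarrow> (real^'n \<Rightarrow> (int^'n \<Rightarrow> complex) \<Rightarrow> int^'n \<Rightarrow> complex) \<Rightarrow> bool" where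
  "range_operator s I \<phi> L R \<longleftrightarrow>
     (AE t in lebesgue_on torus. bounded_operator_on s (range_fun s I \<phi> t) (R t)) \<and>
     (\<forall>a\<in>l2s s. \<forall>b\<in>l2s s.
        (\<lambda>t. l2s_inner s (R t (orth_proj s (range_fun s I \<phi> t) a)) b)
          \<in> borel_measurable (lebesgue_on torus)) \<and>
     (\<forall>f\<in>shift_space s I \<phi>. AE t in lebesgue_on torus. fiber s (L f) t = R t (fiber s f t))"

end

(* The Fourier transform turns H^s into a weighted L^2 space.  That this map is onto the weighted
   space, and one-to-one on distributions, rests on Fourier inversion for Schwartz functions; with
   Riesz-Fischer it makes H^s a Hilbert space, so abstract frame theory applies there.  The frame
   operator F is coercive and bounded, hence I - tau F is a contraction for small tau and F is
   invertible; F is self-adjoint, so <f, F^-1 e> = <F^-1 f, e>, and the dual expansions and bounds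
   follow.  For a Riesz family the coefficients of an expansion are unique, so the dual family is
   biorthogonal.  Since F commutes with the translations, the shifts of the F^-1 phi_i are the
   images under F^-1 of the shifts of the phi_i.

   For the fibers, A ||g|| <= ||F g|| applied to g = q f, with q a trigonometric polynomial in the
   translations, gives a nonnegative integral of |q|^2 (||R f(t)||^2 - A^2 ||f(t)||^2) over the torus,
   where f(t) is the fiber of f.  By Stone-Weierstrass and outer regularity R(t) is bounded below
   by A on a countable dense subset of J(t), hence on J(t).  Its range contains every fiber of
   phi_i = F theta_i, so R(t) is a bijection of J(t) sending the fiber of theta_i to that of phi_i. *)

theory Submission
  imports Defs "HOL-Library.Function_Algebras" "HOL-Probability.Characteristic_Functions"
    "HOL-Probability.Sinc_Integral"
begin


section \<open>Frames in a complex Hilbert space\<close>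

text \<open>Distributions and sequences fill only part of their function types, hence the carrier
  \<open>H\<close>. The obstacle on the fiber side is that \<open>fhat\<close> is an arbitrary
  choice among functions equal almost everywhere, so each identity between fibers has a null set
  depending on the distributions involved, and \<open>R t\<close> is tied to the frame operator only
  one distribution at a time. Nothing can be asserted directly about all vectors of
  \<open>range_fun s I \<phi> t\<close>. What survives is a countable supply, the rational
  combinations of the generators, and boundedness of \<open>R t\<close> carries an estimate from
  them to their closure. The property transported is a lower bound, because it yields injectivity
  and closed range together; solving for the generators then gives surjectivity. Its constant is
  \<open>A\<close>, since Cauchy-Schwarz turns the coercivity A |f|^2 <= <F f, f> into A |f| <= |F
  f|. A Riesz family is shown to be a frame with the same constants, so the frame operator is
  studied once for both hypotheses, and only the two-sided bound for the dual family is special to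
  the Riesz case.\<close>

text \<open>The norm is a parameter, rather than a definition, so that interpretations can use
  \<open>sobolev_norm\<close> and \<open>l2s_norm\<close> directly.\<close>

locale chilbert = vector_space scale
  for scale :: "complex \<Rightarrow> 'v::ab_group_add \<Rightarrow> 'v" (infixr "*\<^sub>C" 75) +
  fixes H :: "'v set" and ip :: "'v \<Rightarrow> 'v \<Rightarrow> complex" and nrm :: "'v \<Rightarrow> real"
  assumes subspace_H: "subspace H"
    and ip_add_left: "\<lbrakk>f \<in> H; g \<in> H; h \<in> H\<rbrakk> \<Longrightarrow> ip (f + g) h = ip f h + ip g h"
    and ip_scale_left: "\<lbrakk>f \<in> H; h \<in> H\<rbrakk> \<Longrightarrow> ip (c *\<^sub>C f) h = c * ip f h"
    and ip_cnj: "\<lbrakk>f \<in> H; g \<in> H\<rbrakk> \<Longrightarrow> cnj (ip f g) = ip g f"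
    and ip_pos: "f \<in> H \<Longrightarrow> 0 \<le> Re (ip f f)"
    and ip_definite: "\<lbrakk>f \<in> H; Re (ip f f) = 0\<rbrakk> \<Longrightarrow> f = 0"
    and nrm_def: "nrm f = sqrt (Re (ip f f))"
    and complete: "\<lbrakk>\<And>n. X n \<in> H; \<And>e. e > 0 \<Longrightarrow> \<exists>m. \<forall>i\<ge>m. \<forall>j\<ge>m. nrm (X i - X j) < e\<rbrakk>
      \<Longrightarrow> \<exists>f\<in>H. (\<lambda>n::nat. nrm (X n - f)) \<longlonglongrightarrow> 0"
begin

lemma zero_in [simp]: "0 \<in> H"
  and add_in [simp]: "\<lbrakk>f \<in> H; g \<in> H\<rbrakk> \<Longrightarrow> f + g \<in> H"
  and diff_in [simp]: "\<lbrakk>f \<in> H; g \<in> H\<rbrakk> \<Longrightarrow> f - g \<in> H"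
  and scale_in [simp]: "f \<in> H \<Longrightarrow> c *\<^sub>C f \<in> H"
  and sum_in: "(\<And>p. p \<in> M \<Longrightarrow> E p \<in> H) \<Longrightarrow> sum E M \<in> H"
  using subspace_H by (auto intro: subspace_0 subspace_add subspace_diff subspace_scale subspace_sum)

lemma ip_add_right: "\<lbrakk>f \<in> H; g \<in> H; h \<in> H\<rbrakk> \<Longrightarrow> ip h (f + g) = ip h f + ip h g"
  by (metis add_in complex_cnj_add ip_add_left ip_cnj)

lemma ip_scale_right: "\<lbrakk>f \<in> H; h \<in> H\<rbrakk> \<Longrightarrow> ip h (c *\<^sub>C f) = cnj c * ip h f"
  by (metis scale_in complex_cnj_mult ip_scale_left ip_cnj)

lemma ip_diff_left: "\<lbrakk>f \<in> H; g \<in> H; h \<in> H\<rbrakk> \<Longrightarrow> ip (f - g) h = ip f h - ip g h"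
  using ip_add_left[of "f - g" g h] by simp

lemma ip_diff_right: "\<lbrakk>f \<in> H; g \<in> H; h \<in> H\<rbrakk> \<Longrightarrow> ip h (f - g) = ip h f - ip h g"
  using ip_add_right[of "f - g" g h] by simp

lemma ip_zero_left [simp]: "h \<in> H \<Longrightarrow> ip 0 h = 0"
  using ip_diff_left[of 0 0 h] by simp

lemma ip_sum_left: "\<lbrakk>\<And>p. p \<in> M \<Longrightarrow> E p \<in> H; h \<in> H\<rbrakk> \<Longrightarrow> ip (sum E M) h = (\<Sum>p\<in>M. ip (E p) h)"
  by (induction M rule: infinite_finite_induct) (auto simp: ip_add_left sum_in)

lemma nrm_ge_0 [simp]: "f \<in> H \<Longrightarrow> 0 \<le> nrm f"
  by (simp add: nrm_def ip_pos)

lemma nrm_sq: "f \<in> H \<Longrightarrow> (nrm f)\<^sup>2 = Re (ip f f)"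
  by (simp add: nrm_def ip_pos)

lemma ip_self: "f \<in> H \<Longrightarrow> ip f f = of_real ((nrm f)\<^sup>2)"
  using ip_cnj[of f f] by (simp add: nrm_sq complex_eq_iff)

lemma nrm_zero [simp]: "nrm 0 = 0"
  by (simp add: nrm_def)

lemma nrm_eq_0: "f \<in> H \<Longrightarrow> nrm f = 0 \<Longrightarrow> f = 0"
  using ip_definite nrm_sq by fastforce

lemma nrm_scale: "f \<in> H \<Longrightarrow> nrm (c *\<^sub>C f) = cmod c * nrm f"
proof -
  assume f: "f \<in> H"
  have "ip (c *\<^sub>C f) (c *\<^sub>C f) = (c * cnj c) * ip f f"
    using f by (simp add: ip_scale_left ip_scale_right)
  also have "\<dots> = of_real ((cmod c * nrm f)\<^sup>2)"
    by (simp only: ip_self[OF f] complex_norm_square[symmetric] of_real_mult[symmetric]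
        of_real_power[symmetric] power_mult_distrib)
  finally show ?thesis
    using f by (simp add: nrm_def[of "c *\<^sub>C f"] del: of_real_power)
qed

lemma cauchy_schwarz: assumes f: "f \<in> H" and g: "g \<in> H" shows "cmod (ip f g) \<le> nrm f * nrm g"
proof (cases "nrm g = 0")
  case True
  then have "g = 0" using g nrm_eq_0 by blast
  then have "ip f g = 0" using f ip_scale_right[of 0 f 0] by simp
  then show ?thesis using f g by simp
next
  case False
  define c where "c = ip f g / of_real ((nrm g)\<^sup>2)"
  have c: "c * of_real ((nrm g)\<^sup>2) = ip f g" using False by (simp add: c_def)
  have "ip (f - c *\<^sub>C g) (f - c *\<^sub>C g) = ip f f - cnj c * ip f g - c * (ip g f - cnj c * ip g g)"
    using f g by (simp add: ip_diff_left ip_diff_right ip_scale_left ip_scale_right algebra_simps)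
  also have "\<dots> = ip f f - cnj c * ip f g"
    using c ip_cnj[OF f g] ip_self[OF g] by (metis (no_types, lifting) complex_cnj_complex_of_real complex_cnj_mult
        diff_self diff_zero mult_zero_right)
  also have "cnj c * ip f g = of_real ((cmod (ip f g))\<^sup>2) / of_real ((nrm g)\<^sup>2)"
    by (simp only: c_def complex_cnj_divide complex_cnj_complex_of_real complex_norm_square
        times_divide_eq_left mult.commute[of "cnj _"])
  also have "ip f f - \<dots> = of_real ((nrm f)\<^sup>2 - (cmod (ip f g))\<^sup>2 / (nrm g)\<^sup>2)"
    by (simp add: ip_self[OF f])
  finally have "0 \<le> (nrm f)\<^sup>2 - (cmod (ip f g))\<^sup>2 / (nrm g)\<^sup>2"
    using ip_pos[of "f - c *\<^sub>C g"] f g by simp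
  then have "(cmod (ip f g))\<^sup>2 \<le> (nrm f * nrm g)\<^sup>2"
    using False g by (simp add: field_simps power_mult_distrib)
  then show ?thesis by (rule power2_le_imp_le) (use f g in simp)
qed

text \<open>Pairing the combination with itself and applying the discrete Cauchy-Schwarz inequality
  bounds synthesis by analysis. It serves in both directions: with an upper frame bound it estimates
  the synthesis, with a lower Riesz bound it estimates the analysis from below.\<close>

lemma nrm_comb_sq_le:
  assumes E: "\<And>p. p \<in> M \<Longrightarrow> E p \<in> H"
  shows "(nrm (\<Sum>p\<in>M. c p *\<^sub>C E p))\<^sup>2 \<le>
    L2_set (\<lambda>p. cmod (c p)) M * L2_set (\<lambda>p. cmod (ip (\<Sum>p\<in>M. c p *\<^sub>C E p) (E p))) M"
proof -
  define g where "g = (\<Sum>p\<in>M. c p *\<^sub>C E p)"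
  have gH: "g \<in> H" unfolding g_def using E by (intro sum_in) auto
  have "(nrm g)\<^sup>2 = Re (ip g g)" by (simp add: nrm_sq gH)
  also have "ip g g = (\<Sum>p\<in>M. ip (c p *\<^sub>C E p) g)"
    unfolding g_def by (rule ip_sum_left) (use E gH in \<open>auto simp: g_def\<close>)
  also have "\<dots> = (\<Sum>p\<in>M. c p * ip (E p) g)"
    by (rule sum.cong) (use E gH ip_scale_left in auto)
  also have "Re \<dots> \<le> cmod \<dots>" by (rule complex_Re_le_cmod)
  also have "\<dots> \<le> (\<Sum>p\<in>M. cmod (c p) * cmod (ip g (E p)))"
  proof (rule order_trans[OF norm_sum], rule sum_mono)
    fix p assume "p \<in> M"
    then have "cnj (ip g (E p)) = ip (E p) g" using ip_cnj[OF gH, of "E p"] E by auto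
    then have "cmod (ip (E p) g) = cmod (ip g (E p))" by (metis complex_mod_cnj)
    then show "cmod (c p * ip (E p) g) \<le> cmod (c p) * cmod (ip g (E p))" by (simp add: norm_mult)
  qed
  also have "\<dots> \<le> L2_set (\<lambda>p. cmod (c p)) M * L2_set (\<lambda>p. cmod (ip g (E p))) M"
    using L2_set_mult_ineq[of "\<lambda>p. cmod (c p)" "\<lambda>p. cmod (ip g (E p))" M] by simp
  finally show ?thesis unfolding g_def .
qed

lemma nrm_triangle: assumes f: "f \<in> H" and g: "g \<in> H" shows "nrm (f + g) \<le> nrm f + nrm g"
proof -
  have "(nrm (f + g))\<^sup>2 = (nrm f)\<^sup>2 + (nrm g)\<^sup>2 + 2 * Re (ip f g)"
    using f g ip_cnj[OF f g] by (simp add: nrm_sq ip_add_left ip_add_right flip: ip_cnj[OF f g])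
  also have "\<dots> \<le> (nrm f)\<^sup>2 + (nrm g)\<^sup>2 + 2 * (nrm f * nrm g)"
    using cauchy_schwarz[OF f g] complex_Re_le_cmod[of "ip f g"] by linarith
  also have "\<dots> = (nrm f + nrm g)\<^sup>2" by (simp add: power2_sum)
  finally show ?thesis by (rule power2_le_imp_le) (use f g in simp)
qed

lemma nrm_minus_commute: "\<lbrakk>f \<in> H; g \<in> H\<rbrakk> \<Longrightarrow> nrm (f - g) = nrm (g - f)"
  using nrm_scale[of "f - g" "-1"] by simp

lemma nrm_triangle_via: "\<lbrakk>f \<in> H; g \<in> H; h \<in> H\<rbrakk> \<Longrightarrow> nrm (f - h) \<le> nrm (f - g) + nrm (g - h)"
  using nrm_triangle[of "f - g" "g - h"] by simp

lemma nrm_triangle_diff: "\<lbrakk>f \<in> H; g \<in> H\<rbrakk> \<Longrightarrow> nrm f \<le> nrm (f - g) + nrm g"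
  using nrm_triangle_via[of f g 0] by simp

lemma ip_eqI: "\<lbrakk>f \<in> H; g \<in> H; \<And>h. h \<in> H \<Longrightarrow> ip f h = ip g h\<rbrakk> \<Longrightarrow> f = g"
  using ip_definite[of "f - g"] by (simp add: ip_diff_left)

section \<open>Closed spans and unconditional sums relative to the carrier\<close>

definition cspan :: "('p \<Rightarrow> 'v) \<Rightarrow> 'p set \<Rightarrow> 'v set" where
  "cspan E P = {f \<in> H. \<forall>\<epsilon>>0. \<exists>c M. finite M \<and> M \<subseteq> P \<and> nrm (f - (\<Sum>p\<in>M. c p *\<^sub>C E p)) < \<epsilon>}"

lemma cspan_in_H [simp]: "f \<in> cspan E P \<Longrightarrow> f \<in> H"
  by (simp add: cspan_def)

lemma cspan_approx:
  assumes "f \<in> cspan E P" "0 < \<epsilon>"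
  obtains c M where "finite M" "M \<subseteq> P" "nrm (f - (\<Sum>p\<in>M. c p *\<^sub>C E p)) < \<epsilon>"
  using assms unfolding cspan_def by auto

lemma comb_in_cspan:
  assumes E: "\<And>p. p \<in> P \<Longrightarrow> E p \<in> H" and M: "finite M" "M \<subseteq> P"
  shows "(\<Sum>p\<in>M. c p *\<^sub>C E p) \<in> cspan E P"
proof -
  have "(\<Sum>p\<in>M. c p *\<^sub>C E p) \<in> H" using E M by (intro sum_in) auto
  moreover have "nrm ((\<Sum>p\<in>M. c p *\<^sub>C E p) - (\<Sum>p\<in>M. c p *\<^sub>C E p)) = 0" by simp
  ultimately show ?thesis unfolding cspan_def using M
    by (intro CollectI conjI allI impI exI[of _ c] exI[of _ M]) simp_all
qed

lemma generator_in_cspan: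
  assumes "\<And>p. p \<in> P \<Longrightarrow> E p \<in> H" "p \<in> P"
  shows "E p \<in> cspan E P"
  using comb_in_cspan[of P E "{p}" "\<lambda>_. 1"] assms by simp

lemma cspan_closed:
  assumes E: "\<And>p. p \<in> P \<Longrightarrow> E p \<in> H" and f: "f \<in> H"
    and app: "\<And>e. e > 0 \<Longrightarrow> \<exists>g\<in>cspan E P. nrm (f - g) < e"
  shows "f \<in> cspan E P"
  unfolding cspan_def
proof safe
  fix e :: real assume "e > 0"
  then obtain g where g: "g \<in> cspan E P" "nrm (f - g) < e/2" using app[of "e/2"] by auto
  then obtain c M where cM: "finite M" "M \<subseteq> P" "nrm (g - (\<Sum>p\<in>M. c p *\<^sub>C E p)) < e/2"
    using \<open>e > 0\<close> by (elim cspan_approx[of _ _ _ "e/2"]) auto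
  have "(\<Sum>p\<in>M. c p *\<^sub>C E p) \<in> H" using E cM by (intro sum_in) auto
  then have "nrm (f - (\<Sum>p\<in>M. c p *\<^sub>C E p)) < e"
    using nrm_triangle_via[of f g "\<Sum>p\<in>M. c p *\<^sub>C E p"] f g cM by simp
  then show "\<exists>c M. finite M \<and> M \<subseteq> P \<and> nrm (f - (\<Sum>p\<in>M. c p *\<^sub>C E p)) < e"
    using cM by blast
qed (rule f)

lemma cspan_add:
  assumes E: "\<And>p. p \<in> P \<Longrightarrow> E p \<in> H" and f: "f \<in> cspan E P" and g: "g \<in> cspan E P"
  shows "f + g \<in> cspan E P"
proof (rule cspan_closed[OF E])
  show "f + g \<in> H" using f g by simp
  fix e :: real assume "e > 0"
  then have "e/2 > 0" by simp
  obtain c M where cM: "finite M" "M \<subseteq> P" "nrm (f - (\<Sum>p\<in>M. c p *\<^sub>C E p)) < e/2"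
    using cspan_approx[OF f \<open>e/2 > 0\<close>] .
  obtain d N where dN: "finite N" "N \<subseteq> P" "nrm (g - (\<Sum>p\<in>N. d p *\<^sub>C E p)) < e/2"
    using cspan_approx[OF g \<open>e/2 > 0\<close>] .
  define f' where "f' = (\<Sum>p\<in>M. c p *\<^sub>C E p)"
  define g' where "g' = (\<Sum>p\<in>N. d p *\<^sub>C E p)"
  have f': "f' \<in> H" and g': "g' \<in> H"
    using cM dN E unfolding f'_def g'_def by (auto intro!: sum_in)
  have "f' = (\<Sum>p\<in>M \<union> N. (if p \<in> M then c p else 0) *\<^sub>C E p)"
    unfolding f'_def using cM dN by (intro sum.mono_neutral_cong_left) auto
  moreover have "g' = (\<Sum>p\<in>M \<union> N. (if p \<in> N then d p else 0) *\<^sub>C E p)"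
    unfolding g'_def using cM dN by (intro sum.mono_neutral_cong_left) auto
  ultimately have "f' + g' = (\<Sum>p\<in>M \<union> N. ((if p \<in> M then c p else 0) + (if p \<in> N then d p else 0)) *\<^sub>C E p)"
    by (simp add: sum.distrib scale_left_distrib)
  then have "f' + g' \<in> cspan E P" using comb_in_cspan[where P = P and E = E and M = "M \<union> N"] E cM dN by auto
  moreover have "(f + g) - (f' + g') = (f - f') + (g - g')" by simp
  moreover have "nrm ((f - f') + (g - g')) < e"
    using nrm_triangle[of "f - f'" "g - g'"] cM(3) dN(3) f g f' g' unfolding f'_def[symmetric] g'_def[symmetric]
    by simp
  ultimately show "\<exists>h\<in>cspan E P. nrm (f + g - h) < e" by metis
qed

lemma cspan_scale:
  assumes E: "\<And>p. p \<in> P \<Longrightarrow> E p \<in> H" and f: "f \<in> cspan E P"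
  shows "a *\<^sub>C f \<in> cspan E P"
proof (rule cspan_closed[OF E])
  show "a *\<^sub>C f \<in> H" using f by simp
  fix e :: real assume e: "e > 0"
  \<comment> \<open>The added 1 keeps the denominator positive when \<open>a = 0\<close>.\<close>
  define d where "d = e / (cmod a + 1)"
  have "d > 0" using e by (simp add: d_def add_nonneg_pos)
  obtain c M where cM: "finite M" "M \<subseteq> P" "nrm (f - (\<Sum>p\<in>M. c p *\<^sub>C E p)) < d"
    using cspan_approx[OF f \<open>d > 0\<close>] .
  define f' where "f' = (\<Sum>p\<in>M. c p *\<^sub>C E p)"
  have f': "f' \<in> H" using cM E unfolding f'_def by (auto intro!: sum_in)
  have "a *\<^sub>C f' = (\<Sum>p\<in>M. (a * c p) *\<^sub>C E p)" by (simp add: f'_def scale_sum_right)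
  then have "a *\<^sub>C f' \<in> cspan E P" using comb_in_cspan[where P = P and E = E] E cM(1,2) by simp
  moreover have "nrm (a *\<^sub>C f - a *\<^sub>C f') = cmod a * nrm (f - f')"
    using f f' nrm_scale[of "f - f'" a] by (simp add: scale_right_diff_distrib)
  moreover have "cmod a * nrm (f - f') \<le> cmod a * d"
    using cM(3) by (intro mult_left_mono) (auto simp: f'_def)
  moreover have "cmod a * d < (cmod a + 1) * d" using \<open>d > 0\<close> by simp
  moreover have "(cmod a + 1) * d = e"
    using norm_ge_zero[of a] unfolding d_def by (simp del: norm_ge_zero)
  ultimately show "\<exists>h\<in>cspan E P. nrm (a *\<^sub>C f - h) < e" by (smt (verit))
qed

lemma subspace_cspan:
  assumes E: "\<And>p. p \<in> P \<Longrightarrow> E p \<in> H"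
  shows "subspace (cspan E P)"
proof -
  have "(0::'v) \<in> cspan E P" using comb_in_cspan[where P = P and E = E and M = "{}"] E by simp
  then show ?thesis using cspan_add[OF E] cspan_scale[OF E] by (auto simp: subspace_def)
qed

lemma cspan_least:
  assumes E: "\<And>p. p \<in> P \<Longrightarrow> E p \<in> H" and D: "\<And>q. q \<in> Q \<Longrightarrow> D q \<in> cspan E P"
  shows "cspan D Q \<subseteq> cspan E P"
proof
  fix f assume f: "f \<in> cspan D Q"
  show "f \<in> cspan E P"
  proof (rule cspan_closed[OF E])
    show "f \<in> H" using f by simp
    fix e :: real assume "e > 0"
    obtain c M where cM: "finite M" "M \<subseteq> Q" "nrm (f - (\<Sum>p\<in>M. c p *\<^sub>C D p)) < e"
      using cspan_approx[OF f \<open>e > 0\<close>] .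
    have "(\<Sum>p\<in>M. c p *\<^sub>C D p) \<in> cspan E P"
      using cM D by (intro subspace_sum[OF subspace_cspan[OF E]] cspan_scale[OF E]) auto
    then show "\<exists>g\<in>cspan E P. nrm (f - g) < e" using cM by blast
  qed
qed

text \<open>The type \<open>'v\<close> carries no topology, so convergence of the net of finite
  partial sums is expressed through real-valued distances. This is the shape of
  \<open>sobolev_has_sum\<close>, which becomes an instance.\<close>

definition usum :: "('p \<Rightarrow> 'v) \<Rightarrow> 'p set \<Rightarrow> 'v \<Rightarrow> bool" where
  "usum E P f \<longleftrightarrow> f \<in> H \<and> ((\<lambda>M. nrm (f - sum E M)) \<longlongrightarrow> 0) (finite_subsets_at_top P)"

lemma usum_in_H: "usum E P f \<Longrightarrow> f \<in> H"
  by (simp add: usum_def)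

text \<open>Continuity of the inner product in its first argument. It moves questions about series
  of vectors to complex series, where \<open>has_sum\<close> provides uniqueness, reindexing and
  conjugation.\<close>

lemma usum_ip:
  assumes f: "usum E P f" and E: "\<And>p. p \<in> P \<Longrightarrow> E p \<in> H" and g: "g \<in> H"
  shows "((\<lambda>p. ip (E p) g) has_sum ip f g) P"
  unfolding has_sum_def
proof (rule LIM_zero_cancel, rule tendsto_norm_zero_cancel)
  have "((\<lambda>M. nrm (f - sum E M) * nrm g) \<longlongrightarrow> 0) (finite_subsets_at_top P)"
    using f unfolding usum_def by (auto intro: tendsto_mult_left_zero)
  moreover have "\<forall>\<^sub>F M in finite_subsets_at_top P. norm (norm ((\<Sum>p\<in>M. ip (E p) g) - ip f g)) \<le> nrm (f - sum E M) * nrm g"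
  proof (rule eventually_finite_subsets_at_top_weakI)
    fix M assume M: "finite M" "M \<subseteq> P"
    then have sM: "sum E M \<in> H" using E by (intro sum_in) auto
    have "norm ((\<Sum>p\<in>M. ip (E p) g) - ip f g) = cmod (ip (f - sum E M) g)"
      using f M E g sM by (subst norm_minus_commute) (simp add: ip_diff_left usum_in_H ip_sum_left subset_iff)
    also have "\<dots> \<le> nrm (f - sum E M) * nrm g" using usum_in_H[OF f] sM g by (intro cauchy_schwarz) auto
    finally show "norm (norm ((\<Sum>p\<in>M. ip (E p) g) - ip f g)) \<le> nrm (f - sum E M) * nrm g" by simp
  qed
  ultimately show "((\<lambda>M. norm ((\<Sum>p\<in>M. ip (E p) g) - ip f g)) \<longlongrightarrow> 0) (finite_subsets_at_top P)"
    by (rule Lim_null_comparison[rotated])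
qed

lemma usum_unique:
  assumes "usum E P f" "usum E P g" and E: "\<And>p. p \<in> P \<Longrightarrow> E p \<in> H"
  shows "f = g"
proof (rule ip_eqI)
  show "f \<in> H" "g \<in> H" using assms by (auto simp: usum_def)
  fix h assume "h \<in> H"
  then show "ip f h = ip g h" using usum_ip[OF assms(1) E] usum_ip[OF assms(2) E] has_sum_unique by blast
qed

lemma usum_approx:
  assumes "usum E P f" "e > 0"
  shows "\<exists>M. finite M \<and> M \<subseteq> P \<and> nrm (f - sum E M) < e"
proof -
  have "\<forall>\<^sub>F M in finite_subsets_at_top P. nrm (f - sum E M) < e"
    using assms unfolding usum_def by (auto dest: order_tendstoD(2))
  then show ?thesis unfolding eventually_finite_subsets_at_top by blast
qed

text \<open>On finite partial sums additivity suffices to commute with \<open>T\<close>, and the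
  bound passes to the limit. The map is only controlled on the subspace \<open>V\<close> because it
  will be applied to \<open>finv\<close>.\<close>

lemma usum_image:
  assumes f: "usum E P f" and E: "\<And>p. p \<in> P \<Longrightarrow> E p \<in> V" and V: "subspace V" "V \<subseteq> H" "f \<in> V"
    and T: "\<And>x. x \<in> V \<Longrightarrow> T x \<in> H" "\<And>x y. \<lbrakk>x \<in> V; y \<in> V\<rbrakk> \<Longrightarrow> T (x + y) = T x + T y"
    and bound: "\<And>x. x \<in> V \<Longrightarrow> nrm (T x) \<le> C * nrm x"
  shows "usum (\<lambda>p. T (E p)) P (T f)"
  unfolding usum_def
proof (intro conjI)
  show "T f \<in> H" using T V by blast
  have T0: "T 0 = 0" using T(2)[of 0 0] V by (simp add: subspace_0)
  have Tdiff: "T (x - y) = T x - T y" if "x \<in> V" "y \<in> V" for x y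
    using T(2)[of "x - y" y] that V by (simp add: subspace_diff)
  have Tsum: "T (sum E M) = (\<Sum>p\<in>M. T (E p)) \<and> sum E M \<in> V" if "finite M" "M \<subseteq> P" for M
    using that by (induction M rule: finite_induct) (auto simp: T0 T(2) E V subspace_0 subspace_add)
  have "((\<lambda>M. C * nrm (f - sum E M)) \<longlongrightarrow> 0) (finite_subsets_at_top P)"
    using f unfolding usum_def by (auto intro: tendsto_mult_right_zero)
  moreover have "\<forall>\<^sub>F M in finite_subsets_at_top P. norm (nrm (T f - (\<Sum>p\<in>M. T (E p)))) \<le> C * nrm (f - sum E M)"
  proof (rule eventually_finite_subsets_at_top_weakI)
    fix M assume M: "finite M" "M \<subseteq> P"
    have "T f - (\<Sum>p\<in>M. T (E p)) = T (f - sum E M)" using Tsum[OF M] Tdiff V by simp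
    moreover have "f - sum E M \<in> V" using Tsum[OF M] V by (simp add: subspace_diff)
    ultimately show "norm (nrm (T f - (\<Sum>p\<in>M. T (E p)))) \<le> C * nrm (f - sum E M)"
      using bound[of "f - sum E M"] T(1) by simp
  qed
  ultimately show "((\<lambda>M. nrm (T f - (\<Sum>p\<in>M. T (E p)))) \<longlongrightarrow> 0) (finite_subsets_at_top P)"
    by (rule Lim_null_comparison[rotated])
qed

text \<open>Completeness is given for sequences, while the index set is arbitrary. Choosing a finite
  set \<open>K n\<close> with tails below 1/(n+1) produces a Cauchy sequence of partial sums; the
  tail condition then shows that the whole net has the same limit.\<close>

lemma usum_Cauchy:
  assumes E: "\<And>p. p \<in> P \<Longrightarrow> E p \<in> H"
    and tail: "\<And>e. e > 0 \<Longrightarrow> \<exists>M0. finite M0 \<and> M0 \<subseteq> P \<and>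
        (\<forall>M. finite M \<longrightarrow> M \<subseteq> P \<longrightarrow> M \<inter> M0 = {} \<longrightarrow> nrm (sum E M) < e)"
  shows "\<exists>f. usum E P f"
proof -
  have "\<forall>n. \<exists>M0. finite M0 \<and> M0 \<subseteq> P \<and>
        (\<forall>M. finite M \<longrightarrow> M \<subseteq> P \<longrightarrow> M \<inter> M0 = {} \<longrightarrow> nrm (sum E M) < inverse (real (Suc n)))"
    by (intro allI tail) simp
  from choice[OF this] obtain K where KK: "\<forall>n. finite (K n) \<and> K n \<subseteq> P \<and>
        (\<forall>M. finite M \<longrightarrow> M \<subseteq> P \<longrightarrow> M \<inter> K n = {} \<longrightarrow> nrm (sum E M) < inverse (real (Suc n)))" ..
  have K: "finite (K n)" "K n \<subseteq> P" for n using KK by auto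
  have Kt: "nrm (sum E M) < inverse (real (Suc n))" if "finite M" "M \<subseteq> P" "M \<inter> K n = {}" for n M
    using KK that by blast
  define X where "X n = sum E (K n)" for n
  have sH: "sum E M \<in> H" if "M \<subseteq> P" for M using that E by (intro sum_in) auto
  have X: "X n \<in> H" for n using K sH by (simp add: X_def)
  \<comment> \<open>The sets \<open>K n\<close> are not nested. After the common part is cancelled,
    \<open>K i - K j\<close> avoids \<open>K j\<close> and \<open>K j - K i\<close> avoids
    \<open>K i\<close>, so each leftover sum is a tail for one of the two tolerances.\<close>
  have dist: "nrm (X i - X j) < inverse (real (Suc i)) + inverse (real (Suc j))" for i j
  proof -
    have "X i = sum E (K i - K j) + sum E (K i \<inter> K j)" "X j = sum E (K j - K i) + sum E (K i \<inter> K j)"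
      unfolding X_def using sum.Int_Diff[of "K i" E "K j"] sum.Int_Diff[of "K j" E "K i"] K
      by (simp_all add: add.commute Int_commute)
    then have "X i - X j = sum E (K i - K j) - sum E (K j - K i)" by simp
    moreover have "sum E (K i - K j) \<in> H" "sum E (K j - K i) \<in> H" using K by (auto intro!: sH)
    ultimately have "nrm (X i - X j) \<le> nrm (sum E (K i - K j)) + nrm (sum E (K j - K i))"
      using nrm_triangle_via[of "sum E (K i - K j)" 0 "sum E (K j - K i)"]
        nrm_minus_commute[of 0 "sum E (K j - K i)"] by simp
    moreover have "nrm (sum E (K i - K j)) < inverse (real (Suc j))" "nrm (sum E (K j - K i)) < inverse (real (Suc i))"
      using K by (auto intro!: Kt simp del: of_nat_Suc)
    ultimately show ?thesis by linarith
  qed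
  have "\<exists>f\<in>H. (\<lambda>n. nrm (X n - f)) \<longlonglongrightarrow> 0"
  proof (rule complete[OF X])
    fix e :: real assume "e > 0"
    then obtain m where m: "inverse (real (Suc m)) < e/2" using reals_Archimedean[of "e/2"] by auto
    have "nrm (X i - X j) < e" if "i \<ge> m" "j \<ge> m" for i j
    proof -
      have "inverse (real (Suc i)) \<le> inverse (real (Suc m))" "inverse (real (Suc j)) \<le> inverse (real (Suc m))"
        using that by (auto intro!: le_imp_inverse_le)
      then show ?thesis using dist[of i j] m by linarith
    qed
    then show "\<exists>m. \<forall>i\<ge>m. \<forall>j\<ge>m. nrm (X i - X j) < e" by blast
  qed
  then obtain f where f: "f \<in> H" "(\<lambda>n. nrm (X n - f)) \<longlonglongrightarrow> 0" by blast
  have "((\<lambda>M. nrm (f - sum E M)) \<longlongrightarrow> 0) (finite_subsets_at_top P)"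
  proof (rule tendstoI)
    fix e :: real assume "e > 0"
    then have "\<forall>\<^sub>F n in sequentially. nrm (X n - f) < e/2" using order_tendstoD(2)[OF f(2), of "e/2"] by simp
    moreover have "\<forall>\<^sub>F n in sequentially. inverse (real (Suc n)) < e/2"
      using order_tendstoD(2)[OF LIMSEQ_inverse_real_of_nat, of "e/2"] \<open>e > 0\<close> by simp
    ultimately have "\<forall>\<^sub>F n in sequentially. nrm (X n - f) < e/2 \<and> inverse (real (Suc n)) < e/2"
      by eventually_elim simp
    then obtain n where n: "nrm (X n - f) < e/2" "inverse (real (Suc n)) < e/2"
      using eventually_happens'[OF sequentially_bot] by blast
    show "\<forall>\<^sub>F M in finite_subsets_at_top P. dist (nrm (f - sum E M)) 0 < e"
      unfolding eventually_finite_subsets_at_top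
    proof (intro exI[of _ "K n"] conjI allI impI K)
      fix M assume M: "finite M \<and> K n \<subseteq> M \<and> M \<subseteq> P"
      have "sum E M = sum E (M - K n) + X n"
        unfolding X_def using M K by (simp add: sum.subset_diff)
      then have "X n - sum E M = 0 - sum E (M - K n)" by simp
      then have "nrm (X n - sum E M) = nrm (sum E (M - K n))"
        using nrm_minus_commute[of 0 "sum E (M - K n)"] sH[of "M - K n"] M by auto
      also have "\<dots> < inverse (real (Suc n))" using M by (intro Kt) auto
      finally have "nrm (X n - sum E M) < e/2" using n by linarith
      moreover have "nrm (f - sum E M) \<le> nrm (X n - f) + nrm (X n - sum E M)"
        using nrm_triangle_via[of f "X n" "sum E M"] nrm_minus_commute[of f "X n"] f X sH M by simp
      ultimately have "nrm (f - sum E M) < e" using n by linarith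
      then show "dist (nrm (f - sum E M)) 0 < e" using f sH M by auto
    qed
  qed
  then show ?thesis using f unfolding usum_def by blast
qed

end

section \<open>Frames, the frame operator and its inverse\<close>

locale cframe = chilbert scale H ip nrm
  for scale :: "complex \<Rightarrow> 'v::ab_group_add \<Rightarrow> 'v" (infixr "*\<^sub>C" 75)
    and H :: "'v set" and ip :: "'v \<Rightarrow> 'v \<Rightarrow> complex" and nrm :: "'v \<Rightarrow> real" +
  fixes E :: "'p \<Rightarrow> 'v" and P :: "'p set" and A B :: real
  assumes E_in: "p \<in> P \<Longrightarrow> E p \<in> H"
    and A_pos: "0 < A" and A_le_B: "A \<le> B"
    and frame_summable: "f \<in> cspan E P \<Longrightarrow> (\<lambda>p. (cmod (ip f (E p)))\<^sup>2) summable_on P"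
    and frame_lower: "f \<in> cspan E P \<Longrightarrow> A * (nrm f)\<^sup>2 \<le> (\<Sum>\<^sub>\<infinity>p\<in>P. (cmod (ip f (E p)))\<^sup>2)"
    and frame_upper: "f \<in> cspan E P \<Longrightarrow> (\<Sum>\<^sub>\<infinity>p\<in>P. (cmod (ip f (E p)))\<^sup>2) \<le> B * (nrm f)\<^sup>2"
begin

abbreviation S :: "'v set" where "S \<equiv> cspan E P"

lemma B_pos: "0 < B" using A_pos A_le_B by simp

lemma subspace_S: "subspace S" using subspace_cspan E_in by blast

lemma E_in_S: "p \<in> P \<Longrightarrow> E p \<in> S" using generator_in_cspan E_in by metis

lemma S_closed: "\<lbrakk>f \<in> H; \<And>e. e > 0 \<Longrightarrow> \<exists>g\<in>S. nrm (f - g) < e\<rbrakk> \<Longrightarrow> f \<in> S"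
  using cspan_closed[of P E f] E_in by blast

lemma S_add: "\<lbrakk>f \<in> S; g \<in> S\<rbrakk> \<Longrightarrow> f + g \<in> S"
  and S_diff: "\<lbrakk>f \<in> S; g \<in> S\<rbrakk> \<Longrightarrow> f - g \<in> S"
  and S_scale: "f \<in> S \<Longrightarrow> c *\<^sub>C f \<in> S"
  and S_zero: "0 \<in> S"
  using subspace_S by (auto intro: subspace_0 subspace_add subspace_diff subspace_scale)

lemma comb_in_S: "\<lbrakk>finite M; M \<subseteq> P\<rbrakk> \<Longrightarrow> (\<Sum>p\<in>M. c p *\<^sub>C E p) \<in> S"
  using comb_in_cspan[where P = P and E = E] E_in by blast

text \<open>Synthesis is adjoint to analysis and so has norm at most \<open>sqrt B\<close>: in
  \<open>nrm_comb_sq_le\<close> the analysis factor is at most \<open>sqrt B * nrm g\<close>, and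
  one factor \<open>nrm g\<close> cancels.\<close>

lemma nrm_comb_le:
  assumes M: "finite M" "M \<subseteq> P"
  shows "nrm (\<Sum>p\<in>M. c p *\<^sub>C E p) \<le> sqrt (B * (\<Sum>p\<in>M. (cmod (c p))\<^sup>2))"
proof -
  define g where "g = (\<Sum>p\<in>M. c p *\<^sub>C E p)"
  have gS: "g \<in> S" unfolding g_def by (rule comb_in_S[OF M])
  then have gH: "g \<in> H" by simp
  have "(nrm g)\<^sup>2 \<le> L2_set (\<lambda>p. cmod (c p)) M * L2_set (\<lambda>p. cmod (ip g (E p))) M"
    unfolding g_def by (rule nrm_comb_sq_le) (use M E_in in auto)
  also have "L2_set (\<lambda>p. cmod (ip g (E p))) M \<le> sqrt (B * (nrm g)\<^sup>2)"
    unfolding L2_set_def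
    using finite_sum_le_infsum[OF frame_summable[OF gS] M] frame_upper[OF gS] by simp
  then have "L2_set (\<lambda>p. cmod (c p)) M * L2_set (\<lambda>p. cmod (ip g (E p))) M
      \<le> L2_set (\<lambda>p. cmod (c p)) M * sqrt (B * (nrm g)\<^sup>2)" by (simp add: mult_left_mono)
  also have "\<dots> = (L2_set (\<lambda>p. cmod (c p)) M * sqrt B) * nrm g"
    using gH by (simp add: real_sqrt_mult)
  finally have *: "(nrm g)\<^sup>2 \<le> (L2_set (\<lambda>p. cmod (c p)) M * sqrt B) * nrm g" .
  have "nrm g \<le> L2_set (\<lambda>p. cmod (c p)) M * sqrt B"
  proof (cases "nrm g = 0")
    case False
    then have "nrm g > 0" using gH nrm_ge_0[of g] by linarith
    then show ?thesis using * by (simp add: power2_eq_square)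
  qed (simp add: B_pos less_imp_le)
  then show ?thesis by (simp add: g_def L2_set_def real_sqrt_mult mult.commute)
qed

lemma synthesis_converges:
  assumes c: "(\<lambda>p. (cmod (c p))\<^sup>2) summable_on P"
  shows "\<exists>f. usum (\<lambda>p. c p *\<^sub>C E p) P f"
proof (rule usum_Cauchy)
  show "c p *\<^sub>C E p \<in> H" if "p \<in> P" for p using that E_in by simp
  fix e :: real assume e: "e > 0"
  define a where "a = (\<Sum>\<^sub>\<infinity>p\<in>P. (cmod (c p))\<^sup>2)"
  have lim: "(sum (\<lambda>p. (cmod (c p))\<^sup>2) \<longlongrightarrow> a) (finite_subsets_at_top P)"
    using has_sum_infsum[OF c] unfolding a_def has_sum_def .
  \<comment> \<open>The threshold is chosen so that the coefficients outside \<open>M0\<close> have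
    square sum below e^2/B, which \<open>nrm_comb_le\<close> turns into a norm below
    \<open>e\<close>.\<close>
  have "a - e\<^sup>2 / B < a" using e B_pos by simp
  from order_tendstoD(1)[OF lim this]
  obtain M0 where M0: "finite M0" "M0 \<subseteq> P" "a - e\<^sup>2 / B < (\<Sum>p\<in>M0. (cmod (c p))\<^sup>2)"
    unfolding eventually_finite_subsets_at_top by blast
  have "nrm (\<Sum>p\<in>M. c p *\<^sub>C E p) < e" if M: "finite M" "M \<subseteq> P" "M \<inter> M0 = {}" for M
  proof -
    have "(\<Sum>p\<in>M \<union> M0. (cmod (c p))\<^sup>2) \<le> a"
      unfolding a_def using M M0 by (intro finite_sum_le_infsum[OF c]) auto
    then have "(\<Sum>p\<in>M. (cmod (c p))\<^sup>2) < e\<^sup>2 / B"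
      using M M0 by (simp add: sum.union_disjoint)
    then have "B * (\<Sum>p\<in>M. (cmod (c p))\<^sup>2) < e\<^sup>2"
      using B_pos by (simp add: field_simps)
    then have "sqrt (B * (\<Sum>p\<in>M. (cmod (c p))\<^sup>2)) < e"
      using e real_sqrt_less_mono by fastforce
    then show ?thesis using nrm_comb_le[OF M(1,2), of c] by linarith
  qed
  then show "\<exists>M0. finite M0 \<and> M0 \<subseteq> P \<and> (\<forall>M. finite M \<longrightarrow> M \<subseteq> P \<longrightarrow> M \<inter> M0 = {} \<longrightarrow>
      nrm (\<Sum>p\<in>M. c p *\<^sub>C E p) < e)" using M0 by blast
qed

lemma usum_comb_in_S:
  assumes "usum (\<lambda>p. c p *\<^sub>C E p) P f" shows "f \<in> S"
proof (rule S_closed)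
  show "f \<in> H" using assms by (rule usum_in_H)
  fix e :: real assume "e > 0"
  from usum_approx[OF assms this] obtain M where "finite M" "M \<subseteq> P" "nrm (f - (\<Sum>p\<in>M. c p *\<^sub>C E p)) < e"
    by blast
  then show "\<exists>g\<in>S. nrm (f - g) < e" using comb_in_S by blast
qed

text \<open>The description copies that of \<open>frame_operator\<close>, so the two agree as
  functions everywhere, also at arguments outside \<open>S\<close>.\<close>

definition fop :: "'v \<Rightarrow> 'v" where
  "fop f = (THE g. usum (\<lambda>p. ip f (E p) *\<^sub>C E p) P g)"

lemma fop_usum: assumes "f \<in> S" shows "usum (\<lambda>p. ip f (E p) *\<^sub>C E p) P (fop f)"
proof -
  obtain g where g: "usum (\<lambda>p. ip f (E p) *\<^sub>C E p) P g"
    using synthesis_converges[OF frame_summable[OF assms]] by blast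
  show ?thesis unfolding fop_def
  proof (rule theI[where a = g])
    show "usum (\<lambda>p. ip f (E p) *\<^sub>C E p) P g" by (rule g)
    fix h assume "usum (\<lambda>p. ip f (E p) *\<^sub>C E p) P h"
    then show "h = g" using usum_unique[OF _ g] E_in by simp
  qed
qed

lemma fop_in_S: "f \<in> S \<Longrightarrow> fop f \<in> S"
  using fop_usum[of f] by (rule usum_comb_in_S)

lemma fop_in_H [simp]: "f \<in> S \<Longrightarrow> fop f \<in> H"
  using fop_in_S cspan_in_H by blast

lemma fop_has_sum: assumes f: "f \<in> S" and g: "g \<in> H"
  shows "((\<lambda>p. ip f (E p) * ip (E p) g) has_sum ip (fop f) g) P"
proof -
  have "((\<lambda>p. ip (ip f (E p) *\<^sub>C E p) g) has_sum ip (fop f) g) P"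
    by (rule usum_ip[OF fop_usum[OF f]]) (use E_in g in auto)
  then show ?thesis by (rule has_sum_cong[THEN iffD1, rotated]) (simp add: ip_scale_left E_in g)
qed

text \<open>Linearity is checked weakly: against a fixed vector \<open>h\<close> the frame operator
  is a complex series, whose terms are linear in \<open>f\<close>.\<close>

lemma fop_add: assumes f: "f \<in> S" and g: "g \<in> S" shows "fop (f + g) = fop f + fop g"
proof (rule ip_eqI)
  fix h assume h: "h \<in> H"
  have "((\<lambda>p. ip f (E p) * ip (E p) h + ip g (E p) * ip (E p) h) has_sum ip (fop f) h + ip (fop g) h) P"
    by (intro has_sum_add fop_has_sum f g h)
  then have "((\<lambda>p. ip (f + g) (E p) * ip (E p) h) has_sum ip (fop f) h + ip (fop g) h) P"
    by (rule has_sum_cong[THEN iffD1, rotated]) (use f g E_in in \<open>simp add: ip_add_left algebra_simps\<close>)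
  then show "ip (fop (f + g)) h = ip (fop f + fop g) h"
    using has_sum_unique[OF fop_has_sum[OF S_add[OF f g] h]] f g h by (simp add: ip_add_left)
qed (use f g S_add in auto)

lemma fop_scale: assumes f: "f \<in> S" shows "fop (c *\<^sub>C f) = c *\<^sub>C fop f"
proof (rule ip_eqI)
  fix h assume h: "h \<in> H"
  have "((\<lambda>p. c * (ip f (E p) * ip (E p) h)) has_sum c * ip (fop f) h) P"
    by (intro has_sum_cmult_right fop_has_sum f h)
  then have "((\<lambda>p. ip (c *\<^sub>C f) (E p) * ip (E p) h) has_sum c * ip (fop f) h) P"
    by (rule has_sum_cong[THEN iffD1, rotated]) (use f E_in in \<open>simp add: ip_scale_left\<close>)
  then show "ip (fop (c *\<^sub>C f)) h = ip (c *\<^sub>C fop f) h"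
    using has_sum_unique[OF fop_has_sum[OF S_scale[OF f] h]] f h by (simp add: ip_scale_left)
qed (use f S_scale in auto)

lemma fop_diff: "\<lbrakk>f \<in> S; g \<in> S\<rbrakk> \<Longrightarrow> fop (f - g) = fop f - fop g"
  using fop_add[of "f - g" g] S_diff by simp

lemma fop_sym: assumes f: "f \<in> S" and g: "g \<in> S" shows "ip (fop f) g = ip f (fop g)"
proof -
  have "((\<lambda>p. cnj (ip g (E p) * ip (E p) f)) has_sum cnj (ip (fop g) f)) P"
    using fop_has_sum[OF g, of f] f by (subst has_sum_cnj_iff) simp
  moreover have "cnj (ip (fop g) f) = ip f (fop g)" using f g ip_cnj by simp
  ultimately have "((\<lambda>p. ip f (E p) * ip (E p) g) has_sum ip f (fop g)) P"
    by (subst has_sum_cong[where g = "\<lambda>p. cnj (ip g (E p) * ip (E p) f)"])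
       (use f g E_in in \<open>simp_all add: ip_cnj mult.commute\<close>)
  then show ?thesis using has_sum_unique[OF fop_has_sum[OF f, of g]] g by simp
qed

text \<open>Testing \<open>fop f\<close> against \<open>f\<close> itself reproduces the frame sum,
  so the frame inequalities become bounds on the quadratic form of \<open>fop\<close>.\<close>

lemma fop_energy: assumes f: "f \<in> S"
  shows "((\<lambda>p. (cmod (ip f (E p)))\<^sup>2) has_sum Re (ip (fop f) f)) P"
proof -
  have "((\<lambda>p. of_real ((cmod (ip f (E p)))\<^sup>2) :: complex) has_sum ip (fop f) f) P"
  proof (rule has_sum_cong[THEN iffD1, OF _ fop_has_sum[OF f, of f]])
    fix p assume "p \<in> P"
    then have "ip (E p) f = cnj (ip f (E p))" using f E_in ip_cnj by simp
    then show "ip f (E p) * ip (E p) f = of_real ((cmod (ip f (E p)))\<^sup>2)"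
      by (simp only: complex_norm_square)
  qed (use f in simp)
  then have "((\<lambda>p. Re (of_real ((cmod (ip f (E p)))\<^sup>2))) has_sum Re (ip (fop f) f)) P"
    by (rule has_sum_Re)
  then show ?thesis by simp
qed

lemma fop_lower: "f \<in> S \<Longrightarrow> A * (nrm f)\<^sup>2 \<le> Re (ip (fop f) f)"
  using frame_lower infsumI[OF fop_energy] by metis

lemma fop_upper: "f \<in> S \<Longrightarrow> Re (ip (fop f) f) \<le> B * (nrm f)\<^sup>2"
  using frame_upper infsumI[OF fop_energy] by metis

text \<open>The vector \<open>fop f\<close> is the synthesis of the coefficients of
  \<open>f\<close>; synthesis costs a factor \<open>sqrt B\<close>, and the square sum of the
  coefficients is the quadratic form. Keeping the quadratic form, instead of passing to
  \<open>B * nrm f\<close>, is what later yields the sharp lower constant \<open>inverse B\<close>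
  for the dual frame.\<close>

lemma fop_sq_le: assumes f: "f \<in> S" shows "(nrm (fop f))\<^sup>2 \<le> B * Re (ip (fop f) f)"
proof -
  let ?R = "Re (ip (fop f) f)"
  have "nrm (fop f) \<le> sqrt (B * ?R)"
  proof (rule field_le_epsilon)
    fix e :: real assume "e > 0"
    from usum_approx[OF fop_usum[OF f] this] obtain M where
      M: "finite M" "M \<subseteq> P" "nrm (fop f - (\<Sum>p\<in>M. ip f (E p) *\<^sub>C E p)) < e" by blast
    have "(\<Sum>p\<in>M. (cmod (ip f (E p)))\<^sup>2) \<le> ?R"
      using M by (intro finite_sum_le_has_sum[OF fop_energy[OF f]]) auto
    then have "sqrt (B * (\<Sum>p\<in>M. (cmod (ip f (E p)))\<^sup>2)) \<le> sqrt (B * ?R)" using B_pos by simp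
    then have "nrm (\<Sum>p\<in>M. ip f (E p) *\<^sub>C E p) \<le> sqrt (B * ?R)"
      using nrm_comb_le[OF M(1,2), of "\<lambda>p. ip f (E p)"] by linarith
    then show "nrm (fop f) \<le> sqrt (B * ?R) + e"
      using nrm_triangle_diff[OF fop_in_H[OF f] cspan_in_H[OF comb_in_S[OF M(1,2), of "\<lambda>p. ip f (E p)"]]] M(3)
      by linarith
  qed
  moreover have "0 \<le> A * (nrm f)\<^sup>2" using A_pos by simp
  then have "0 \<le> B * ?R" using fop_lower[OF f] B_pos by simp
  moreover have "0 \<le> nrm (fop f)" using f by simp
  ultimately show ?thesis using power_mono[of "nrm (fop f)" "sqrt (B * ?R)" 2] by simp
qed

lemma fop_bound: assumes f: "f \<in> S" shows "nrm (fop f) \<le> B * nrm f"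
proof -
  have "(nrm (fop f))\<^sup>2 \<le> B * (B * (nrm f)\<^sup>2)"
    using fop_sq_le[OF f] mult_left_mono[OF fop_upper[OF f], of B] B_pos by linarith
  also have "\<dots> = (B * nrm f)\<^sup>2" by (simp add: power2_eq_square)
  finally show ?thesis by (rule power2_le_imp_le) (use f B_pos in simp)
qed

lemma fop_below: assumes f: "f \<in> S" shows "A * nrm f \<le> nrm (fop f)"
proof (cases "nrm f = 0")
  case False
  have fH: "f \<in> H" using f by simp
  have pos: "nrm f > 0" using False nrm_ge_0[OF fH] by linarith
  have "A * (nrm f)\<^sup>2 \<le> cmod (ip (fop f) f)"
    using fop_lower[OF f] complex_Re_le_cmod[of "ip (fop f) f"] by linarith
  also have "\<dots> \<le> nrm (fop f) * nrm f" using f by (intro cauchy_schwarz) auto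
  finally show ?thesis using pos by (simp add: power2_eq_square mult.assoc[symmetric])
qed (use f in simp)

lemma geometric_Cauchy:
  fixes X :: "nat \<Rightarrow> 'v"
  assumes X: "\<And>n. X n \<in> H" and q: "0 \<le> q" "q < 1" and step: "\<And>n. nrm (X (Suc n) - X n) \<le> C * q ^ n"
  shows "\<exists>f\<in>H. (\<lambda>n. nrm (X n - f)) \<longlonglongrightarrow> 0"
proof (rule complete[OF X])
  have C: "C \<ge> 0" using order_trans[OF nrm_ge_0[OF diff_in[OF X X]] step[of 0]] by simp
  have bound: "nrm (X (m + k) - X m) \<le> C * q ^ m / (1 - q)" for m k
  proof -
    have "nrm (X (m + k) - X m) \<le> (\<Sum>i<k. C * q ^ (m + i))"
    proof (induction k)
      case (Suc k)
      have "nrm (X (m + Suc k) - X m) \<le> nrm (X (Suc (m + k)) - X (m + k)) + nrm (X (m + k) - X m)"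
        using nrm_triangle_via[of "X (Suc (m + k))" "X (m + k)" "X m"] X by simp
      then show ?case using Suc step[of "m + k"] by simp
    qed simp
    also have "\<dots> = C * q ^ m * (\<Sum>i<k. q ^ i)" by (simp add: sum_distrib_left power_add mult.assoc)
    also have "(\<Sum>i<k. q ^ i) \<le> 1 / (1 - q)"
      using q sum_le_suminf[of "\<lambda>i. q ^ i" "{..<k}"] by (simp add: suminf_geometric summable_geometric)
    then have "C * q ^ m * (\<Sum>i<k. q ^ i) \<le> C * q ^ m * (1 / (1 - q))"
      using C q by (intro mult_left_mono) auto
    finally show ?thesis by simp
  qed
  fix e :: real assume "e > 0"
  have "(\<lambda>m. C * q ^ m / (1 - q)) \<longlonglongrightarrow> C * 0 / (1 - q)"
    using q by (intro tendsto_intros LIMSEQ_realpow_zero) auto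
  then have "\<forall>\<^sub>F m in sequentially. C * q ^ m / (1 - q) < e/2"
    using order_tendstoD(2)[of "\<lambda>m. C * q ^ m / (1 - q)" 0 sequentially "e/2"] \<open>e > 0\<close> by simp
  then obtain m where m: "C * q ^ m / (1 - q) < e/2"
    using eventually_happens'[OF sequentially_bot] by blast
  have near: "nrm (X i - X m) < e/2" if "i \<ge> m" for i
    using order.strict_trans1[OF bound[of m "i - m"] m] that by simp
  have "nrm (X i - X j) < e" if "i \<ge> m" "j \<ge> m" for i j
    using nrm_triangle_via[of "X i" "X m" "X j"] nrm_minus_commute[of "X m" "X j"] near[of i] near[of j] that X
    by simp
  then show "\<exists>m. \<forall>i\<ge>m. \<forall>j\<ge>m. nrm (X i - X j) < e" by blast
qed

text \<open>Solves \<open>fop x = g\<close> by Richardson iteration: with \<open>\<tau> = A / B\<^sup>2\<close> the map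
  \<open>x \<mapsto> x - \<tau> (fop x - g)\<close> is a contraction, because \<open>fop\<close> is coercive and bounded.\<close>

lemma fop_surj: assumes g: "g \<in> S" shows "\<exists>x\<in>S. fop x = g"
proof -
  \<comment> \<open>This value minimises 1 - 2 \<tau> A + \<tau>^2 B^2, the bound on the squared
    contraction factor; the minimum is 1 - A^2/B^2, the square of \<open>q\<close> below.\<close>
  define \<tau> where "\<tau> = A / B\<^sup>2"
  have \<tau>: "\<tau> > 0" using A_pos B_pos by (simp add: \<tau>_def)
  define q where "q = sqrt (1 - A\<^sup>2 / B\<^sup>2)"
  have AB: "A\<^sup>2 / B\<^sup>2 \<le> 1" "A\<^sup>2 / B\<^sup>2 > 0" using A_pos A_le_B B_pos by (auto simp: power_mono)
  then have q: "0 \<le> q" "q < 1" by (auto simp: q_def)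
  have contr: "nrm (d - complex_of_real \<tau> *\<^sub>C fop d) \<le> q * nrm d" if d: "d \<in> S" for d
  proof (rule power2_le_imp_le)
    have dH: "d \<in> H" using d by simp
    have re: "Re (ip d (fop d)) = Re (ip (fop d) d)"
      using d by (simp flip: ip_cnj[of "fop d" d])
    have "(nrm (d - complex_of_real \<tau> *\<^sub>C fop d))\<^sup>2 =
        (nrm d)\<^sup>2 - 2 * \<tau> * Re (ip (fop d) d) + \<tau>\<^sup>2 * (nrm (fop d))\<^sup>2"
    proof -
      have mem: "d - complex_of_real \<tau> *\<^sub>C fop d \<in> H" using d by simp
      have "ip (d - complex_of_real \<tau> *\<^sub>C fop d) (d - complex_of_real \<tau> *\<^sub>C fop d) =
          ip d d - of_real \<tau> * ip d (fop d) - of_real \<tau> * (ip (fop d) d - of_real \<tau> * ip (fop d) (fop d))"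
        using d by (simp add: ip_diff_left ip_diff_right ip_scale_left ip_scale_right algebra_simps)
      then have "Re (ip (d - complex_of_real \<tau> *\<^sub>C fop d) (d - complex_of_real \<tau> *\<^sub>C fop d)) =
          Re (ip d d) - \<tau> * Re (ip d (fop d)) - \<tau> * (Re (ip (fop d) d) - \<tau> * Re (ip (fop d) (fop d)))"
        by simp
      then show ?thesis unfolding nrm_sq[OF mem] nrm_sq[OF dH] nrm_sq[OF fop_in_H[OF d]] re
        by (simp add: power2_eq_square algebra_simps)
    qed
    also have "\<dots> \<le> (nrm d)\<^sup>2 - 2 * \<tau> * (A * (nrm d)\<^sup>2) + \<tau>\<^sup>2 * (B * nrm d)\<^sup>2"
    proof -
      have "2 * \<tau> * (A * (nrm d)\<^sup>2) \<le> 2 * \<tau> * Re (ip (fop d) d)"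
        using \<tau> fop_lower[OF d] by (intro mult_left_mono) auto
      moreover have "\<tau>\<^sup>2 * (nrm (fop d))\<^sup>2 \<le> \<tau>\<^sup>2 * (B * nrm d)\<^sup>2"
        using fop_bound[OF d] d by (intro mult_left_mono power_mono) auto
      ultimately show ?thesis by linarith
    qed
    also have "\<dots> = (1 - A\<^sup>2 / B\<^sup>2) * (nrm d)\<^sup>2"
    proof -
      have "\<tau> * A = A\<^sup>2 / B\<^sup>2" by (simp add: \<tau>_def power2_eq_square)
      moreover have "\<tau>\<^sup>2 * B\<^sup>2 = A\<^sup>2 / B\<^sup>2" using B_pos by (simp add: \<tau>_def power2_eq_square)
      moreover have "(nrm d)\<^sup>2 - 2 * \<tau> * (A * (nrm d)\<^sup>2) + \<tau>\<^sup>2 * (B * nrm d)\<^sup>2 =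
          (nrm d)\<^sup>2 * (1 - 2 * (\<tau> * A) + \<tau>\<^sup>2 * B\<^sup>2)"
        by (simp add: power_mult_distrib algebra_simps)
      ultimately show ?thesis by (simp add: mult.commute)
    qed
    also have "\<dots> = (q * nrm d)\<^sup>2" using AB by (simp add: q_def power_mult_distrib)
    finally show "(nrm (d - complex_of_real \<tau> *\<^sub>C fop d))\<^sup>2 \<le> (q * nrm d)\<^sup>2" .
    show "0 \<le> q * nrm d" using q dH by simp
  qed
  define K where "K x = x - complex_of_real \<tau> *\<^sub>C (fop x - g)" for x
  have KS: "K x \<in> S" if "x \<in> S" for x
    unfolding K_def using that g by (intro S_diff S_scale fop_in_S)
  have Kdiff: "nrm (K x - K y) \<le> q * nrm (x - y)" if x: "x \<in> S" and y: "y \<in> S" for x y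
  proof -
    have "K x - K y = (x - y) - complex_of_real \<tau> *\<^sub>C fop (x - y)"
      using x y by (simp add: K_def fop_diff scale_right_diff_distrib)
    then show ?thesis using contr[OF S_diff[OF x y]] by simp
  qed
  define X where "X n = (K ^^ n) 0" for n
  have XS: "X n \<in> S" for n by (induction n) (auto simp: X_def S_zero KS)
  then have XH: "X n \<in> H" for n using cspan_in_H by blast
  have XSuc: "X (Suc n) = K (X n)" for n by (simp add: X_def)
  have step: "nrm (X (Suc n) - X n) \<le> nrm (X 1 - X 0) * q ^ n" for n
  proof (induction n)
    case (Suc n)
    have "nrm (X (Suc (Suc n)) - X (Suc n)) \<le> q * nrm (X (Suc n) - X n)"
      using Kdiff[OF XS XS, of "Suc n" n] by (simp add: XSuc)
    also have "\<dots> \<le> q * (nrm (X 1 - X 0) * q ^ n)" using Suc q by (intro mult_left_mono) auto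
    finally show ?case by (simp add: mult_ac)
  qed simp
  from geometric_Cauchy[OF XH q step] obtain x where x: "x \<in> H" "(\<lambda>n. nrm (X n - x)) \<longlonglongrightarrow> 0" by blast
  have xS: "x \<in> S"
  proof (rule S_closed[OF x(1)])
    fix e :: real assume "e > 0"
    from order_tendstoD(2)[OF x(2) this] obtain n where "nrm (X n - x) < e"
      using eventually_happens'[OF sequentially_bot] by blast
    then show "\<exists>g\<in>S. nrm (x - g) < e" using XS nrm_minus_commute[OF x(1) XH] by metis
  qed
  have Kx: "K x = x"
  proof -
    have lim: "(\<lambda>n. q * nrm (X n - x) + nrm (X (Suc n) - x)) \<longlonglongrightarrow> q * 0 + 0"
      using x(2) by (intro tendsto_intros LIMSEQ_Suc) auto
    have "nrm (K x - x) \<le> q * nrm (X n - x) + nrm (X (Suc n) - x)" for n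
    proof -
      have KxH: "K x \<in> H" using KS[OF xS] by simp
      have "nrm (K x - x) \<le> nrm (K x - X (Suc n)) + nrm (X (Suc n) - x)"
        by (rule nrm_triangle_via[OF KxH XH x(1)])
      moreover have "nrm (K x - X (Suc n)) \<le> q * nrm (X n - x)"
        using Kdiff[OF xS XS, of n] nrm_minus_commute[OF x(1) XH, of n] by (simp add: XSuc)
      ultimately show ?thesis by linarith
    qed
    then have "nrm (K x - x) \<le> q * 0 + 0" by (intro LIMSEQ_le_const[OF lim]) auto
    moreover have "0 \<le> nrm (K x - x)" using KS[OF xS] x(1) by simp
    ultimately have "nrm (K x - x) = 0" by linarith
    then show ?thesis using nrm_eq_0[of "K x - x"] KS[OF xS] x(1) by simp
  qed
  then have "complex_of_real \<tau> *\<^sub>C (fop x - g) = 0" by (simp add: K_def)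
  then have "fop x = g" using \<tau> by (simp add: scale_eq_0_iff)
  then show ?thesis using xS by blast
qed

lemma fop_inj: "inj_on fop S"
proof (rule inj_onI)
  fix x y assume x: "x \<in> S" and y: "y \<in> S" and eq: "fop x = fop y"
  have "A * nrm (x - y) \<le> 0" using fop_below[OF S_diff[OF x y]] x y eq by (simp add: fop_diff)
  then have "nrm (x - y) \<le> 0" using A_pos by (simp add: mult_le_0_iff)
  moreover have "0 \<le> nrm (x - y)" using x y by simp
  ultimately have "nrm (x - y) = 0" by linarith
  then show "x = y" using nrm_eq_0[of "x - y"] x y by simp
qed

lemma fop_bij: "bij_betw fop S S"
  using fop_inj fop_surj fop_in_S by (auto simp: bij_betw_def image_iff)

definition finv :: "'v \<Rightarrow> 'v" where "finv = inv_into S fop"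

lemma finv_in_S: "g \<in> S \<Longrightarrow> finv g \<in> S"
  and fop_finv: "g \<in> S \<Longrightarrow> fop (finv g) = g"
  and finv_fop: "f \<in> S \<Longrightarrow> finv (fop f) = f"
  unfolding finv_def using fop_bij
  by (auto simp: bij_betw_def inv_into_into f_inv_into_f inv_into_f_f)

lemma finv_in_H [simp]: "g \<in> S \<Longrightarrow> finv g \<in> H"
  using finv_in_S cspan_in_H by blast

lemma finv_add: "\<lbrakk>f \<in> S; g \<in> S\<rbrakk> \<Longrightarrow> finv (f + g) = finv f + finv g"
  using fop_add[of "finv f" "finv g"] finv_fop[of "finv f + finv g"] by (simp add: finv_in_S fop_finv S_add)

lemma finv_scale: "f \<in> S \<Longrightarrow> finv (c *\<^sub>C f) = c *\<^sub>C finv f"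
  using fop_scale[of "finv f" c] finv_fop[of "c *\<^sub>C finv f"] by (simp add: finv_in_S fop_finv S_scale)

lemma finv_sym: "\<lbrakk>f \<in> S; g \<in> S\<rbrakk> \<Longrightarrow> ip (finv f) g = ip f (finv g)"
  using fop_sym[of "finv f" "finv g"] by (simp add: finv_in_S fop_finv)

lemma finv_bound: "f \<in> S \<Longrightarrow> nrm (finv f) \<le> inverse A * nrm f"
  using fop_below[of "finv f"] A_pos by (simp add: finv_in_S fop_finv field_simps)

lemma dual_expansion_1: assumes f: "f \<in> S" shows "usum (\<lambda>p. ip f (finv (E p)) *\<^sub>C E p) P f"
proof -
  have "usum (\<lambda>p. ip (finv f) (E p) *\<^sub>C E p) P f"
    using fop_usum[OF finv_in_S[OF f]] by (simp add: fop_finv[OF f])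
  moreover have "usum (\<lambda>p. ip (finv f) (E p) *\<^sub>C E p) P f \<longleftrightarrow> usum (\<lambda>p. ip f (finv (E p)) *\<^sub>C E p) P f"
    unfolding usum_def
    by (intro conj_cong refl tendsto_cong eventually_finite_subsets_at_top_weakI)
       (auto intro!: arg_cong[where f = nrm] sum.cong simp: finv_sym f E_in_S subset_iff)
  ultimately show ?thesis by blast
qed

text \<open>The bounded map \<open>finv\<close> is applied termwise to the series defining
  \<open>fop f\<close>.\<close>

lemma dual_expansion_2: assumes f: "f \<in> S" shows "usum (\<lambda>p. ip f (E p) *\<^sub>C finv (E p)) P f"
proof -
  have "usum (\<lambda>p. finv (ip f (E p) *\<^sub>C E p)) P (finv (fop f))"
    by (rule usum_image[OF fop_usum[OF f] _ subspace_S _ _ _ _ finv_bound])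
       (auto simp: S_scale E_in_S fop_in_S f finv_add)
  moreover have "usum (\<lambda>p. finv (ip f (E p) *\<^sub>C E p)) P f \<longleftrightarrow> usum (\<lambda>p. ip f (E p) *\<^sub>C finv (E p)) P f"
    unfolding usum_def
    by (intro conj_cong refl tendsto_cong eventually_finite_subsets_at_top_weakI)
       (auto intro!: arg_cong[where f = nrm] sum.cong simp: finv_scale E_in_S subset_iff)
  ultimately show ?thesis by (simp add: finv_fop f)
qed

text \<open>The inclusion of \<open>S\<close> holds because the second dual expansion approximates
  each vector of \<open>S\<close> by finite combinations of the dual family.\<close>

lemma cspan_dual: "cspan (\<lambda>p. finv (E p)) P = S"
proof
  show "cspan (\<lambda>p. finv (E p)) P \<subseteq> S"
    by (rule cspan_least) (auto simp: E_in finv_in_S E_in_S)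
  show "S \<subseteq> cspan (\<lambda>p. finv (E p)) P"
  proof
    fix f assume f: "f \<in> S"
    show "f \<in> cspan (\<lambda>p. finv (E p)) P"
      unfolding cspan_def
    proof safe
      show "f \<in> H" using f by simp
      fix e :: real assume "e > 0"
      from usum_approx[OF dual_expansion_2[OF f] this]
      show "\<exists>c M. finite M \<and> M \<subseteq> P \<and> nrm (f - (\<Sum>p\<in>M. c p *\<^sub>C finv (E p))) < e"
        by (rule exI[of _ "\<lambda>p. ip f (E p)"])
    qed
  qed
qed

lemma dual_energy: assumes f: "f \<in> S"
  shows "((\<lambda>p. (cmod (ip f (finv (E p))))\<^sup>2) has_sum Re (ip f (finv f))) P"
proof -
  have "((\<lambda>p. (cmod (ip (finv f) (E p)))\<^sup>2) has_sum Re (ip (fop (finv f)) (finv f))) P"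
    by (rule fop_energy[OF finv_in_S[OF f]])
  then show ?thesis unfolding fop_finv[OF f]
    by (rule has_sum_cong[THEN iffD1, rotated]) (simp add: finv_sym f E_in_S)
qed

lemma dual_bounds: assumes f: "f \<in> S"
  shows "inverse B * (nrm f)\<^sup>2 \<le> (\<Sum>\<^sub>\<infinity>p\<in>P. (cmod (ip f (finv (E p))))\<^sup>2)"
    and "(\<Sum>\<^sub>\<infinity>p\<in>P. (cmod (ip f (finv (E p))))\<^sup>2) \<le> inverse A * (nrm f)\<^sup>2"
proof -
  have eq: "(\<Sum>\<^sub>\<infinity>p\<in>P. (cmod (ip f (finv (E p))))\<^sup>2) = Re (ip f (finv f))"
    using infsumI[OF dual_energy[OF f]] .
  show "inverse B * (nrm f)\<^sup>2 \<le> (\<Sum>\<^sub>\<infinity>p\<in>P. (cmod (ip f (finv (E p))))\<^sup>2)"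
    using fop_sq_le[OF finv_in_S[OF f]] B_pos unfolding eq fop_finv[OF f] by (simp add: field_simps)
  have "Re (ip f (finv f)) \<le> nrm f * nrm (finv f)"
    using cauchy_schwarz[of f "finv f"] complex_Re_le_cmod[of "ip f (finv f)"] f by simp
  also have "\<dots> \<le> nrm f * (inverse A * nrm f)"
    using f by (intro mult_left_mono finv_bound) auto
  finally show "(\<Sum>\<^sub>\<infinity>p\<in>P. (cmod (ip f (finv (E p))))\<^sup>2) \<le> inverse A * (nrm f)\<^sup>2"
    unfolding eq by (simp add: power2_eq_square mult_ac)
qed

lemma fop_commute:
  assumes U: "\<And>f. f \<in> H \<Longrightarrow> U f \<in> H" "\<And>f g. \<lbrakk>f \<in> H; g \<in> H\<rbrakk> \<Longrightarrow> U (f + g) = U f + U g"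
      "\<And>c f. f \<in> H \<Longrightarrow> U (c *\<^sub>C f) = c *\<^sub>C U f" "\<And>f g. \<lbrakk>f \<in> H; g \<in> H\<rbrakk> \<Longrightarrow> ip (U f) (U g) = ip f g"
      "U ` H = H"
    and \<pi>: "bij_betw \<pi> P P" "\<And>p. p \<in> P \<Longrightarrow> U (E p) = E (\<pi> p)"
    and f: "f \<in> S"
  shows "U f \<in> S" and "fop (U f) = U (fop f)"
proof -
  have \<pi>P: "\<pi> p \<in> P" if "p \<in> P" for p using that \<pi>(1) by (auto simp: bij_betw_def)
  have U0: "U 0 = 0" using U(3)[of 0 0] by simp
  have Udiff: "U (x - y) = U x - U y" if "x \<in> H" "y \<in> H" for x y
    using U(2)[of "x - y" y] that by simp
  have Unrm: "nrm (U x) = nrm x" if "x \<in> H" for x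
    using U(4)[OF that that] by (simp add: nrm_def)
  show Uf: "U f \<in> S"
  proof (rule S_closed)
    show "U f \<in> H" using U(1) f by simp
    fix e :: real assume "e > 0"
    obtain c M where cM: "finite M" "M \<subseteq> P" "nrm (f - (\<Sum>p\<in>M. c p *\<^sub>C E p)) < e"
      using cspan_approx[OF f \<open>e > 0\<close>] .
    have "U (\<Sum>p\<in>M. c p *\<^sub>C E p) = (\<Sum>p\<in>M. c p *\<^sub>C E (\<pi> p)) \<and> (\<Sum>p\<in>M. c p *\<^sub>C E p) \<in> H"
      using cM(1,2) by (induction M rule: finite_induct) (auto simp: U0 U(2,3) \<pi>(2) E_in)
    moreover have "(\<Sum>p\<in>M. c p *\<^sub>C E (\<pi> p)) \<in> S"
      using cM by (intro subspace_sum[OF subspace_S] S_scale E_in_S \<pi>P) auto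
    ultimately have "U (\<Sum>p\<in>M. c p *\<^sub>C E p) \<in> S" "nrm (U f - U (\<Sum>p\<in>M. c p *\<^sub>C E p)) < e"
      using cM(3) f Udiff[of f "\<Sum>p\<in>M. c p *\<^sub>C E p"] Unrm[of "f - (\<Sum>p\<in>M. c p *\<^sub>C E p)"] by auto
    then show "\<exists>g\<in>S. nrm (U f - g) < e" by blast
  qed
  show "fop (U f) = U (fop f)"
  proof (rule ip_eqI)
    show "fop (U f) \<in> H" "U (fop f) \<in> H" using Uf f U(1) by auto
    fix h assume "h \<in> H"
    then obtain k where k: "k \<in> H" "h = U k" using U(5) by blast
    have "((\<lambda>p. ip (U f) (E (\<pi> p)) * ip (E (\<pi> p)) (U k)) has_sum ip (fop f) k) P"
    proof (rule has_sum_cong[THEN iffD1, OF _ fop_has_sum[OF f k(1)]])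
      fix p assume "p \<in> P"
      then show "ip f (E p) * ip (E p) k = ip (U f) (E (\<pi> p)) * ip (E (\<pi> p)) (U k)"
        using U(4)[of f "E p"] U(4)[of "E p" k] \<pi>(2)[of p] f k E_in by simp
    qed
    then have "((\<lambda>p. ip (U f) (E p) * ip (E p) (U k)) has_sum ip (fop f) k) P"
      by (subst (asm) has_sum_reindex_bij_betw[OF \<pi>(1)])
    then have "ip (fop (U f)) h = ip (fop f) k"
      using has_sum_unique[OF fop_has_sum[OF Uf, of h]] k U(1) by simp
    also have "\<dots> = ip (U (fop f)) h" using U(4)[of "fop f" k] f k by simp
    finally show "ip (fop (U f)) h = ip (U (fop f)) h" .
  qed
qed

lemma finv_commute:
  assumes U: "\<And>f. f \<in> H \<Longrightarrow> U f \<in> H" "\<And>f g. \<lbrakk>f \<in> H; g \<in> H\<rbrakk> \<Longrightarrow> U (f + g) = U f + U g"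
      "\<And>c f. f \<in> H \<Longrightarrow> U (c *\<^sub>C f) = c *\<^sub>C U f" "\<And>f g. \<lbrakk>f \<in> H; g \<in> H\<rbrakk> \<Longrightarrow> ip (U f) (U g) = ip f g"
      "U ` H = H"
    and \<pi>: "bij_betw \<pi> P P" "\<And>p. p \<in> P \<Longrightarrow> U (E p) = E (\<pi> p)"
    and f: "f \<in> S"
  shows "finv (U f) = U (finv f)"
proof -
  note comm = fop_commute[where U = U, OF U \<pi> finv_in_S[OF f]]
  have "fop (U (finv f)) = U f" using comm(2) by (simp add: fop_finv[OF f])
  then show ?thesis using finv_fop[OF comm(1)] by simp
qed

end

section \<open>From Riesz bounds to frame bounds\<close>

context chilbert
begin

text \<open>The upper Riesz bound limits the norm of synthesis, hence of its adjoint, and gives a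
  Bessel inequality on all of \<open>H\<close>. For the lower frame bound, a finite combination
  already has large enough coefficients over its own index set, by \<open>nrm_comb_sq_le\<close> and
  the lower Riesz bound; density then extends the inequality to the closed span.\<close>

lemma riesz_imp_frame:
  assumes E: "\<And>p. p \<in> P \<Longrightarrow> E p \<in> H" and AB: "0 < A" "A \<le> B"
    and R: "\<And>c M. \<lbrakk>finite M; M \<subseteq> P\<rbrakk> \<Longrightarrow>
      A * (\<Sum>p\<in>M. (cmod (c p))\<^sup>2) \<le> (nrm (\<Sum>p\<in>M. c p *\<^sub>C E p))\<^sup>2 \<and>
      (nrm (\<Sum>p\<in>M. c p *\<^sub>C E p))\<^sup>2 \<le> B * (\<Sum>p\<in>M. (cmod (c p))\<^sup>2)"
  shows "cframe scale H ip nrm E P A B"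
proof -
  have B: "B > 0" using AB by simp
  have comb_H: "(\<Sum>p\<in>M. c p *\<^sub>C E p) \<in> H" if "M \<subseteq> P" for c M using that E by (intro sum_in) auto
  have bessel: "(\<Sum>p\<in>M. (cmod (ip f (E p)))\<^sup>2) \<le> B * (nrm f)\<^sup>2"
    if f: "f \<in> H" and M: "finite M" "M \<subseteq> P" for f M
  proof -
    \<comment> \<open>Duality with the vector \<open>g\<close> built from the coefficients of
      \<open>f\<close> themselves: \<open>s\<close> equals |<g, f>|, so s <= sqrt(B s) |f|, and
      squaring allows division by \<open>s\<close>.\<close>
    define s where "s = (\<Sum>p\<in>M. (cmod (ip f (E p)))\<^sup>2)"
    define g where "g = (\<Sum>p\<in>M. ip f (E p) *\<^sub>C E p)"
    have s0: "s \<ge> 0" by (simp add: s_def sum_nonneg)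
    have gH: "g \<in> H" unfolding g_def by (rule comb_H[OF M(2)])
    have "ip g f = (\<Sum>p\<in>M. ip (ip f (E p) *\<^sub>C E p) f)"
      unfolding g_def by (rule ip_sum_left) (use M E f in auto)
    also have "\<dots> = (\<Sum>p\<in>M. of_real ((cmod (ip f (E p)))\<^sup>2))"
    proof (rule sum.cong)
      fix p assume "p \<in> M"
      then have p: "E p \<in> H" using E M by auto
      then show "ip (ip f (E p) *\<^sub>C E p) f = of_real ((cmod (ip f (E p)))\<^sup>2)"
        unfolding complex_norm_square using ip_cnj[OF f p] f by (simp add: ip_scale_left)
    qed simp
    finally have "s = cmod (ip g f)" using s0 by (simp add: s_def flip: of_real_sum of_real_power)
    also have "\<dots> \<le> nrm g * nrm f" by (rule cauchy_schwarz[OF gH f])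
    also have "nrm g \<le> sqrt (B * s)"
      using R[OF M, of "\<lambda>p. ip f (E p)"] unfolding g_def[symmetric] s_def[symmetric]
      by (simp add: real_le_rsqrt)
    then have "nrm g * nrm f \<le> sqrt (B * s) * nrm f" using f by (simp add: mult_right_mono)
    finally have "s\<^sup>2 \<le> (sqrt (B * s) * nrm f)\<^sup>2" using s0 by (intro power_mono)
    also have "\<dots> = s * (B * (nrm f)\<^sup>2)" using s0 B by (simp add: power_mult_distrib mult_ac)
    finally have "s * s \<le> s * (B * (nrm f)\<^sup>2)" by (simp add: power2_eq_square)
    then show ?thesis
    proof (cases "s = 0")
      case True then show ?thesis using B f by (simp add: s_def)
    next
      case False
      then show ?thesis using \<open>s * s \<le> _\<close> s0 unfolding s_def by (metis mult_le_cancel_left_pos order_le_imp_less_or_eq)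
    qed
  qed
  show ?thesis
  proof (unfold_locales)
    fix f assume f: "f \<in> cspan E P"
    then have fH: "f \<in> H" by simp
    show sm: "(\<lambda>p. (cmod (ip f (E p)))\<^sup>2) summable_on P"
      by (rule nonneg_bdd_above_summable_on) (auto intro!: bdd_aboveI2 bessel[OF fH])
    show "(\<Sum>\<^sub>\<infinity>p\<in>P. (cmod (ip f (E p)))\<^sup>2) \<le> B * (nrm f)\<^sup>2"
      by (rule infsum_le_finite_sums[OF sm]) (auto intro: bessel[OF fH])
    define a where "a = (\<Sum>\<^sub>\<infinity>p\<in>P. (cmod (ip f (E p)))\<^sup>2)"
    have a0: "a \<ge> 0" unfolding a_def by (rule infsum_nonneg) simp
    have "sqrt A * nrm f \<le> sqrt a"
    proof (rule field_le_epsilon)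
      fix e :: real assume e: "e > 0"
      \<comment> \<open>Replacing \<open>f\<close> by the combination \<open>g\<close> costs
        \<open>sqrt B * d\<close> in the coefficients and \<open>sqrt A * d\<close> in the norm;
        together these make up \<open>e\<close>.\<close>
      define d where "d = e / (sqrt A + sqrt B)"
      have sAB: "sqrt A + sqrt B > 0" using AB B by (simp add: add_pos_pos)
      have d: "d > 0" using e sAB by (simp add: d_def)
      obtain c M where M: "finite M" "M \<subseteq> P" and close: "nrm (f - (\<Sum>p\<in>M. c p *\<^sub>C E p)) < d"
        using cspan_approx[OF f d] .
      define g where "g = (\<Sum>p\<in>M. c p *\<^sub>C E p)"
      have gH: "g \<in> H" unfolding g_def by (rule comb_H[OF M(2)])
      have an: "L2_set (\<lambda>p. cmod (ip h (E p))) M \<le> sqrt B * nrm h" if "h \<in> H" for h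
        using bessel[OF that M] B that unfolding L2_set_def
        by (metis nrm_ge_0 real_sqrt_le_iff real_sqrt_mult real_sqrt_abs abs_of_nonneg)
      have "sqrt A * nrm g \<le> L2_set (\<lambda>p. cmod (ip g (E p))) M"
      proof (cases "nrm g = 0")
        case False
        then have pos: "nrm g > 0" using nrm_ge_0[OF gH] by linarith
        have *: "(nrm g)\<^sup>2 \<le> L2_set (\<lambda>p. cmod (c p)) M * L2_set (\<lambda>p. cmod (ip g (E p))) M"
          unfolding g_def by (rule nrm_comb_sq_le) (use M E in auto)
        have "sqrt A * L2_set (\<lambda>p. cmod (c p)) M \<le> nrm g"
          using R[OF M, of c] gH unfolding g_def[symmetric] L2_set_def
          by (metis nrm_ge_0 real_le_lsqrt real_sqrt_le_iff real_sqrt_mult real_sqrt_abs abs_of_nonneg)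
        then have "(sqrt A * L2_set (\<lambda>p. cmod (c p)) M) * L2_set (\<lambda>p. cmod (ip g (E p))) M
            \<le> nrm g * L2_set (\<lambda>p. cmod (ip g (E p))) M" by (simp add: mult_right_mono)
        moreover have "sqrt A * (nrm g)\<^sup>2 \<le> sqrt A * (L2_set (\<lambda>p. cmod (c p)) M * L2_set (\<lambda>p. cmod (ip g (E p))) M)"
          using * AB by (intro mult_left_mono) auto
        ultimately have "nrm g * (sqrt A * nrm g) \<le> nrm g * L2_set (\<lambda>p. cmod (ip g (E p))) M"
          by (simp add: power2_eq_square mult_ac)
        then show ?thesis using pos by simp
      qed simp
      also have "\<dots> \<le> L2_set (\<lambda>p. cmod (ip f (E p)) + cmod (ip (f - g) (E p))) M"
      proof (rule L2_set_mono)
        fix p assume "p \<in> M"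
        then have "ip g (E p) = ip f (E p) - ip (f - g) (E p)" using fH gH E M by (simp add: ip_diff_left subset_iff)
        then show "cmod (ip g (E p)) \<le> cmod (ip f (E p)) + cmod (ip (f - g) (E p))"
          by (metis norm_triangle_ineq4)
      qed simp
      also have "\<dots> \<le> L2_set (\<lambda>p. cmod (ip f (E p))) M + L2_set (\<lambda>p. cmod (ip (f - g) (E p))) M"
        by (rule L2_set_triangle_ineq)
      also have "\<dots> \<le> sqrt a + sqrt B * d"
      proof -
        have "L2_set (\<lambda>p. cmod (ip f (E p))) M \<le> sqrt a"
          unfolding L2_set_def a_def using finite_sum_le_infsum[OF sm M] by simp
        moreover have "L2_set (\<lambda>p. cmod (ip (f - g) (E p))) M \<le> sqrt B * nrm (f - g)"
          using fH gH by (intro an) simp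
        moreover have "sqrt B * nrm (f - g) \<le> sqrt B * d" using close B by (simp add: g_def mult_left_mono)
        ultimately show ?thesis by linarith
      qed
      finally have 1: "sqrt A * nrm g \<le> sqrt a + sqrt B * d" .
      have "nrm f \<le> d + nrm g" using nrm_triangle_diff[OF fH gH] close by (simp add: g_def)
      then have "sqrt A * nrm f \<le> sqrt A * (d + nrm g)" using AB by (intro mult_left_mono) auto
      then have "sqrt A * nrm f \<le> sqrt a + (sqrt A + sqrt B) * d" using 1 by (simp add: algebra_simps)
      also have "(sqrt A + sqrt B) * d = e" using sAB by (simp add: d_def)
      finally show "sqrt A * nrm f \<le> sqrt a + e" .
    qed
    then have "(sqrt A * nrm f)\<^sup>2 \<le> (sqrt a)\<^sup>2" using AB fH by (intro power_mono) auto
    then show "A * (nrm f)\<^sup>2 \<le> (\<Sum>\<^sub>\<infinity>p\<in>P. (cmod (ip f (E p)))\<^sup>2)"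
      using AB a0 by (simp add: power_mult_distrib a_def)
  qed (use E AB in auto)
qed

end

context cframe
begin

text \<open>The lower Riesz bound makes expansion coefficients unique, so \<open>E\<close> and \<open>finv \<circ> E\<close> are
  biorthogonal.\<close>

lemma riesz_biorthogonal:
  assumes R: "\<And>c M. \<lbrakk>finite M; M \<subseteq> P\<rbrakk> \<Longrightarrow>
      A * (\<Sum>p\<in>M. (cmod (c p))\<^sup>2) \<le> (nrm (\<Sum>p\<in>M. c p *\<^sub>C E p))\<^sup>2"
    and pq: "p \<in> P" "q \<in> P"
  shows "ip (E q) (finv (E p)) = (if p = q then 1 else 0)"
proof -
  \<comment> \<open>The difference between the dual expansion of \<open>E q\<close> and its trivial
    expansion with a single coefficient 1. It represents zero, so its partial sums have small norm,
    and the lower Riesz bound makes every coefficient small.\<close>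
  define d where "d r = ip (E q) (finv (E r)) - (if r = q then 1 else 0)" for r
  have "A * (cmod (d p))\<^sup>2 \<le> 0"
  proof (rule field_le_epsilon)
    fix e :: real assume e: "e > 0"
    have u: "((\<lambda>M. nrm (E q - (\<Sum>r\<in>M. ip (E q) (finv (E r)) *\<^sub>C E r))) \<longlongrightarrow> 0) (finite_subsets_at_top P)"
      using dual_expansion_1[OF E_in_S[OF pq(2)]] unfolding usum_def by blast
    have "\<forall>\<^sub>F M in finite_subsets_at_top P. nrm (E q - (\<Sum>r\<in>M. ip (E q) (finv (E r)) *\<^sub>C E r)) < sqrt e"
      using order_tendstoD(2)[OF u, of "sqrt e"] e by simp
    then obtain M0 where M0: "finite M0" "M0 \<subseteq> P" "\<And>M. finite M \<Longrightarrow> M0 \<subseteq> M \<Longrightarrow> M \<subseteq> P \<Longrightarrow>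
        nrm (E q - (\<Sum>r\<in>M. ip (E q) (finv (E r)) *\<^sub>C E r)) < sqrt e"
      unfolding eventually_finite_subsets_at_top by metis
    \<comment> \<open>The index \<open>p\<close> is added so that \<open>d p\<close> is among the
      coefficients counted, and \<open>q\<close> so that the trivial expansion is complete.\<close>
    define M where "M = M0 \<union> {p, q}"
    have M: "finite M" "M \<subseteq> P" "p \<in> M" "q \<in> M" using M0(1,2) pq by (auto simp: M_def)
    have M0M: "M0 \<subseteq> M" by (auto simp: M_def)
    have comb_H: "(\<Sum>r\<in>M. ip (E q) (finv (E r)) *\<^sub>C E r) \<in> H"
      by (rule cspan_in_H[OF comb_in_S[OF M(1,2)]])
    have "(\<Sum>r\<in>M. d r *\<^sub>C E r) = (\<Sum>r\<in>M. ip (E q) (finv (E r)) *\<^sub>C E r) - E q"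
    proof -
      have "(\<Sum>r\<in>M. (if r = q then 1 else 0) *\<^sub>C E r) = (\<Sum>r\<in>M. if r = q then E r else 0)"
        by (rule sum.cong) auto
      also have "\<dots> = E q" using M by simp
      finally show ?thesis by (simp add: d_def scale_left_diff_distrib sum_subtractf)
    qed
    then have "nrm (\<Sum>r\<in>M. d r *\<^sub>C E r) < sqrt e"
      using M0(3)[OF M(1) M0M M(2)] nrm_minus_commute[OF E_in[OF pq(2)] comb_H] by simp
    moreover have "0 \<le> nrm (\<Sum>r\<in>M. d r *\<^sub>C E r)"
      by (rule nrm_ge_0[OF cspan_in_H[OF comb_in_S[OF M(1,2)]]])
    ultimately have "(nrm (\<Sum>r\<in>M. d r *\<^sub>C E r))\<^sup>2 \<le> (sqrt e)\<^sup>2"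
      by (intro power_mono) auto
    then have "(nrm (\<Sum>r\<in>M. d r *\<^sub>C E r))\<^sup>2 \<le> e" using e by simp
    moreover have "(cmod (d p))\<^sup>2 \<le> (\<Sum>r\<in>M. (cmod (d r))\<^sup>2)"
      using M by (intro member_le_sum) auto
    then have "A * (cmod (d p))\<^sup>2 \<le> A * (\<Sum>r\<in>M. (cmod (d r))\<^sup>2)" using A_pos by simp
    ultimately show "A * (cmod (d p))\<^sup>2 \<le> 0 + e" using R[OF M(1,2), of d] by linarith
  qed
  then have "(cmod (d p))\<^sup>2 \<le> 0" using A_pos by (simp add: mult_le_0_iff)
  then have "d p = 0" by simp
  then show ?thesis by (simp add: d_def)
qed

text \<open>By biorthogonality the coefficients of \<open>h\<close> against the original family are
  exactly the \<open>c p\<close>. The frame inequality for \<open>h\<close> therefore reads A |h|^2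
  <= sum |c p|^2 <= B |h|^2, which is the dual Riesz inequality rearranged.\<close>

lemma riesz_dual:
  assumes R: "\<And>c M. \<lbrakk>finite M; M \<subseteq> P\<rbrakk> \<Longrightarrow>
      A * (\<Sum>p\<in>M. (cmod (c p))\<^sup>2) \<le> (nrm (\<Sum>p\<in>M. c p *\<^sub>C E p))\<^sup>2"
    and M: "finite M" "M \<subseteq> P"
  shows "inverse B * (\<Sum>p\<in>M. (cmod (c p))\<^sup>2) \<le> (nrm (\<Sum>p\<in>M. c p *\<^sub>C finv (E p)))\<^sup>2"
    and "(nrm (\<Sum>p\<in>M. c p *\<^sub>C finv (E p)))\<^sup>2 \<le> inverse A * (\<Sum>p\<in>M. (cmod (c p))\<^sup>2)"
proof -
  define h where "h = (\<Sum>p\<in>M. c p *\<^sub>C finv (E p))"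
  have hS: "h \<in> S"
    unfolding h_def using M by (intro subspace_sum[OF subspace_S] S_scale finv_in_S E_in_S) auto
  have coef: "ip h (E q) = (if q \<in> M then c q else 0)" if q: "q \<in> P" for q
  proof -
    have "ip h (E q) = (\<Sum>p\<in>M. ip (c p *\<^sub>C finv (E p)) (E q))"
      unfolding h_def using M q E_in E_in_S by (intro ip_sum_left) auto
    also have "\<dots> = (\<Sum>p\<in>M. if p = q then c p else 0)"
    proof (rule sum.cong)
      fix p assume "p \<in> M"
      then have p: "p \<in> P" using M by auto
      have "ip (finv (E p)) (E q) = cnj (ip (E q) (finv (E p)))"
        using ip_cnj[of "E q" "finv (E p)"] p q E_in E_in_S by simp
      then show "ip (c p *\<^sub>C finv (E p)) (E q) = (if p = q then c p else 0)"
        using p q E_in E_in_S riesz_biorthogonal[OF R p q] by (simp add: ip_scale_left)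
    qed simp
    also have "\<dots> = (if q \<in> M then c q else 0)" using M by simp
    finally show ?thesis .
  qed
  have "(\<Sum>\<^sub>\<infinity>p\<in>P. (cmod (ip h (E p)))\<^sup>2) = (\<Sum>\<^sub>\<infinity>p\<in>M. (cmod (c p))\<^sup>2)"
  proof (rule infsum_cong_neutral)
    show "(cmod (c p))\<^sup>2 = 0" if "p \<in> M - P" for p using that M(2) by blast
    show "(cmod (ip h (E p)))\<^sup>2 = 0" if "p \<in> P - M" for p using that coef[of p] by simp
    show "(cmod (ip h (E p)))\<^sup>2 = (cmod (c p))\<^sup>2" if "p \<in> P \<inter> M" for p using that coef[of p] by simp
  qed
  also have "\<dots> = (\<Sum>p\<in>M. (cmod (c p))\<^sup>2)" using M by simp
  finally have eq: "(\<Sum>\<^sub>\<infinity>p\<in>P. (cmod (ip h (E p)))\<^sup>2) = (\<Sum>p\<in>M. (cmod (c p))\<^sup>2)" .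
  show "inverse B * (\<Sum>p\<in>M. (cmod (c p))\<^sup>2) \<le> (nrm (\<Sum>p\<in>M. c p *\<^sub>C finv (E p)))\<^sup>2"
    using frame_upper[OF hS] B_pos unfolding eq h_def[symmetric] by (simp add: field_simps)
  show "(nrm (\<Sum>p\<in>M. c p *\<^sub>C finv (E p)))\<^sup>2 \<le> inverse A * (\<Sum>p\<in>M. (cmod (c p))\<^sup>2)"
    using frame_lower[OF hS] A_pos unfolding eq h_def[symmetric] by (simp add: field_simps)
qed

end

section \<open>Square-integrable functions\<close>

definition L2 :: "'a measure \<Rightarrow> ('a \<Rightarrow> complex) \<Rightarrow> bool" where
  "L2 M g \<longleftrightarrow> g \<in> borel_measurable M \<and> integrable M (\<lambda>x. (norm (g x))\<^sup>2)"

lemma cnj_measurable [measurable]: "cnj \<in> borel_measurable borel"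
  by (intro borel_measurable_continuous_onI continuous_intros)

lemma L2_measurable: "L2 M g \<Longrightarrow> g \<in> borel_measurable M"
  by (simp add: L2_def)

lemma L2_iff: "L2 M g \<longleftrightarrow> g \<in> borel_measurable M \<and> (\<integral>\<^sup>+x. ennreal ((norm (g x))\<^sup>2) \<partial>M) < \<infinity>"
proof (cases "g \<in> borel_measurable M")
  case True
  then have [measurable]: "g \<in> borel_measurable M" .
  show ?thesis by (simp add: L2_def integrable_iff_bounded)
qed (simp add: L2_def)

lemma L2_mult_integrable:
  assumes g: "L2 M g" and h: "L2 M h"
  shows "integrable M (\<lambda>x. g x * cnj (h x))"
proof -
  have [measurable]: "g \<in> borel_measurable M" "h \<in> borel_measurable M" using g h by (auto simp: L2_def)
  have "integrable M (\<lambda>x. (norm (g x))\<^sup>2 + (norm (h x))\<^sup>2)" using g h by (auto simp: L2_def)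
  then show ?thesis
  proof (rule Bochner_Integration.integrable_bound)
    show "AE x in M. norm (g x * cnj (h x)) \<le> norm ((norm (g x))\<^sup>2 + (norm (h x))\<^sup>2)"
    proof (rule AE_I2)
      fix x
      have "2 * (norm (g x) * norm (h x)) \<le> (norm (g x))\<^sup>2 + (norm (h x))\<^sup>2"
        using zero_le_power2[of "norm (g x) - norm (h x)"] by (simp add: power2_diff)
      moreover have "0 \<le> norm (g x) * norm (h x)" by simp
      ultimately have "norm (g x) * norm (h x) \<le> (norm (g x))\<^sup>2 + (norm (h x))\<^sup>2" by linarith
      then show "norm (g x * cnj (h x)) \<le> norm ((norm (g x))\<^sup>2 + (norm (h x))\<^sup>2)" by (simp add: norm_mult)
    qed
  qed measurable
qed

lemma norm_add_sq_le: "(norm (a + b))\<^sup>2 \<le> 2 * (norm a)\<^sup>2 + 2 * (norm b)\<^sup>2" for a b :: "'a::real_normed_vector"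
proof -
  have "(norm (a + b))\<^sup>2 \<le> (norm a + norm b)\<^sup>2" by (intro power_mono norm_triangle_ineq) auto
  also have "\<dots> \<le> 2 * (norm a)\<^sup>2 + 2 * (norm b)\<^sup>2"
    using zero_le_power2[of "norm a - norm b"] by (simp add: power2_diff power2_sum)
  finally show ?thesis .
qed

lemma L2_add: assumes g: "L2 M g" and h: "L2 M h" shows "L2 M (\<lambda>x. g x + h x)"
proof -
  have [measurable]: "g \<in> borel_measurable M" "h \<in> borel_measurable M" using g h by (auto simp: L2_def)
  have "integrable M (\<lambda>x. 2 * (norm (g x))\<^sup>2 + 2 * (norm (h x))\<^sup>2)" using g h by (auto simp: L2_def)
  then have "integrable M (\<lambda>x. (norm (g x + h x))\<^sup>2)"
    by (rule Bochner_Integration.integrable_bound) (use norm_add_sq_le in auto)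
  then show ?thesis by (simp add: L2_def)
qed

lemma L2_cmult: "L2 M g \<Longrightarrow> L2 M (\<lambda>x. c * g x)"
  by (auto simp: L2_def norm_mult power_mult_distrib)

lemma L2_diff: "L2 M g \<Longrightarrow> L2 M h \<Longrightarrow> L2 M (\<lambda>x. g x - h x)"
  using L2_add[of M g "\<lambda>x. - 1 * h x"] L2_cmult[of M h "- 1"] by simp

text \<open>The rate 4^-k leaves room for a weight 2^k in the completeness proof that
  follows.\<close>

lemma fast_Cauchy_subseq:
  fixes d :: "nat \<Rightarrow> nat \<Rightarrow> ennreal"
  assumes "\<And>e::real. e > 0 \<Longrightarrow> \<exists>N. \<forall>i\<ge>N. \<forall>j\<ge>N. d i j \<le> ennreal e"
  obtains r where "strict_mono r" "\<And>k j. j \<ge> r k \<Longrightarrow> d (r k) j \<le> ennreal ((1/4) ^ k)"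
proof -
  have "\<exists>N. \<forall>i\<ge>N. \<forall>j\<ge>N. d i j \<le> ennreal ((1/4) ^ k)" for k :: nat by (rule assms) simp
  then obtain N where N: "\<And>k i j. i \<ge> N k \<Longrightarrow> j \<ge> N k \<Longrightarrow> d i j \<le> ennreal ((1/4) ^ k)" by metis
  define r where "r = rec_nat (N 0) (\<lambda>k m. max (Suc m) (N (Suc k)))"
  have r: "r 0 = N 0" "r (Suc k) = max (Suc (r k)) (N (Suc k))" for k by (auto simp: r_def)
  have "strict_mono r" by (rule strict_monoI_Suc) (simp add: r)
  moreover have "N k \<le> r k" for k by (cases k) (auto simp: r)
  ultimately show ?thesis using that N by (meson order_trans)
qed

theorem Riesz_Fischer:
  fixes g :: "nat \<Rightarrow> 'a \<Rightarrow> complex"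
  assumes g: "\<And>n. L2 M (g n)"
    and cauchy: "\<And>e::real. e > 0 \<Longrightarrow> \<exists>N. \<forall>i\<ge>N. \<forall>j\<ge>N. (\<integral>\<^sup>+x. ennreal ((norm (g i x - g j x))\<^sup>2) \<partial>M) \<le> ennreal e"
  obtains f where "L2 M f" "(\<lambda>n. \<integral>\<^sup>+x. ennreal ((norm (g n x - f x))\<^sup>2) \<partial>M) \<longlonglongrightarrow> 0"
proof -
  have [measurable]: "g n \<in> borel_measurable M" for n using g by (rule L2_measurable)
  obtain r where r: "strict_mono r" and fast: "\<And>k j. j \<ge> r k \<Longrightarrow>
      (\<integral>\<^sup>+x. ennreal ((norm (g (r k) x - g j x))\<^sup>2) \<partial>M) \<le> ennreal ((1/4) ^ k)"
  proof (rule fast_Cauchy_subseq[of "\<lambda>i j. \<integral>\<^sup>+x. ennreal ((norm (g i x - g j x))\<^sup>2) \<partial>M", OF cauchy])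
    fix r assume "strict_mono r" "\<And>k j. j \<ge> r k \<Longrightarrow>
      (\<integral>\<^sup>+x. ennreal ((norm (g (r k) x - g j x))\<^sup>2) \<partial>M) \<le> ennreal ((1/4) ^ k)"
    then show thesis by (rule that)
  qed
  \<comment> \<open>Since the integrals decay like 4^-k, the weight 2^k still leaves a convergent
    series. Its finiteness at a point forces the increments there to decay geometrically with ratio
    sqrt(1/2).\<close>
  define d where "d k x = 2 ^ k * (norm (g (r k) x - g (r (Suc k)) x))\<^sup>2" for k x
  have [measurable]: "d k \<in> borel_measurable M" for k unfolding d_def by measurable
  have dk: "(\<integral>\<^sup>+x. ennreal (d k x) \<partial>M) \<le> ennreal ((1/2) ^ k)" for k
  proof -
    have "(\<integral>\<^sup>+x. ennreal (d k x) \<partial>M) = ennreal (2 ^ k) * (\<integral>\<^sup>+x. ennreal ((norm (g (r k) x - g (r (Suc k)) x))\<^sup>2) \<partial>M)"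
      unfolding d_def by (subst nn_integral_cmult[symmetric]) (auto simp: ennreal_mult')
    also have "\<dots> \<le> ennreal (2 ^ k) * ennreal ((1/4) ^ k)"
      using r by (intro mult_left_mono fast) (auto simp: strict_mono_def less_imp_le)
    also have "\<dots> = ennreal (2 ^ k * (1/4) ^ k)" by (rule ennreal_mult'[symmetric]) simp
    also have "2 ^ k * (1/4) ^ k = (1/2::real) ^ k" by (simp only: power_mult_distrib[symmetric]) simp
    finally show ?thesis .
  qed
  have "(\<integral>\<^sup>+x. (\<Sum>k. ennreal (d k x)) \<partial>M) = (\<Sum>k. \<integral>\<^sup>+x. ennreal (d k x) \<partial>M)"
    by (rule nn_integral_suminf) measurable
  also have "\<dots> \<le> (\<Sum>k. ennreal ((1/2) ^ k))" by (intro suminf_le dk) auto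
  also have "\<dots> = ennreal (\<Sum>k. (1/2) ^ k)" by (intro suminf_ennreal2) (auto simp: summable_geometric)
  also have "\<dots> < \<infinity>" by simp
  finally have "AE x in M. (\<Sum>k. ennreal (d k x)) \<noteq> \<infinity>" by (intro nn_integral_PInf_AE) auto
  then have conv: "AE x in M. convergent (\<lambda>k. g (r k) x)"
  proof eventually_elim
    fix x assume fin: "(\<Sum>k. ennreal (d k x)) \<noteq> \<infinity>"
    then have sm: "summable (\<lambda>k. d k x)"
      by (intro summable_suminf_not_top) (auto simp: d_def)
    then obtain B where B: "\<And>k. \<bar>d k x\<bar> \<le> B" using summable_imp_bounded[OF sm] unfolding bounded_real by auto
    have B0: "B \<ge> 0" using B[of 0] by linarith
    have bnd: "norm (g (r (Suc k)) x - g (r k) x) \<le> sqrt B * (sqrt (1/2)) ^ k" for k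
    proof (rule power2_le_imp_le)
      have "2 ^ k * (norm (g (r k) x - g (r (Suc k)) x))\<^sup>2 \<le> B" using B[of k] by (simp add: d_def)
      then have "(norm (g (r k) x - g (r (Suc k)) x))\<^sup>2 \<le> B * (1/2) ^ k" by (simp add: field_simps power_divide)
      also have "\<dots> = (sqrt B * (sqrt (1/2)) ^ k)\<^sup>2"
      proof -
        have "(sqrt (1/2) ^ k)\<^sup>2 = ((sqrt (1/2))\<^sup>2) ^ k" by (simp only: power_mult[symmetric] mult.commute)
        then show ?thesis using B0 by (simp add: power_mult_distrib)
      qed
      finally show "(norm (g (r (Suc k)) x - g (r k) x))\<^sup>2 \<le> (sqrt B * (sqrt (1/2)) ^ k)\<^sup>2"
        by (simp add: norm_minus_commute)
    qed (use B0 in simp)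
    have "summable (\<lambda>k. g (r (Suc k)) x - g (r k) x)"
    proof (rule summable_comparison_test'[where N = 0])
      show "summable (\<lambda>k. sqrt B * (sqrt (1/2)) ^ k)"
        by (intro summable_mult summable_geometric) (simp add: real_sqrt_divide)
    qed (rule bnd)
    then have "convergent (\<lambda>n. \<Sum>k<n. g (r (Suc k)) x - g (r k) x)" by (simp add: summable_iff_convergent)
    then have "convergent (\<lambda>n. g (r n) x - g (r 0) x)"
      by (simp add: sum_lessThan_telescope[where f = "\<lambda>k. g (r k) x"])
    then show "convergent (\<lambda>k. g (r k) x)"
      using convergent_add[OF _ convergent_const[of "g (r 0) x"]] by fastforce
  qed
  define f where "f x = lim (\<lambda>k. g (r k) x)" for x
  have [measurable]: "f \<in> borel_measurable M" unfolding f_def by measurable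
  have lim: "AE x in M. (\<lambda>k. g (r k) x) \<longlonglongrightarrow> f x"
    using conv by eventually_elim (simp add: f_def convergent_LIMSEQ_iff)
  \<comment> \<open>Fatou along the subsequence: almost everywhere \<open>g (r k)\<close> tends to
    \<open>f\<close>, so the distance from \<open>g n\<close> to \<open>f\<close> is at most the
    lower limit of the distances from \<open>g n\<close> to \<open>g (r k)\<close>. This controls
    the full sequence at once.\<close>
  have dist: "(\<integral>\<^sup>+x. ennreal ((norm (g n x - f x))\<^sup>2) \<partial>M) \<le> ennreal e"
    if N: "\<And>i j. i \<ge> N \<Longrightarrow> j \<ge> N \<Longrightarrow> (\<integral>\<^sup>+x. ennreal ((norm (g i x - g j x))\<^sup>2) \<partial>M) \<le> ennreal e" and n: "n \<ge> N" for e N n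
  proof -
    have "(\<integral>\<^sup>+x. ennreal ((norm (g n x - f x))\<^sup>2) \<partial>M) = (\<integral>\<^sup>+x. liminf (\<lambda>k. ennreal ((norm (g n x - g (r k) x))\<^sup>2)) \<partial>M)"
    proof (rule nn_integral_cong_AE, use lim in eventually_elim)
      fix x assume "(\<lambda>k. g (r k) x) \<longlonglongrightarrow> f x"
      then have "(\<lambda>k. ennreal ((norm (g n x - g (r k) x))\<^sup>2)) \<longlonglongrightarrow> ennreal ((norm (g n x - f x))\<^sup>2)"
        by (intro tendsto_intros)
      then show "ennreal ((norm (g n x - f x))\<^sup>2) = liminf (\<lambda>k. ennreal ((norm (g n x - g (r k) x))\<^sup>2))"
        by (intro lim_imp_Liminf[symmetric]) simp
    qed
    also have "\<dots> \<le> liminf (\<lambda>k. \<integral>\<^sup>+x. ennreal ((norm (g n x - g (r k) x))\<^sup>2) \<partial>M)"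
      by (rule nn_integral_liminf) measurable
    also have "\<dots> \<le> ennreal e"
    proof (rule Liminf_le)
      have "r k \<ge> N" if "k \<ge> N" for k using seq_suble[OF r, of k] that by linarith
      then have "(\<integral>\<^sup>+x. ennreal ((norm (g n x - g (r k) x))\<^sup>2) \<partial>M) \<le> ennreal e" if "k \<ge> N" for k
        using N n that by blast
      then show "\<forall>\<^sub>F k in sequentially. (\<integral>\<^sup>+x. ennreal ((norm (g n x - g (r k) x))\<^sup>2) \<partial>M) \<le> ennreal e"
        unfolding eventually_sequentially by blast
    qed simp
    finally show ?thesis .
  qed
  have "L2 M f"
  proof -
    obtain N where N: "\<And>i j. i \<ge> N \<Longrightarrow> j \<ge> N \<Longrightarrow> (\<integral>\<^sup>+x. ennreal ((norm (g i x - g j x))\<^sup>2) \<partial>M) \<le> ennreal 1"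
      using cauchy[of 1] by auto
    have "(\<integral>\<^sup>+x. ennreal ((norm (g N x - f x))\<^sup>2) \<partial>M) \<le> ennreal 1" by (rule dist[OF N]) auto
    then have "(\<integral>\<^sup>+x. ennreal ((norm (g N x - f x))\<^sup>2) \<partial>M) < \<infinity>" using le_less_trans by fastforce
    then have "L2 M (\<lambda>x. g N x - f x)" by (simp add: L2_iff)
    from L2_diff[OF g[of N] this] show ?thesis by simp
  qed
  moreover have "(\<lambda>n. \<integral>\<^sup>+x. ennreal ((norm (g n x - f x))\<^sup>2) \<partial>M) \<longlonglongrightarrow> 0"
  proof (rule order_tendstoI)
    fix a :: ennreal assume "0 < a"
    then obtain e :: real where e: "0 < e" "ennreal e < a"
    proof (cases a)
      case (real b)
      then show ?thesis using that[of "b / 2"] \<open>0 < a\<close> by (auto simp: ennreal_less_iff)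
    next
      case top
      then show ?thesis using that[of 1] by simp
    qed
    obtain N where N: "\<And>i j. i \<ge> N \<Longrightarrow> j \<ge> N \<Longrightarrow> (\<integral>\<^sup>+x. ennreal ((norm (g i x - g j x))\<^sup>2) \<partial>M) \<le> ennreal e"
      using cauchy[OF e(1)] by auto
    show "\<forall>\<^sub>F n in sequentially. (\<integral>\<^sup>+x. ennreal ((norm (g n x - f x))\<^sup>2) \<partial>M) < a"
      unfolding eventually_sequentially using dist[OF N] e(2) le_less_trans by blast
  qed simp
  ultimately show ?thesis using that by blast
qed

text \<open>Transports the Hilbert space structure of L^2 along a map \<open>J\<close> that is
  linear, onto and one-to-one only modulo null sets. Functions with Lebesgue measure give the
  Sobolev space, functions with counting measure give the weighted sequence space.\<close>

lemma chilbert_L2: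
  fixes scale :: "complex \<Rightarrow> 'v::ab_group_add \<Rightarrow> 'v" and J :: "'v \<Rightarrow> 'a \<Rightarrow> complex"
  assumes vs: "vector_space scale" and H: "module.subspace scale H"
    and J: "\<And>f. f \<in> H \<Longrightarrow> L2 M (J f)"
    and add: "\<And>f g. \<lbrakk>f \<in> H; g \<in> H\<rbrakk> \<Longrightarrow> AE x in M. J (f + g) x = J f x + J g x"
    and mult: "\<And>c f. f \<in> H \<Longrightarrow> AE x in M. J (scale c f) x = c * J f x"
    and surj: "\<And>g. L2 M g \<Longrightarrow> \<exists>f\<in>H. AE x in M. J f x = g x"
    and inj: "\<And>f. \<lbrakk>f \<in> H; AE x in M. J f x = 0\<rbrakk> \<Longrightarrow> f = 0"
    and ip: "\<And>f g. \<lbrakk>f \<in> H; g \<in> H\<rbrakk> \<Longrightarrow> ip f g = (LINT x|M. J f x * cnj (J g x))"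
    and nrm: "\<And>f. nrm f = sqrt (Re (ip f f))"
  shows "chilbert scale H ip nrm"
proof -
  interpret vector_space scale by (rule vs)
  have Jm [measurable]: "J f \<in> borel_measurable M" if "f \<in> H" for f using J[OF that] by (rule L2_measurable)
  have self: "ip f f = of_real (LINT x|M. (norm (J f x))\<^sup>2)" if "f \<in> H" for f
    using ip[OF that that] by (simp only: complex_norm_square[symmetric] integral_complex_of_real)
  have nrm_sq: "(nrm f)\<^sup>2 = (LINT x|M. (norm (J f x))\<^sup>2)" if "f \<in> H" for f
    using that by (simp add: nrm self integral_nonneg_AE)
  have diff_in: "f - g \<in> H" if "f \<in> H" "g \<in> H" for f g using H that by (rule subspace_diff)
  have Jdiff: "AE x in M. J (f - g) x = J f x - J g x" if fg: "f \<in> H" "g \<in> H" for f g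
    using add[OF diff_in[OF fg] fg(2)] by eventually_elim simp
  have nn: "(\<integral>\<^sup>+x. ennreal ((norm (J f x - J g x))\<^sup>2) \<partial>M) = ennreal ((nrm (f - g))\<^sup>2)" if fg: "f \<in> H" "g \<in> H" for f g
  proof -
    have "(\<integral>\<^sup>+x. ennreal ((norm (J f x - J g x))\<^sup>2) \<partial>M) = (\<integral>\<^sup>+x. ennreal ((norm (J (f - g) x))\<^sup>2) \<partial>M)"
      by (rule nn_integral_cong_AE) (use Jdiff[OF fg] in eventually_elim, simp)
    also have "\<dots> = ennreal (LINT x|M. (norm (J (f - g) x))\<^sup>2)"
      using J[OF diff_in[OF fg]] by (intro nn_integral_eq_integral) (auto simp: L2_def)
    finally show ?thesis by (simp add: nrm_sq[OF diff_in[OF fg]])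
  qed
  show ?thesis
  proof unfold_locales
    show "subspace H" by (rule H)
    fix f assume f: "f \<in> H"
    show "0 \<le> Re (ip f f)" using f by (simp add: self)
    show "f = 0" if "Re (ip f f) = 0"
    proof (rule inj[OF f])
      have "(LINT x|M. (norm (J f x))\<^sup>2) = 0" using that f by (simp add: self)
      then have "AE x in M. (norm (J f x))\<^sup>2 = 0"
        using J[OF f] by (subst (asm) integral_nonneg_eq_0_iff_AE) (auto simp: L2_def)
      then show "AE x in M. J f x = 0" by simp
    qed
    fix g assume g: "g \<in> H"
    show "cnj (ip f g) = ip g f"
      unfolding ip[OF f g] ip[OF g f] Bochner_Integration.integral_cnj[symmetric]
      by (simp only: complex_cnj_mult complex_cnj_cnj mult.commute)
    show "ip (scale c f) g = c * ip f g" for c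
    proof -
      have cf: "scale c f \<in> H" using H f by (rule subspace_scale)
      have "ip (scale c f) g = (LINT x|M. c * (J f x * cnj (J g x)))"
        unfolding ip[OF cf g]
        by (rule integral_cong_AE)
           (use cf f g in \<open>measurable, use mult[OF f, of c] in eventually_elim, simp\<close>)
      then show ?thesis by (simp add: ip[OF f g])
    qed
    fix h assume h: "h \<in> H"
    show "ip (f + g) h = ip f h + ip g h"
    proof -
      have fg: "f + g \<in> H" using H f g by (rule subspace_add)
      have "ip (f + g) h = (LINT x|M. J f x * cnj (J h x) + J g x * cnj (J h x))"
        unfolding ip[OF fg h]
        by (rule integral_cong_AE)
           (use fg f g h in \<open>measurable, use add[OF f g] in eventually_elim, simp add: algebra_simps\<close>)
      then show ?thesis using L2_mult_integrable[OF J[OF f] J[OF h]] L2_mult_integrable[OF J[OF g] J[OF h]]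
        by (simp add: ip f g h)
    qed
  next
    show "nrm f = sqrt (Re (ip f f))" for f by (rule nrm)
  next
    fix X :: "nat \<Rightarrow> 'v"
    assume X: "\<And>n. X n \<in> H" and C: "\<And>e. e > 0 \<Longrightarrow> \<exists>m. \<forall>i\<ge>m. \<forall>j\<ge>m. nrm (X i - X j) < e"
    have nn0: "0 \<le> nrm (f - g)" if "f \<in> H" "g \<in> H" for f g
      using diff_in[OF that] by (simp add: nrm self)
    obtain G where G: "L2 M G" "(\<lambda>n. \<integral>\<^sup>+x. ennreal ((norm (J (X n) x - G x))\<^sup>2) \<partial>M) \<longlonglongrightarrow> 0"
    proof (rule Riesz_Fischer[of M "\<lambda>n. J (X n)"])
      show "L2 M (J (X n))" for n by (rule J[OF X])
      fix e :: real assume "e > 0"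
      then obtain m where m: "\<And>i j. i \<ge> m \<Longrightarrow> j \<ge> m \<Longrightarrow> nrm (X i - X j) < sqrt e" using C[of "sqrt e"] by auto
      have "(nrm (X i - X j))\<^sup>2 \<le> e" if "i \<ge> m" "j \<ge> m" for i j
        using power_mono[OF less_imp_le[OF m[OF that]] nn0[OF X X], of 2] \<open>e > 0\<close> by simp
      then show "\<exists>N. \<forall>i\<ge>N. \<forall>j\<ge>N. (\<integral>\<^sup>+x. ennreal ((norm (J (X i) x - J (X j) x))\<^sup>2) \<partial>M) \<le> ennreal e"
        unfolding nn[OF X X] by (intro exI[of _ m]) (auto intro: ennreal_leI)
    qed
    obtain f where f: "f \<in> H" "AE x in M. J f x = G x" using surj[OF G(1)] by blast
    have "(\<integral>\<^sup>+x. ennreal ((norm (J (X n) x - G x))\<^sup>2) \<partial>M) = ennreal ((nrm (X n - f))\<^sup>2)" for n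
    proof -
      have "(\<integral>\<^sup>+x. ennreal ((norm (J (X n) x - G x))\<^sup>2) \<partial>M) = (\<integral>\<^sup>+x. ennreal ((norm (J (X n) x - J f x))\<^sup>2) \<partial>M)"
        by (rule nn_integral_cong_AE) (use f(2) in eventually_elim, simp)
      then show ?thesis by (simp add: nn[OF X f(1)])
    qed
    then have "(\<lambda>n. ennreal ((nrm (X n - f))\<^sup>2)) \<longlonglongrightarrow> ennreal 0" using G(2) by simp
    then have "(\<lambda>n. (nrm (X n - f))\<^sup>2) \<longlonglongrightarrow> 0" by (subst (asm) tendsto_ennreal_iff) auto
    then have "(\<lambda>n. sqrt ((nrm (X n - f))\<^sup>2)) \<longlonglongrightarrow> sqrt 0" by (rule tendsto_real_sqrt)
    then have "(\<lambda>n. nrm (X n - f)) \<longlonglongrightarrow> 0" using nn0[OF X f(1)] by simp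
    then show "\<exists>f\<in>H. (\<lambda>n. nrm (X n - f)) \<longlonglongrightarrow> 0" using f(1) by blast
  qed
qed

section \<open>Schwartz functions and Fourier inversion\<close>

text \<open>The decay part of the Schwartz condition for the function alone, without its
  derivatives; differentiation is handled separately by \<open>schwartz_coinduct\<close>.\<close>

definition rapid :: "(real^'n::finite \<Rightarrow> complex) \<Rightarrow> bool" where
  "rapid f \<longleftrightarrow> (\<forall>m. \<exists>K. \<forall>x. norm x ^ m * norm (f x) \<le> K)"

lemma iter_deriv_append: "iter_deriv (\<alpha> @ \<beta>) f = iter_deriv \<alpha> (iter_deriv \<beta> f)"
  by (induction \<alpha>) auto

text \<open>Induction on the multi-index keeps all iterated derivatives inside \<open>C\<close>. One
  closure step per first derivative thus takes the place of a Leibniz formula for derivatives of all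
  orders.\<close>

lemma schwartz_coinduct:
  assumes "f \<in> C" and "\<And>g x. g \<in> C \<Longrightarrow> g differentiable (at x)" and "\<And>g. g \<in> C \<Longrightarrow> rapid g"
    and "\<And>g i. g \<in> C \<Longrightarrow> dir_deriv i g \<in> C"
  shows "schwartz f"
proof -
  have "iter_deriv \<alpha> f \<in> C" for \<alpha> by (induction \<alpha>) (use assms in auto)
  then have "rapid (iter_deriv \<alpha> f)" "iter_deriv \<alpha> f differentiable (at x)" for \<alpha> x
    using assms by blast+
  moreover from this have "bdd_above (range (\<lambda>x. norm x ^ m * norm (iter_deriv \<alpha> f x)))" for m \<alpha>
    unfolding rapid_def by (meson bdd_aboveI2)
  ultimately show ?thesis unfolding schwartz_def smooth_def by blast
qed

lemma schwartz_iter_deriv: "schwartz f \<Longrightarrow> schwartz (iter_deriv \<beta> f)"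
  unfolding schwartz_def smooth_def by (metis iter_deriv_append)

lemma schwartz_dir_deriv: "schwartz f \<Longrightarrow> schwartz (dir_deriv i f)"
  using schwartz_iter_deriv[of f "[i]"] by simp

lemma schwartz_differentiable: "schwartz f \<Longrightarrow> f differentiable (at x)"
  unfolding schwartz_def smooth_def by (metis iter_deriv.simps(1))

lemma seminorm_ge: "schwartz f \<Longrightarrow> norm x ^ m * norm (iter_deriv \<alpha> f x) \<le> schwartz_seminorm m \<alpha> f"
  unfolding schwartz_def schwartz_seminorm_def by (intro cSUP_upper) auto

lemma seminorm_nonneg: "schwartz f \<Longrightarrow> 0 \<le> schwartz_seminorm m \<alpha> f"
  by (rule order_trans[OF _ seminorm_ge[of f 0]]) auto

lemma schwartz_rapid: "schwartz f \<Longrightarrow> rapid f"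
  unfolding rapid_def using seminorm_ge[of f _ _ "[]"] by auto

lemma schwartz_continuous: "schwartz f \<Longrightarrow> continuous_on UNIV f"
  by (meson continuous_at_imp_continuous_on differentiable_imp_continuous_within schwartz_differentiable)

lemma schwartz_measurable: "schwartz f \<Longrightarrow> f \<in> borel_measurable borel"
  by (intro borel_measurable_continuous_onI schwartz_continuous)

lemma dir_deriv_eq: "(f has_derivative f') (at x) \<Longrightarrow> dir_deriv i f x = f' (axis i 1)"
  unfolding dir_deriv_def using frechet_derivative_at by metis

lemma rapid_add: assumes "rapid f" "rapid g" shows "rapid (\<lambda>x. f x + g x)"
  unfolding rapid_def
proof
  fix m
  obtain K L where K: "\<And>x. norm x ^ m * norm (f x) \<le> K" and L: "\<And>x. norm x ^ m * norm (g x) \<le> L"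
    using assms unfolding rapid_def by metis
  have "norm x ^ m * norm (f x + g x) \<le> K + L" for x
  proof -
    have "norm x ^ m * norm (f x + g x) \<le> norm x ^ m * (norm (f x) + norm (g x))"
      by (intro mult_left_mono norm_triangle_ineq) auto
    then show ?thesis using K[of x] L[of x] by (simp add: distrib_left)
  qed
  then show "\<exists>K. \<forall>x. norm x ^ m * norm (f x + g x) \<le> K" by blast
qed

lemma rapid_bounded_mult:
  assumes "rapid f" and g: "\<And>x. norm (g x) \<le> b"
  shows "rapid (\<lambda>x. g x * f x)"
  unfolding rapid_def
proof
  fix m
  have b: "0 \<le> b" using g[of 0] norm_ge_zero order_trans by blast
  obtain K where K: "\<And>x. norm x ^ m * norm (f x) \<le> K"
    using assms(1) unfolding rapid_def by metis
  have "norm x ^ m * norm (g x * f x) \<le> b * K" for x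
  proof -
    have "norm x ^ m * norm (g x * f x) = norm (g x) * (norm x ^ m * norm (f x))" by (simp add: norm_mult)
    also have "\<dots> \<le> b * K" using g[of x] K[of x] b by (intro mult_mono) auto
    finally show ?thesis .
  qed
  then show "\<exists>K. \<forall>x. norm x ^ m * norm (g x * f x) \<le> K" by blast
qed

lemma rapid_coord: assumes "rapid f" shows "rapid (\<lambda>x. of_real (x $ i) * f x)"
  unfolding rapid_def
proof
  fix m
  obtain K where K: "\<And>x. norm x ^ Suc m * norm (f x) \<le> K"
    using assms(1) unfolding rapid_def by metis
  have "norm x ^ m * norm (of_real (x $ i) * f x) \<le> K" for x
  proof -
    have "norm x ^ m * norm (of_real (x $ i) * f x) = norm x ^ m * \<bar>x $ i\<bar> * norm (f x)"
      by (simp add: norm_mult)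
    also have "\<dots> \<le> norm x ^ m * norm x * norm (f x)"
      by (intro mult_mono component_le_norm_cart) auto
    also have "\<dots> \<le> K" using K[of x] by (simp add: mult_ac)
    finally show ?thesis .
  qed
  then show "\<exists>K. \<forall>x. norm x ^ m * norm (of_real (x $ i) * f x) \<le> K" by blast
qed

lemma power_add_le: "(a + b) ^ m \<le> 2 ^ m * (a ^ m + b ^ m)" if "0 \<le> a" "0 \<le> b" for a b :: real
proof -
  have "(a + b) ^ m \<le> (2 * max a b) ^ m" using that by (intro power_mono) auto
  also have "\<dots> = 2 ^ m * (max a b) ^ m" by (simp add: power_mult_distrib)
  also have "\<dots> \<le> 2 ^ m * (a ^ m + b ^ m)" using that by (intro mult_left_mono) (auto simp: max_def)
  finally show ?thesis .
qed

lemma rapid_translate: assumes "rapid f" shows "rapid (\<lambda>x. f (x + a))"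
  unfolding rapid_def
proof
  fix m
  obtain K L where K: "\<And>x. norm x ^ m * norm (f x) \<le> K" and L: "\<And>x. norm x ^ 0 * norm (f x) \<le> L"
    using assms(1) unfolding rapid_def by metis
  have "norm x ^ m * norm (f (x + a)) \<le> 2 ^ m * (K + norm a ^ m * L)" for x
  proof -
    have "norm x \<le> norm (x + a) + norm a" using norm_triangle_ineq4[of "x + a" a] by simp
    then have "norm x ^ m \<le> (norm (x + a) + norm a) ^ m" by (intro power_mono) auto
    also have "\<dots> \<le> 2 ^ m * (norm (x + a) ^ m + norm a ^ m)" by (rule power_add_le) auto
    finally have "norm x ^ m * norm (f (x + a)) \<le> 2 ^ m * (norm (x + a) ^ m + norm a ^ m) * norm (f (x + a))"
      by (intro mult_right_mono) auto
    also have "\<dots> = 2 ^ m * (norm (x + a) ^ m * norm (f (x + a)) + norm a ^ m * norm (f (x + a)))"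
      by (simp add: algebra_simps)
    also have "\<dots> \<le> 2 ^ m * (K + norm a ^ m * L)"
      using K[of "x + a"] L[of "x + a"] by (intro mult_left_mono add_mono) auto
    finally show ?thesis .
  qed
  then show "\<exists>K. \<forall>x. norm x ^ m * norm (f (x + a)) \<le> K" by blast
qed

lemma rapid_reflect: assumes "rapid f" shows "rapid (\<lambda>x. f (- x))"
  using assms unfolding rapid_def by (metis norm_minus_cancel minus_minus)

section \<open>A stock of Schwartz functions\<close>

definition gauss :: "real^'n::finite \<Rightarrow> complex" where
  "gauss x = of_real (exp (- (pi * (x \<bullet> x))))"

lemma power_le_exp: "x ^ m \<le> fact m * exp x" if "0 \<le> x" for x :: real
proof -
  have "(\<Sum>k\<in>{m}. inverse (fact k) *\<^sub>R x ^ k) \<le> (\<Sum>k. inverse (fact k) *\<^sub>R x ^ k)"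
    using that by (intro sum_le_suminf summable_exp_generic) auto
  then show ?thesis by (simp add: exp_def field_simps)
qed

lemma rapid_gauss: "rapid gauss"
  unfolding rapid_def
proof
  fix m
  have "norm (x::real^'n) ^ m * norm (gauss x) \<le> 1 + fact m" for x
  proof -
    define a where "a = pi * (norm x)\<^sup>2"
    have a: "a \<ge> 0" by (simp add: a_def)
    \<comment> \<open>The exponent of the Gaussian is quadratic, so the exponential series controls
      only even powers of the norm; y <= 1 + y^2 reduces an arbitrary power to an even one.\<close>
    have "norm x ^ m \<le> 1 + (norm x ^ m)\<^sup>2"
    proof -
      have "0 \<le> (norm x ^ m - 1)\<^sup>2" by simp
      then have "2 * norm x ^ m \<le> 1 + (norm x ^ m)\<^sup>2" by (simp add: power2_diff)
      moreover have "0 \<le> norm x ^ m" by simp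
      ultimately show ?thesis by linarith
    qed
    also have "(norm x ^ m)\<^sup>2 = ((norm x)\<^sup>2) ^ m" by (simp add: power_mult[symmetric] mult.commute)
    also have "\<dots> \<le> a ^ m" unfolding a_def using pi_ge_two
      by (intro power_mono) (auto simp: mult_le_cancel_right1)
    also have "\<dots> \<le> fact m * exp a" by (rule power_le_exp[OF a])
    also have "1 + fact m * exp a \<le> (1 + fact m) * exp a" using a by (simp add: algebra_simps)
    finally have "norm x ^ m * exp (- a) \<le> (1 + fact m) * exp a * exp (- a)"
      by (intro mult_right_mono) auto
    then show ?thesis by (simp add: gauss_def a_def power2_norm_eq_inner mult.assoc flip: exp_add)
  qed
  then show "\<exists>K. \<forall>x. norm (x::real^'n) ^ m * norm (gauss x) \<le> K" by blast
qed

text \<open>Closure properties of Schwartz functions are proved simultaneously: the class below is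
  stable under \<open>dir_deriv\<close>, so \<open>schwartz_coinduct\<close> applies.\<close>

inductive sch :: "(real^'n::finite \<Rightarrow> complex) \<Rightarrow> bool" where
  base: "schwartz f \<Longrightarrow> sch f"
| gauss: "sch gauss"
| add: "sch f \<Longrightarrow> sch g \<Longrightarrow> sch (\<lambda>x. f x + g x)"
| scale: "sch f \<Longrightarrow> sch (\<lambda>x. c * f x)"
| coord: "sch f \<Longrightarrow> sch (\<lambda>x. of_real (x $ i) * f x)"
| modulate: "sch f \<Longrightarrow> sch (\<lambda>x. cis (x \<bullet> a) * f x)"
| translate: "sch f \<Longrightarrow> sch (\<lambda>x. f (x + a))"
| reflect: "sch f \<Longrightarrow> sch (\<lambda>x. f (- x))"
| tanh: "sch f \<Longrightarrow> sch (\<lambda>x. of_real (tanh (m * (x $ i - b))) * f x)"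

lemma has_derivative_vec_nth': "((\<lambda>x. x $ i) has_derivative (\<lambda>h. h $ i)) (at x)"
  by (rule bounded_linear_imp_has_derivative) (rule bounded_linear_vec_nth)

lemma has_derivative_cis_inner:
  "((\<lambda>x. cis (x \<bullet> a)) has_derivative (\<lambda>h. \<i> * of_real (h \<bullet> a) * cis (x \<bullet> a))) (at x)"
proof -
  have 1: "((\<lambda>x. \<i> * complex_of_real (x \<bullet> a)) has_derivative (\<lambda>h. \<i> * complex_of_real (h \<bullet> a))) (at x)"
    by (intro has_derivative_mult_right has_derivative_of_real bounded_linear_imp_has_derivative
        bounded_linear_inner_left)
  have "(exp has_derivative (*) (exp (\<i> * complex_of_real (x \<bullet> a)))) (at (\<i> * complex_of_real (x \<bullet> a)))"
    using DERIV_exp by (simp add: has_field_derivative_def)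
  from has_derivative_compose[OF 1 this] show ?thesis by (simp add: cis_conv_exp mult.commute)
qed

lemma has_derivative_tanh_coord:
  "((\<lambda>x. complex_of_real (tanh (m * (x $ i - b)))) has_derivative
     (\<lambda>h. of_real ((1 - (tanh (m * (x $ i - b)))\<^sup>2) * (m * h $ i)))) (at x)"
proof -
  have 1: "((\<lambda>x. m * (x $ i - b)) has_derivative (\<lambda>h. m * h $ i)) (at x)"
    by (auto intro!: derivative_eq_intros has_derivative_vec_nth')
  have "(tanh has_derivative (*) (1 - (tanh (m * (x $ i - b)))\<^sup>2)) (at (m * (x $ i - b)))"
    using has_field_derivative_tanh[OF _ DERIV_ident, of "m * (x $ i - b)"]
    by (simp add: has_field_derivative_def)
  then have "((\<lambda>x. tanh (m * (x $ i - b))) has_derivative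
     (\<lambda>h. (1 - (tanh (m * (x $ i - b)))\<^sup>2) * (m * h $ i))) (at x)"
    by (rule has_derivative_compose[OF 1])
  then show ?thesis by (rule has_derivative_of_real)
qed

lemma has_derivative_gauss:
  "(gauss has_derivative (\<lambda>h. of_real (- (2 * pi) * (x \<bullet> h)) * gauss x)) (at x)"
proof -
  have "((\<lambda>x. exp (- (pi * (x \<bullet> x)))) has_derivative (\<lambda>h. (- (2 * pi) * (x \<bullet> h)) * exp (- (pi * (x \<bullet> x))))) (at x)"
    by (auto intro!: derivative_eq_intros simp: inner_commute algebra_simps)
  from has_derivative_of_real[OF this] show ?thesis by (simp add: gauss_def[abs_def])
qed

lemma dir_deriv_gauss: "dir_deriv i gauss = (\<lambda>x. of_real (- (2 * pi)) * (of_real (x $ i) * gauss x))"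
  by (rule ext, subst dir_deriv_eq[OF has_derivative_gauss]) (simp add: inner_axis)

lemma sch_caseI:
  assumes D: "\<And>x. (F has_derivative D x) (at x)" and "rapid F"
    and "\<And>j. dir_deriv j F = G j" and "\<And>j. sch (G j)"
  shows "(\<forall>x. F differentiable (at x)) \<and> rapid F \<and> (\<forall>j. sch (dir_deriv j F))"
proof -
  have "F differentiable (at x)" for x using D[of x] unfolding differentiable_def by blast
  then show ?thesis using assms(2-4) by simp
qed

text \<open>The rules of \<open>sch\<close> are chosen so that each derivative is again a
  combination of terms built by the rules. The delicate one is \<open>tanh\<close>: its derivative
  is 1 - tanh^2, and the square is obtained by applying the same rule twice.\<close>

lemma sch_main:
  fixes f :: "real^'n::finite \<Rightarrow> complex"
  shows "sch f \<Longrightarrow> (\<forall>x. f differentiable (at x)) \<and> rapid f \<and> (\<forall>j. sch (dir_deriv j f))"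
proof (induction rule: sch.induct)
  case (base f)
  then show ?case using schwartz_differentiable schwartz_rapid schwartz_dir_deriv sch.base by blast
next
  case gauss
  have "(\<forall>x. gauss differentiable (at (x::real^'n)))"
    using has_derivative_gauss unfolding differentiable_def by blast
  moreover have "sch (dir_deriv j gauss)" for j :: 'n
    unfolding dir_deriv_gauss by (intro sch.scale sch.coord sch.gauss)
  ultimately show ?case using rapid_gauss by blast
next
  case (add f g)
  have D: "((\<lambda>x. f x + g x) has_derivative (\<lambda>h. frechet_derivative f (at x) h + frechet_derivative g (at x) h)) (at x)" for x
    using add.IH by (intro has_derivative_add) (auto simp: frechet_derivative_works[symmetric])
  have eq: "dir_deriv j (\<lambda>x. f x + g x) = (\<lambda>x. dir_deriv j f x + dir_deriv j g x)" for j
    by (rule ext, subst dir_deriv_eq[OF D]) (simp add: dir_deriv_def)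
  show ?case
  proof (rule sch_caseI[OF D _ eq])
    show "rapid (\<lambda>x. f x + g x)" using add.IH by (intro rapid_add) auto
    show "sch (\<lambda>x. dir_deriv j f x + dir_deriv j g x)" for j using add.IH by (intro sch.add) auto
  qed
next
  case (scale f c)
  have D: "((\<lambda>x. c * f x) has_derivative (\<lambda>h. c * frechet_derivative f (at x) h)) (at x)" for x
    using scale.IH by (intro has_derivative_mult_right) (auto simp: frechet_derivative_works[symmetric])
  have eq: "dir_deriv j (\<lambda>x. c * f x) = (\<lambda>x. c * dir_deriv j f x)" for j
    by (rule ext, subst dir_deriv_eq[OF D]) (simp add: dir_deriv_def)
  have ra: "rapid (\<lambda>x. c * f x)" using rapid_bounded_mult[of f "\<lambda>_. c" "norm c"] scale.IH by simp
  show ?case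
  proof (rule sch_caseI[OF D _ eq])
    show "rapid (\<lambda>x. c * f x)" using ra .
    show "sch (\<lambda>x. c * dir_deriv j f x)" for j using scale.IH by (intro sch.scale) auto
  qed
next
  case (coord f i)
  have D: "((\<lambda>x. of_real (x $ i) * f x) has_derivative (\<lambda>h. of_real (x $ i) * frechet_derivative f (at x) h + of_real (h $ i) * f x)) (at x)" for x
    using coord.IH by (intro has_derivative_mult has_derivative_of_real has_derivative_vec_nth') (auto simp: frechet_derivative_works[symmetric])
  have eq: "dir_deriv j (\<lambda>x. of_real (x $ i) * f x) = (\<lambda>x. of_real (x $ i) * dir_deriv j f x + of_real (axis j 1 $ i) * f x)" for j
    by (rule ext, subst dir_deriv_eq[OF D]) (simp add: dir_deriv_def)
  have sc: "sch (\<lambda>x. of_real (x $ i) * dir_deriv j f x + of_real (axis j 1 $ i) * f x)" for j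
    using coord by (intro sch.add sch.coord sch.scale) auto
  show ?case
  proof (rule sch_caseI[OF D _ eq])
    show "rapid (\<lambda>x. of_real (x $ i) * f x)" using coord.IH by (intro rapid_coord) auto
    show "sch (\<lambda>x. of_real (x $ i) * dir_deriv j f x + of_real (axis j 1 $ i) * f x)" for j using sc .
  qed
next
  case (modulate f a)
  have D: "((\<lambda>x. cis (x \<bullet> a) * f x) has_derivative (\<lambda>h. cis (x \<bullet> a) * frechet_derivative f (at x) h + (\<i> * of_real (h \<bullet> a) * cis (x \<bullet> a)) * f x)) (at x)" for x
    using modulate.IH by (intro has_derivative_mult has_derivative_cis_inner) (auto simp: frechet_derivative_works[symmetric])
  have eq: "dir_deriv j (\<lambda>x. cis (x \<bullet> a) * f x) = (\<lambda>x. cis (x \<bullet> a) * dir_deriv j f x + (\<i> * of_real (axis j 1 \<bullet> a)) * (cis (x \<bullet> a) * f x))" for j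
    by (rule ext, subst dir_deriv_eq[OF D]) (simp add: dir_deriv_def)
  have sc: "sch (\<lambda>x. cis (x \<bullet> a) * dir_deriv j f x + (\<i> * of_real (axis j 1 \<bullet> a)) * (cis (x \<bullet> a) * f x))" for j
    using modulate by (intro sch.add sch.modulate sch.scale) auto
  have ra: "rapid (\<lambda>x. cis (x \<bullet> a) * f x)"
    using modulate by (intro rapid_bounded_mult[where b = 1]) auto
  show ?case
  proof (rule sch_caseI[OF D _ eq])
    show "rapid (\<lambda>x. cis (x \<bullet> a) * f x)" using ra .
    show "sch (\<lambda>x. cis (x \<bullet> a) * dir_deriv j f x + (\<i> * of_real (axis j 1 \<bullet> a)) * (cis (x \<bullet> a) * f x))" for j using sc .
  qed
next
  case (translate f a)
  have "((\<lambda>x. x + a) has_derivative (\<lambda>h. h)) (at x)" for x by (auto intro!: derivative_eq_intros)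
  then have D: "((\<lambda>x. f (x + a)) has_derivative frechet_derivative f (at (x + a))) (at x)" for x
    using translate.IH by (intro has_derivative_compose[of "\<lambda>x. x + a" "\<lambda>h. h" x UNIV f]) (auto simp: frechet_derivative_works[symmetric])
  have eq: "dir_deriv j (\<lambda>x. f (x + a)) = (\<lambda>x. dir_deriv j f (x + a))" for j
    by (rule ext, subst dir_deriv_eq[OF D]) (simp add: dir_deriv_def)
  show ?case
  proof (rule sch_caseI[OF D _ eq])
    show "rapid (\<lambda>x. f (x + a))" using translate.IH by (intro rapid_translate) auto
    show "sch (\<lambda>x. dir_deriv j f (x + a))" for j using translate.IH by (intro sch.translate) auto
  qed
next
  case (reflect f)
  have "((\<lambda>x. - x) has_derivative (\<lambda>h. - h)) (at x)" for x :: "real^'n" by (auto intro!: derivative_eq_intros)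
  then have D: "((\<lambda>x. f (- x)) has_derivative (\<lambda>h. frechet_derivative f (at (- x)) (- h))) (at x)" for x
    using reflect.IH by (intro has_derivative_compose[of "\<lambda>x. - x" "\<lambda>h. - h" x UNIV f]) (auto simp: frechet_derivative_works[symmetric])
  have lin: "linear (frechet_derivative f (at x))" for x
    using reflect.IH by (simp add: linear_frechet_derivative)
  have eq: "dir_deriv j (\<lambda>x. f (- x)) = (\<lambda>x. (- 1) * dir_deriv j f (- x))" for j
    by (rule ext, subst dir_deriv_eq[OF D]) (simp add: dir_deriv_def linear_neg[OF lin])
  show ?case
  proof (rule sch_caseI[OF D _ eq])
    show "rapid (\<lambda>x. f (- x))" using reflect.IH by (intro rapid_reflect) auto
    show "sch (\<lambda>x. (- 1) * dir_deriv j f (- x))" for j using reflect.IH by (intro sch.scale sch.reflect) auto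
  qed
next
  case (tanh f m i b)
  let ?T = "\<lambda>x. complex_of_real (tanh (m * (x $ i - b)))"
  have D: "((\<lambda>x. ?T x * f x) has_derivative (\<lambda>h. ?T x * frechet_derivative f (at x) h + of_real ((1 - (tanh (m * (x $ i - b)))\<^sup>2) * (m * h $ i)) * f x)) (at x)" for x
    using tanh.IH by (intro has_derivative_mult has_derivative_tanh_coord) (auto simp: frechet_derivative_works[symmetric])
  have eq: "dir_deriv j (\<lambda>x. ?T x * f x) = (\<lambda>x. ?T x * dir_deriv j f x + (of_real (m * axis j 1 $ i) * f x + (- of_real (m * axis j 1 $ i)) * (?T x * (?T x * f x))))" for j
    by (rule ext, subst dir_deriv_eq[OF D]) (simp add: dir_deriv_def power2_eq_square algebra_simps)
  have sc: "sch (\<lambda>x. ?T x * dir_deriv j f x + (of_real (m * axis j 1 $ i) * f x + (- of_real (m * axis j 1 $ i)) * (?T x * (?T x * f x))))" for j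
    using tanh by (intro sch.add sch.tanh sch.scale) auto
  have ra: "rapid (\<lambda>x. ?T x * f x)"
    using tanh by (intro rapid_bounded_mult[where b = 1]) (auto simp: abs_if tanh_real_lt_1 tanh_real_gt_neg1 less_imp_le minus_le_iff)
  show ?case
  proof (rule sch_caseI[OF D _ eq])
    show "rapid (\<lambda>x. ?T x * f x)" using ra .
    show "sch (\<lambda>x. ?T x * dir_deriv j f x + (of_real (m * axis j 1 $ i) * f x + (- of_real (m * axis j 1 $ i)) * (?T x * (?T x * f x))))" for j using sc .
  qed
qed

lemma sch_iff: "sch f \<longleftrightarrow> schwartz f"
proof
  assume "sch f"
  then show "schwartz f"
    by (intro schwartz_coinduct[where C = "Collect sch"]) (auto dest: sch_main)
qed (rule sch.base)

lemmas schwartz_intros = sch.intros(2-9)[unfolded sch_iff]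

section \<open>Integrability of rapidly decreasing functions\<close>

lemma integrable_weight_1: "(\<integral>\<^sup>+x. ennreal (inverse (1 + x\<^sup>2)) \<partial>lborel) < \<infinity>"
proof -
  have "integrable lborel (\<lambda>x::real. inverse (1 + x\<^sup>2))"
    using integrable_inverse_1_plus_square unfolding set_integrable_def einterval_eq_UNIV by simp
  then show ?thesis by (subst nn_integral_eq_integral) auto
qed

definition weight :: "real^'n::finite \<Rightarrow> real" where
  "weight x = inverse ((1 + (norm x)\<^sup>2) ^ CARD('n))"

lemma weight_pos: "0 < weight x"
  unfolding weight_def by (simp add: add_pos_nonneg)

lemma weight_measurable [measurable]: "weight \<in> borel_measurable borel"
  unfolding weight_def by measurable

text \<open>The power (1 + |x|^2)^n dominates the product of the factors 1 + x_b^2 over the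
  coordinates, and the integral of the reciprocal of that product factors into one-dimensional
  integrals of 1/(1 + x^2).\<close>

lemma integrable_weight: "integrable lborel (weight :: real^'n::finite \<Rightarrow> real)"
proof (rule integrableI_bounded)
  have "(\<integral>\<^sup>+x. ennreal (norm (weight (x::real^'n))) \<partial>lborel) \<le>
      (\<integral>\<^sup>+x. (\<Prod>b\<in>(Basis::(real^'n) set). ennreal (inverse (1 + (x \<bullet> b)\<^sup>2))) \<partial>lborel)"
  proof (rule nn_integral_mono)
    fix x :: "real^'n"
    have "(\<Prod>b\<in>(Basis::(real^'n) set). 1 + (x \<bullet> b)\<^sup>2) \<le> (\<Prod>b\<in>(Basis::(real^'n) set). 1 + (norm x)\<^sup>2)"
      by (intro prod_mono) (auto simp: Basis_le_norm abs_le_square_iff[symmetric])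
    also have "\<dots> = (1 + (norm x)\<^sup>2) ^ CARD('n)" by simp
    finally have "norm (weight x) \<le> inverse (\<Prod>b\<in>(Basis::(real^'n) set). 1 + (x \<bullet> b)\<^sup>2)"
      using weight_pos[of x] unfolding weight_def
      by (auto intro!: le_imp_inverse_le prod_pos simp: add_pos_nonneg)
    also have "\<dots> = (\<Prod>b\<in>(Basis::(real^'n) set). inverse (1 + (x \<bullet> b)\<^sup>2))" by (simp add: prod_inversef[symmetric] o_def)
    finally show "ennreal (norm (weight x)) \<le> (\<Prod>b\<in>(Basis::(real^'n) set). ennreal (inverse (1 + (x \<bullet> b)\<^sup>2)))"
      by (subst prod_ennreal) (auto intro: ennreal_leI)
  qed
  also have "\<dots> = (\<Prod>b\<in>(Basis::(real^'n) set). (\<integral>\<^sup>+x. ennreal (inverse (1 + x\<^sup>2)) \<partial>lborel))"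
    by (rule nn_integral_lborel_prod) auto
  also have "\<dots> < \<infinity>"
    using integrable_weight_1 by (simp add: ennreal_prod_eq_top less_top[symmetric] power_eq_top_ennreal)
  finally show "(\<integral>\<^sup>+x. ennreal (norm (weight (x::real^'n))) \<partial>lborel) < \<infinity>" .
qed simp

lemma norm_le_inverse_power:
  assumes "norm (f x) \<le> K" "norm x ^ (2 * M) * norm (f x) \<le> L"
  shows "norm (f x) \<le> 2 ^ M * (K + L) * inverse ((1 + (norm x)\<^sup>2) ^ M)"
proof -
  have "(1 + (norm x)\<^sup>2) ^ M \<le> 2 ^ M * (1 ^ M + ((norm x)\<^sup>2) ^ M)"
    by (rule power_add_le) auto
  then have "(1 + (norm x)\<^sup>2) ^ M * norm (f x) \<le> 2 ^ M * (1 ^ M + ((norm x)\<^sup>2) ^ M) * norm (f x)"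
    by (intro mult_right_mono) auto
  also have "\<dots> = 2 ^ M * (norm (f x) + norm x ^ (2 * M) * norm (f x))"
    by (simp only: power_mult power_one distrib_right distrib_left mult_1_left mult.assoc)
  also have "\<dots> \<le> 2 ^ M * (K + L)" using assms by (intro mult_left_mono add_mono) auto
  finally show ?thesis by (simp add: field_simps add_pos_nonneg)
qed

lemma rapid_le_inverse_power:
  assumes "rapid f"
  obtains K where "0 \<le> K" "\<And>x. norm (f x) \<le> K * inverse ((1 + (norm x)\<^sup>2) ^ M)"
proof -
  obtain K L where K: "\<And>x. norm x ^ 0 * norm (f x) \<le> K" and L: "\<And>x. norm x ^ (2 * M) * norm (f x) \<le> L"
    using assms(1) unfolding rapid_def by metis
  have "0 \<le> 2 ^ M * (K + L)" using order_trans[OF _ K[of 0]] order_trans[OF _ L[of 0]] by simp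
  moreover have "norm (f x) \<le> 2 ^ M * (K + L) * inverse ((1 + (norm x)\<^sup>2) ^ M)" for x
    using K[of x] L[of x] by (intro norm_le_inverse_power) auto
  ultimately show ?thesis using that by blast
qed

lemmas norm_le_weight = norm_le_inverse_power[where M = "CARD('n)" and f = f for f :: "real^'n::finite \<Rightarrow> complex", folded weight_def]
lemmas rapid_le_weight = rapid_le_inverse_power[where M = "CARD('n)" and f = f for f :: "real^'n::finite \<Rightarrow> complex", folded weight_def]

lemma integrable_rapid:
  fixes f :: "real^'n::finite \<Rightarrow> complex"
  assumes "rapid f" and [measurable]: "f \<in> borel_measurable borel"
  shows "integrable lborel f"
proof -
  obtain K where K: "0 \<le> K" "\<And>x. norm (f x) \<le> K * weight x" using rapid_le_weight[OF assms(1)] by metis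
  have "integrable lborel (\<lambda>x. K * weight (x::real^'n))" by (intro integrable_mult_right integrable_weight)
  then show ?thesis
  proof (rule Bochner_Integration.integrable_bound)
    have "norm (f x) \<le> norm (K * weight x)" for x
      using K(2)[of x] abs_ge_self[of "K * weight x"] unfolding real_norm_def by linarith
    then show "AE x in lborel. norm (f x) \<le> norm (K * weight x)" by simp
  qed simp
qed

lemma integrable_schwartz: "schwartz f \<Longrightarrow> integrable lborel f"
  by (intro integrable_rapid schwartz_rapid schwartz_measurable)

section \<open>The Fourier transform on Schwartz functions\<close>

definition ee :: "real^'n::finite \<Rightarrow> real^'n \<Rightarrow> complex" where
  "ee x t = cis (x \<bullet> (- (2 * pi) *\<^sub>R t))"

lemma fourier_eq: "fourier f t = (LINT x|lborel. f x * ee x t)"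
  unfolding fourier_def ee_def cis_conv_exp by (simp add: mult_ac)

lemma norm_ee [simp]: "norm (ee x t) = 1" by (simp add: ee_def)

lemma ee_commute: "ee x t = ee t x" by (simp add: ee_def inner_commute)

lemma ee_add: "ee (x + y) t = ee x t * ee y t" by (simp add: ee_def cis_mult inner_add_left algebra_simps)

lemma ee_zero [simp]: "ee 0 t = 1" "ee x 0 = 1" by (simp_all add: ee_def)

lemma ee_scale: "ee (c *\<^sub>R x) t = ee x (c *\<^sub>R t)" by (simp add: ee_def mult_ac)

lemma ee_minus: "ee (- x) t = cnj (ee x t)" by (simp add: ee_def cis_cnj)

lemma ee_measurable [measurable]: "(\<lambda>x. ee x t) \<in> borel_measurable borel"
  unfolding ee_def cis_conv_exp by measurable

lemma ee_measurable_pair: "(\<lambda>p. ee (fst p) (snd p)) \<in> borel_measurable (lborel \<Otimes>\<^sub>M lborel)"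
  unfolding ee_def cis_conv_exp by measurable

lemma integrable_mult_ee: "integrable lborel f \<Longrightarrow> integrable lborel (\<lambda>x. f x * ee x t)"
  by (rule Bochner_Integration.integrable_bound) (auto simp: norm_mult)

lemma integral_affine:
  fixes f :: "'a::euclidean_space \<Rightarrow> 'b::{banach, second_countable_topology}"
  assumes [measurable]: "f \<in> borel_measurable borel" and c: "c \<noteq> 0"
  shows "integral\<^sup>L lborel f = (\<bar>c\<bar> ^ DIM('a)) *\<^sub>R (LINT x|lborel. f (a + c *\<^sub>R x))"
  by (subst lborel_affine[OF c, of a])
     (simp add: integral_density integral_distr)

lemma integrable_affine:
  fixes f :: "'a::euclidean_space \<Rightarrow> 'b::{banach, second_countable_topology}"
  assumes f: "integrable lborel f" and c: "c \<noteq> 0"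
  shows "integrable lborel (\<lambda>x. f (a + c *\<^sub>R x))"
proof -
  have [measurable]: "f \<in> borel_measurable borel" using f by auto
  have "integrable (density (distr lborel borel (\<lambda>x. a + c *\<^sub>R x)) (\<lambda>_. ennreal (\<bar>c\<bar> ^ DIM('a)))) f"
    using f lborel_affine[OF c, of a] by metis
  then have "integrable lborel (\<lambda>x. \<bar>c\<bar> ^ DIM('a) *\<^sub>R f (a + c *\<^sub>R x))"
    by (simp add: integrable_density integrable_distr_eq)
  from integrable_scaleR_right[OF this, of "inverse (\<bar>c\<bar> ^ DIM('a))"] show ?thesis
    using c by simp
qed

lemma integral_translate:
  fixes f :: "'a::euclidean_space \<Rightarrow> 'b::{banach, second_countable_topology}"
  assumes "f \<in> borel_measurable borel"
  shows "(LINT x|lborel. f (x + a)) = integral\<^sup>L lborel f"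
  using integral_affine[OF assms, of 1 a] by (simp add: add.commute)

text \<open>A shift of length at most 1 costs only a constant factor. This gives difference
  quotients one integrable majorant, uniform in the step size.\<close>

lemma weight_translate_le:
  fixes x a :: "real^'n::finite"
  assumes "norm a \<le> 1" shows "weight (x + a) \<le> 3 ^ CARD('n) * weight x"
proof -
  have "norm x \<le> norm (x + a) + norm a" using norm_triangle_ineq4[of "x + a" a] by simp
  then have "norm x \<le> norm (x + a) + 1" using assms by linarith
  then have "(norm x)\<^sup>2 \<le> (norm (x + a) + 1)\<^sup>2" by (intro power_mono) auto
  moreover have "(norm (x + a) + 1)\<^sup>2 \<le> 2 * (norm (x + a))\<^sup>2 + 2"
    using zero_le_power2[of "norm (x + a) - 1"] by (simp add: power2_sum power2_diff)
  ultimately have "1 + (norm x)\<^sup>2 \<le> 3 + 3 * (norm (x + a))\<^sup>2" using zero_le_power2[of "norm (x + a)"] by linarith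
  then have "1 + (norm x)\<^sup>2 \<le> 3 * (1 + (norm (x + a))\<^sup>2)" by (simp only: distrib_left mult_1_right)
  then have "(1 + (norm x)\<^sup>2) ^ CARD('n) \<le> (3 * (1 + (norm (x + a))\<^sup>2)) ^ CARD('n)"
    by (rule power_mono) simp
  also have "\<dots> = 3 ^ CARD('n) * (1 + (norm (x + a))\<^sup>2) ^ CARD('n)" by (rule power_mult_distrib)
  finally have *: "(1 + (norm x)\<^sup>2) ^ CARD('n) \<le> 3 ^ CARD('n) * (1 + (norm (x + a))\<^sup>2) ^ CARD('n)" .
  have "0 < (1 + (norm x)\<^sup>2) ^ CARD('n)" "0 < (1 + (norm (x + a))\<^sup>2) ^ CARD('n)" by (simp_all add: add_pos_nonneg)
  then show ?thesis unfolding weight_def using * by (simp only: divide_inverse[symmetric] pos_le_divide_eq pos_divide_le_eq inverse_eq_divide times_divide_eq_right times_divide_eq_left mult_1 mult_1_right)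
qed

lemma directional_derivative:
  assumes "schwartz f"
  shows "((\<lambda>h. f (x + h *\<^sub>R axis i 1)) has_derivative (\<lambda>h. h *\<^sub>R dir_deriv i f (x + \<theta> *\<^sub>R axis i 1))) (at \<theta>)"
proof -
  let ?y = "x + \<theta> *\<^sub>R axis i 1"
  have f': "(f has_derivative frechet_derivative f (at ?y)) (at ?y)"
    using schwartz_differentiable[OF assms] by (simp add: frechet_derivative_works[symmetric])
  have "((\<lambda>h. x + h *\<^sub>R axis i 1) has_derivative (\<lambda>h. h *\<^sub>R axis i 1)) (at \<theta>)"
    by (auto intro!: derivative_eq_intros)
  from has_derivative_compose[OF this f'] show ?thesis
    using linear_scale[OF linear_frechet_derivative[OF schwartz_differentiable[OF assms]]]
    by (simp add: dir_deriv_def)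
qed

lemma inverse_Suc_limits:
  "(\<lambda>k. inverse (real (Suc k))) \<longlonglongrightarrow> 0" "filterlim (\<lambda>k. inverse (real (Suc k))) (at 0) sequentially"
  using LIMSEQ_inverse_real_of_nat by (auto simp: filterlim_at intro!: always_eventually)

text \<open>Integration by parts without Fubini: differentiate the translation invariance
  of the integral.\<close>

lemma fourier_dir_deriv:
  fixes f :: "real^'n::finite \<Rightarrow> complex"
  assumes f: "schwartz f"
  shows "fourier (dir_deriv i f) t = (2 * pi * \<i> * of_real (t $ i)) * fourier f t"
proof -
  let ?e = "axis i 1 :: real^'n"
  define h where "h k = inverse (real (Suc k))" for k
  have h: "0 < h k" "h k \<le> 1" for k by (auto simp: h_def inverse_le_1_iff)
  have h0: "h \<longlonglongrightarrow> 0" "filterlim h (at 0) sequentially"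
    unfolding h_def[abs_def] using inverse_Suc_limits by auto
  have [measurable]: "f \<in> borel_measurable borel" "dir_deriv i f \<in> borel_measurable borel"
    using f schwartz_dir_deriv schwartz_measurable by blast+
  define q where "q k x = (f (x + h k *\<^sub>R ?e) - f x) / of_real (h k) * ee x t" for k x
  obtain K where K: "0 \<le> K" "\<And>x. norm (dir_deriv i f x) \<le> K * weight x"
    using rapid_le_weight[OF schwartz_rapid[OF schwartz_dir_deriv[OF f]]] by metis
  \<comment> \<open>The mean value inequality along a segment of length at most 1, followed by
    \<open>weight_translate_le\<close>, bounds all difference quotients by one integrable
    function.\<close>
  have qbound: "norm (q k x) \<le> K * (3 ^ CARD('n) * weight x)" for k x
  proof -
    have D: "((\<lambda>s. f (x + s *\<^sub>R ?e)) has_derivative (\<lambda>s. s *\<^sub>R dir_deriv i f (x + \<theta> *\<^sub>R ?e))) (at \<theta>)" for \<theta>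
      by (rule directional_derivative[OF f])
    have "continuous_on {0..h k} (\<lambda>s. f (x + s *\<^sub>R ?e))"
      by (intro continuous_at_imp_continuous_on ballI has_derivative_continuous[OF D])
    from mvt_general[OF h(1)[of k] this D] obtain \<theta> where \<theta>: "\<theta> \<in> {0<..<h k}"
      "norm (f (x + h k *\<^sub>R ?e) - f x) \<le> norm (h k *\<^sub>R dir_deriv i f (x + \<theta> *\<^sub>R ?e))"
      unfolding scaleR_zero_left add_0_right diff_zero by (elim bexE)
    have "norm (\<theta> *\<^sub>R ?e) \<le> 1" using \<theta>(1) h(2)[of k] by simp
    have "norm (f (x + h k *\<^sub>R ?e) - f x) \<le> h k * norm (dir_deriv i f (x + \<theta> *\<^sub>R ?e))"
      using \<theta>(2) h(1)[of k] by simp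
    also have "\<dots> \<le> h k * (K * weight (x + \<theta> *\<^sub>R ?e))"
      using K h(1)[of k] by (intro mult_left_mono) auto
    also have "\<dots> \<le> h k * (K * (3 ^ CARD('n) * weight x))"
      using K h(1)[of k] weight_translate_le[OF \<open>norm (\<theta> *\<^sub>R ?e) \<le> 1\<close>] by (intro mult_left_mono) auto
    finally have "norm (f (x + h k *\<^sub>R ?e) - f x) / h k \<le> K * (3 ^ CARD('n) * weight x)"
      using h(1)[of k] by (simp add: field_simps)
    then show ?thesis using h(1)[of k] by (simp add: q_def norm_mult norm_divide)
  qed
  have qlim: "(\<lambda>k. q k x) \<longlonglongrightarrow> dir_deriv i f x * ee x t" for x
  proof -
    let ?v = "dir_deriv i f x"
    have "((\<lambda>s. f (x + s *\<^sub>R ?e)) has_derivative (\<lambda>s. s *\<^sub>R ?v)) (at 0)"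
      using directional_derivative[OF f, of x i 0] by simp
    then have "((\<lambda>s. norm (f (x + s *\<^sub>R ?e) - f x - s *\<^sub>R ?v) / norm s) \<longlongrightarrow> 0) (at 0)"
      unfolding has_derivative_at by simp
    then have "((\<lambda>k. norm (f (x + h k *\<^sub>R ?e) - f x - h k *\<^sub>R ?v) / norm (h k)) \<longlongrightarrow> 0) sequentially"
      by (rule filterlim_compose[OF _ h0(2)])
    moreover have "norm (f (x + h k *\<^sub>R ?e) - f x - h k *\<^sub>R ?v) / norm (h k) =
        norm ((f (x + h k *\<^sub>R ?e) - f x) / of_real (h k) - ?v)" for k
    proof -
      have "(f (x + h k *\<^sub>R ?e) - f x) / of_real (h k) - ?v =
        (f (x + h k *\<^sub>R ?e) - f x - h k *\<^sub>R ?v) / of_real (h k)"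
        using h(1)[of k] by (simp add: diff_divide_distrib scaleR_conv_of_real)
      then show ?thesis by (simp add: norm_divide)
    qed
    ultimately have "(\<lambda>k. (f (x + h k *\<^sub>R ?e) - f x) / of_real (h k) - ?v) \<longlonglongrightarrow> 0"
      by (simp add: tendsto_norm_zero_iff)
    then have "(\<lambda>k. (f (x + h k *\<^sub>R ?e) - f x) / of_real (h k)) \<longlonglongrightarrow> ?v" by (rule LIM_zero_cancel)
    then show ?thesis unfolding q_def by (intro tendsto_mult) auto
  qed
  have "(\<lambda>k. integral\<^sup>L lborel (q k)) \<longlonglongrightarrow> (LINT x|lborel. dir_deriv i f x * ee x t)"
  proof (rule integral_dominated_convergence[where w = "\<lambda>x. K * (3 ^ CARD('n) * weight x)"])
    show "integrable lborel (\<lambda>x::real^'n. K * (3 ^ CARD('n) * weight x))"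
      by (intro integrable_mult_right integrable_weight)
    show "q k \<in> borel_measurable lborel" for k unfolding q_def by measurable
  qed (use qlim qbound in auto)
  then have lim1: "(\<lambda>k. integral\<^sup>L lborel (q k)) \<longlonglongrightarrow> fourier (dir_deriv i f) t"
    by (simp add: fourier_eq)
  \<comment> \<open>Translation moves the increment from \<open>f\<close> to the character, where it
    becomes a scalar. The integral of the difference quotient is thus \<open>fourier f t\<close>
    times a difference quotient of an exponential at 0.\<close>
  have qint: "integral\<^sup>L lborel (q k) = ((cis (h k * (2 * pi * t $ i)) - 1) / of_real (h k)) * fourier f t" for k
  proof -
    let ?a = "h k *\<^sub>R ?e"
    have "(LINT x|lborel. f (x + ?a) * ee x t) = (LINT x|lborel. (\<lambda>y. ee (- ?a) t * (f y * ee y t)) (x + ?a))"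
    proof (rule Bochner_Integration.integral_cong)
      fix x
      have "ee x t = ee (- ?a) t * ee (x + ?a) t" using ee_add[of "- ?a" "x + ?a" t] by simp
      then show "f (x + ?a) * ee x t = (\<lambda>y. ee (- ?a) t * (f y * ee y t)) (x + ?a)" by (simp add: mult_ac)
    qed simp
    also have "\<dots> = (LINT x|lborel. ee (- ?a) t * (f x * ee x t))"
      by (rule integral_translate) measurable
    also have "\<dots> = ee (- ?a) t * fourier f t" by (simp add: fourier_eq)
    also have "ee (- ?a) t = cis (h k * (2 * pi * t $ i))" by (simp add: ee_def inner_axis' mult_ac)
    finally have 1: "(LINT x|lborel. f (x + ?a) * ee x t) = cis (h k * (2 * pi * t $ i)) * fourier f t" .
    have int: "integrable lborel (\<lambda>x. f (x + ?a) * ee x t)" "integrable lborel (\<lambda>x. f x * ee x t)"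
      using integrable_affine[OF integrable_schwartz[OF f], of 1 ?a] integrable_schwartz[OF f]
      by (auto intro!: integrable_mult_ee simp: add.commute)
    have "integral\<^sup>L lborel (q k) = (LINT x|lborel. (f (x + ?a) * ee x t - f x * ee x t) / of_real (h k))"
      unfolding q_def by (rule Bochner_Integration.integral_cong) (auto simp: field_simps)
    also have "\<dots> = ((LINT x|lborel. f (x + ?a) * ee x t) - fourier f t) / of_real (h k)"
      using int by (simp add: fourier_eq)
    finally show ?thesis unfolding 1 by (simp add: algebra_simps)
  qed
  have "((\<lambda>z. exp (\<i> * of_real (2 * pi * t $ i) * z)) has_field_derivative \<i> * of_real (2 * pi * t $ i)) (at 0)"
    by (auto intro!: derivative_eq_intros)
  then have "((\<lambda>z. (exp (\<i> * of_real (2 * pi * t $ i) * z) - 1) / z) \<longlongrightarrow> \<i> * of_real (2 * pi * t $ i)) (at 0)"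
    unfolding DERIV_def by simp
  moreover have "filterlim (\<lambda>k. complex_of_real (h k)) (at 0) sequentially"
  proof -
    have "complex_of_real (h k) \<noteq> 0" for k using h(1)[of k] by simp
    moreover have "(\<lambda>k. complex_of_real (h k)) \<longlonglongrightarrow> 0"
      using tendsto_of_real[OF h0(1), where 'a = complex] by simp
    ultimately show ?thesis unfolding filterlim_at by simp
  qed
  ultimately have "(\<lambda>k. (exp (\<i> * of_real (2 * pi * t $ i) * of_real (h k)) - 1) / of_real (h k)) \<longlonglongrightarrow> \<i> * of_real (2 * pi * t $ i)"
    by (rule filterlim_compose)
  then have "(\<lambda>k. (cis (h k * (2 * pi * t $ i)) - 1) / of_real (h k)) \<longlonglongrightarrow> \<i> * of_real (2 * pi * t $ i)"
    by (simp add: cis_conv_exp mult_ac)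
  then have "(\<lambda>k. integral\<^sup>L lborel (q k)) \<longlonglongrightarrow> (\<i> * of_real (2 * pi * t $ i)) * fourier f t"
    unfolding qint by (intro tendsto_mult_right)
  from LIMSEQ_unique[OF lim1 this] show ?thesis by (simp add: mult_ac)
qed

lemma fourier_iter_deriv:
  assumes f: "schwartz f"
  shows "fourier (iter_deriv (replicate k i) f) t = (2 * pi * \<i> * of_real (t $ i)) ^ k * fourier f t"
proof (induction k)
  case (Suc k)
  show ?case using fourier_dir_deriv[OF schwartz_iter_deriv[OF f], of i "replicate k i" t] Suc by simp
qed simp

lemma norm_fourier_le: "norm (fourier f t) \<le> (LINT x|lborel. norm (f x))"
  unfolding fourier_eq by (rule order_trans[OF integral_norm_bound]) (simp add: norm_mult)

lemma norm_cis_minus_linear: "norm (cis y - 1 - \<i> * of_real y) \<le> y\<^sup>2 / 2"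
  using iexp_approx1[of y 1] by (simp add: cis_conv_exp power2_eq_square algebra_simps)

lemma fourier_add: "\<lbrakk>integrable lborel f; integrable lborel g\<rbrakk> \<Longrightarrow> fourier (\<lambda>x. f x + g x) t = fourier f t + fourier g t"
  unfolding fourier_eq by (simp add: distrib_right integrable_mult_ee)

lemma fourier_cmult: "fourier (\<lambda>x. c * f x) t = c * fourier f t"
  unfolding fourier_eq by (simp add: mult.assoc)

lemma schwartz_mult_coord: "schwartz f \<Longrightarrow> schwartz (\<lambda>x. c * (of_real (x $ i) * f x))"
  by (intro schwartz_intros)

text \<open>The Taylor remainder of the character, |cis y - 1 - i y| <= y^2/2, is integrated against
  |f|. Since |x|^2 |f(x)| is integrable the error is at most C |h|^2, which gives total
  differentiability in one step.\<close>

lemma fourier_has_derivative: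
  fixes f :: "real^'n::finite \<Rightarrow> complex"
  assumes f: "schwartz f"
  shows "(fourier f has_derivative
     (\<lambda>h. \<Sum>i\<in>UNIV. of_real (h $ i) * fourier (\<lambda>x. (- (2 * pi) * \<i>) * (of_real (x $ i) * f x)) t)) (at t)"
  (is "(_ has_derivative ?D) _")
proof -
  have [measurable]: "f \<in> borel_measurable borel" using f schwartz_measurable by blast
  have intf: "integrable lborel f" by (rule integrable_schwartz[OF f])
  have rap: "rapid (\<lambda>x. of_real ((norm x)\<^sup>2) * f x)"
    unfolding rapid_def
  proof
    fix m
    have eq: "norm x ^ m * norm (of_real ((norm x)\<^sup>2) * f x) = norm x ^ (m + 2) * norm (f x)" for x
      by (simp add: norm_mult power_add power2_eq_square)
    show "\<exists>K. \<forall>x. norm x ^ m * norm (of_real ((norm x)\<^sup>2) * f x) \<le> K"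
      unfolding eq using schwartz_rapid[OF f] unfolding rapid_def by blast
  qed
  have int2: "integrable lborel (\<lambda>x. (norm x)\<^sup>2 * norm (f x))"
    using integrable_norm[OF integrable_rapid[OF rap]] by (simp add: norm_mult norm_power)
  define C where "C = (2 * pi)\<^sup>2 / 2 * (LINT x|lborel. (norm x)\<^sup>2 * norm (f x))"
  have Dh: "?D h = (LINT x|lborel. f x * ee x t * (\<i> * of_real (x \<bullet> (- (2 * pi) *\<^sub>R h))))"
    and Dint: "integrable lborel (\<lambda>x. f x * ee x t * (\<i> * of_real (x \<bullet> (- (2 * pi) *\<^sub>R h))))" for h
  proof -
    let ?g = "\<lambda>i x. of_real (h $ i) * ((- (2 * pi) * \<i>) * (of_real (x $ i) * f x) * ee x t)"
    have int: "integrable lborel (?g i)" for i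
      by (intro integrable_mult_right integrable_mult_ee integrable_schwartz schwartz_mult_coord f)
    have eq: "f x * ee x t * (\<i> * of_real (x \<bullet> (- (2 * pi) *\<^sub>R h))) = (\<Sum>i\<in>UNIV. ?g i x)" for x
    proof -
      have "complex_of_real (x \<bullet> (- (2 * pi) *\<^sub>R h)) = (\<Sum>i\<in>UNIV. of_real (- (2 * pi) * (x $ i * h $ i)))"
        by (simp add: inner_vec_def sum_negf sum_distrib_left mult_ac)
      then show ?thesis by (simp add: sum_distrib_left mult_ac)
    qed
    show "integrable lborel (\<lambda>x. f x * ee x t * (\<i> * of_real (x \<bullet> (- (2 * pi) *\<^sub>R h))))"
      unfolding eq using int by auto
    show "?D h = (LINT x|lborel. f x * ee x t * (\<i> * of_real (x \<bullet> (- (2 * pi) *\<^sub>R h))))"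
      unfolding eq using int by (simp add: fourier_eq del: mult_minus_left)
  qed
  have bound: "norm (fourier f (t + h) - fourier f t - ?D h) \<le> C * (norm h)\<^sup>2" for h
  proof -
    let ?r = "\<lambda>x. f x * ee x t * (cis (x \<bullet> (- (2 * pi) *\<^sub>R h)) - 1 - \<i> * of_real (x \<bullet> (- (2 * pi) *\<^sub>R h)))"
    have i1: "integrable lborel (\<lambda>x. f x * ee x (t + h))" "integrable lborel (\<lambda>x. f x * ee x t)"
      by (intro integrable_mult_ee intf)+
    have "fourier f (t + h) - fourier f t - ?D h =
        (LINT x|lborel. f x * ee x (t + h) - f x * ee x t - f x * ee x t * (\<i> * of_real (x \<bullet> (- (2 * pi) *\<^sub>R h))))"
      unfolding Dh unfolding fourier_eq using i1 Dint[of h] by (simp del: mult_minus_left inner_scaleR_right)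
    also have "\<dots> = (LINT x|lborel. ?r x)"
    proof (rule Bochner_Integration.integral_cong)
      fix x
      have "ee x (t + h) = ee x t * cis (x \<bullet> (- (2 * pi) *\<^sub>R h))"
        by (simp add: ee_def cis_mult inner_add_right algebra_simps)
      then show "f x * ee x (t + h) - f x * ee x t - f x * ee x t * (\<i> * of_real (x \<bullet> (- (2 * pi) *\<^sub>R h))) = ?r x"
        by (simp add: algebra_simps)
    qed simp
    finally have "norm (fourier f (t + h) - fourier f t - ?D h) = norm (LINT x|lborel. ?r x)" by simp
    also have "\<dots> \<le> (LINT x|lborel. (2 * pi)\<^sup>2 / 2 * (norm h)\<^sup>2 * ((norm x)\<^sup>2 * norm (f x)))"
    proof (rule order_trans[OF integral_norm_bound], rule integral_mono')
      show "integrable lborel (\<lambda>x. (2 * pi)\<^sup>2 / 2 * (norm h)\<^sup>2 * ((norm x)\<^sup>2 * norm (f x)))"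
        by (intro integrable_mult_right int2)
      show "norm (?r x) \<le> (2 * pi)\<^sup>2 / 2 * (norm h)\<^sup>2 * ((norm x)\<^sup>2 * norm (f x))" for x
      proof -
        let ?y = "x \<bullet> (- (2 * pi) *\<^sub>R h)"
        have "\<bar>?y\<bar> \<le> norm x * norm (- (2 * pi) *\<^sub>R h)" by (rule Cauchy_Schwarz_ineq2)
        then have "?y\<^sup>2 \<le> (norm x * norm (- (2 * pi) *\<^sub>R h))\<^sup>2" by (metis abs_ge_zero power2_abs power_mono)
        also have "\<dots> = (2 * pi)\<^sup>2 * (norm h)\<^sup>2 * (norm x)\<^sup>2" by (simp add: power_mult_distrib)
        finally have "norm (cis ?y - 1 - \<i> * of_real ?y) \<le> (2 * pi)\<^sup>2 * (norm h)\<^sup>2 * (norm x)\<^sup>2 / 2"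
          using norm_cis_minus_linear[of ?y] by linarith
        then have "norm (f x) * norm (cis ?y - 1 - \<i> * of_real ?y) \<le> norm (f x) * ((2 * pi)\<^sup>2 * (norm h)\<^sup>2 * (norm x)\<^sup>2 / 2)"
          by (intro mult_left_mono) auto
        then show "norm (?r x) \<le> (2 * pi)\<^sup>2 / 2 * (norm h)\<^sup>2 * ((norm x)\<^sup>2 * norm (f x))"
          by (simp add: norm_mult mult_ac)
      qed
    qed simp
    also have "\<dots> = C * (norm h)\<^sup>2" by (simp add: C_def)
    finally show ?thesis .
  qed
  have "bounded_linear ?D"
    by (intro bounded_linear_sum bounded_linear_mult_const bounded_linear_compose[OF bounded_linear_of_real] bounded_linear_vec_nth)
  moreover have "((\<lambda>h. norm (fourier f (t + h) - fourier f t - ?D h) / norm h) \<longlongrightarrow> 0) (at 0)"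
  proof (rule Lim_null_comparison)
    have "((\<lambda>h::real^'n. C * norm h) \<longlongrightarrow> C * norm (0::real^'n)) (at 0)"
      by (intro tendsto_intros)
    then show "((\<lambda>h::real^'n. C * norm h) \<longlongrightarrow> 0) (at 0)" by simp
    show "\<forall>\<^sub>F h in at 0. norm (norm (fourier f (t + h) - fourier f t - ?D h) / norm h) \<le> C * norm h"
      using bound by (auto intro!: eventually_at_filter[THEN iffD2] always_eventually simp: divide_simps power2_eq_square mult.assoc)
  qed
  ultimately show ?thesis unfolding has_derivative_at by blast
qed

lemma dir_deriv_fourier:
  assumes f: "schwartz f"
  shows "dir_deriv i (fourier f) = fourier (\<lambda>x. (- (2 * pi) * \<i>) * (of_real (x $ i) * f x))"
proof
  fix t
  have "dir_deriv i (fourier f) t = (\<Sum>j\<in>UNIV. of_real (axis i (1::real) $ j) *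
      fourier (\<lambda>x. (- (2 * pi) * \<i>) * (of_real (x $ j) * f x)) t)"
    by (rule dir_deriv_eq[OF fourier_has_derivative[OF f]])
  also have "\<dots> = (\<Sum>j\<in>UNIV. if j = i then fourier (\<lambda>x. (- (2 * pi) * \<i>) * (of_real (x $ j) * f x)) t else 0)"
    by (rule sum.cong) (auto simp: axis_def)
  also have "\<dots> = fourier (\<lambda>x. (- (2 * pi) * \<i>) * (of_real (x $ i) * f x)) t" by simp
  finally show "dir_deriv i (fourier f) t = fourier (\<lambda>x. (- (2 * pi) * \<i>) * (of_real (x $ i) * f x)) t" .
qed

lemma norm_power_le_sum: "norm (t::real^'n::finite) ^ k \<le> real CARD('n) ^ k * (\<Sum>i\<in>UNIV. \<bar>t $ i\<bar> ^ k)"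
proof -
  obtain j where j: "\<And>i. \<bar>t $ i\<bar> \<le> \<bar>t $ j\<bar>"
  proof -
    have "Max (range (\<lambda>i. \<bar>t $ i\<bar>)) \<in> range (\<lambda>i. \<bar>t $ i\<bar>)" by (rule Max_in) auto
    then obtain j where "Max (range (\<lambda>i. \<bar>t $ i\<bar>)) = \<bar>t $ j\<bar>" by (elim rangeE)
    then show ?thesis using that[of j] Max_ge[of "range (\<lambda>i. \<bar>t $ i\<bar>)"] by auto
  qed
  have "norm t \<le> (\<Sum>i\<in>UNIV. \<bar>t $ i\<bar>)" by (rule norm_le_l1_cart)
  also have "\<dots> \<le> (\<Sum>i\<in>(UNIV::'n set). \<bar>t $ j\<bar>)" by (intro sum_mono j)
  finally have "norm t ^ k \<le> (real CARD('n) * \<bar>t $ j\<bar>) ^ k" by (intro power_mono) auto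
  also have "\<dots> = real CARD('n) ^ k * \<bar>t $ j\<bar> ^ k" by (simp add: power_mult_distrib)
  also have "\<dots> \<le> real CARD('n) ^ k * (\<Sum>i\<in>UNIV. \<bar>t $ i\<bar> ^ k)"
    by (intro mult_left_mono member_le_sum) auto
  finally show ?thesis .
qed

text \<open>The set \<open>K\<close> and the constant \<open>C\<close> are independent of the
  function, which is what makes \<open>dist_of\<close> continuous for the Schwartz seminorms.
  Derivatives of order 2M produce the factors |t_i|^(2M), and the L^1 norms that bound the
  transforms are estimated with \<open>weight\<close>.\<close>

lemma fourier_decay:
  obtains C :: real and K :: "(nat \<times> 'n::finite list) set" where "finite K" "0 \<le> C"
    "\<And>f t. schwartz f \<Longrightarrow>
      (1 + (norm (t::real^'n))\<^sup>2) ^ M * norm (fourier f t) \<le> C * (\<Sum>(m, \<alpha>)\<in>K. schwartz_seminorm m \<alpha> f)"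
proof -
  let ?n = "CARD('n)"
  \<comment> \<open>The weights 0 and 2n are those needed to majorise a function by
    \<open>weight\<close>; the multi-indices are the empty one and the 2M-fold derivative in each
    single coordinate.\<close>
  define K where "K = {0, 2 * ?n} \<times> insert [] (range (\<lambda>i::'n. replicate (2 * M) i))"
  define W where "W = 2 ^ ?n * integral\<^sup>L lborel (weight :: real^'n \<Rightarrow> real)"
  define C where "C = 2 ^ M * (2 * W + real ?n ^ (2 * M) * (real ?n * (2 * W)))"
  have W: "0 \<le> W" unfolding W_def
    by (intro mult_nonneg_nonneg integral_nonneg_AE AE_I2 less_imp_le[OF weight_pos]) simp
  have finK: "finite K" by (simp add: K_def)
  have main: "(1 + (norm t)\<^sup>2) ^ M * norm (fourier f t) \<le> C * (\<Sum>(m, \<alpha>)\<in>K. schwartz_seminorm m \<alpha> f)"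
    if f: "schwartz f" for f and t :: "real^'n"
  proof -
    define T where "T = (\<Sum>(m, \<alpha>)\<in>K. schwartz_seminorm m \<alpha> f)"
    have le_T: "schwartz_seminorm m \<alpha> f \<le> T" if "(m, \<alpha>) \<in> K" for m \<alpha>
    proof -
      have "(case (m, \<alpha>) of (m, \<alpha>) \<Rightarrow> schwartz_seminorm m \<alpha> f) \<le> T" unfolding T_def
        by (rule member_le_sum[OF that]) (auto simp: finK seminorm_nonneg f)
      then show ?thesis by simp
    qed
    have F: "norm (fourier (iter_deriv \<alpha> f) t) \<le> 2 * W * T"
      if \<alpha>: "\<alpha> \<in> insert [] (range (\<lambda>i::'n. replicate (2 * M) i))" for \<alpha>
    proof -
      let ?g = "iter_deriv \<alpha> f"
      have g: "schwartz ?g" by (rule schwartz_iter_deriv[OF f])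
      have "norm (?g x) \<le> 2 ^ ?n * (T + T) * weight x" for x
      proof (rule norm_le_weight)
        show "norm (?g x) \<le> T" using seminorm_ge[OF f, of x 0 \<alpha>] le_T[of 0 \<alpha>] \<alpha> by (simp add: K_def)
        show "norm x ^ (2 * ?n) * norm (?g x) \<le> T"
          using seminorm_ge[OF f, of x "2 * ?n" \<alpha>] le_T[of "2 * ?n" \<alpha>] \<alpha> by (simp add: K_def)
      qed
      then have "(LINT x|lborel. norm (?g x)) \<le> (LINT x|lborel. 2 ^ ?n * (T + T) * weight (x::real^'n))"
        by (intro integral_mono integrable_norm integrable_schwartz g integrable_mult_right integrable_weight)
      also have "\<dots> = 2 * W * T" by (simp add: W_def)
      finally show ?thesis using norm_fourier_le[of ?g t] by linarith
    qed
    have F0: "norm (fourier f t) \<le> 2 * W * T" using F[of "[]"] by simp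
    have Fi: "\<bar>t $ i\<bar> ^ (2 * M) * norm (fourier f t) \<le> 2 * W * T" for i
    proof -
      have "1 * \<bar>t $ i\<bar> \<le> 2 * pi * \<bar>t $ i\<bar>" using pi_ge_two by (intro mult_right_mono) auto
      then have "\<bar>t $ i\<bar> ^ (2 * M) \<le> (2 * pi * \<bar>t $ i\<bar>) ^ (2 * M)" by (intro power_mono) auto
      then have "\<bar>t $ i\<bar> ^ (2 * M) * norm (fourier f t) \<le> (2 * pi * \<bar>t $ i\<bar>) ^ (2 * M) * norm (fourier f t)"
        by (intro mult_right_mono) auto
      also have "\<dots> = norm (fourier (iter_deriv (replicate (2 * M) i) f) t)"
        unfolding fourier_iter_deriv[OF f] by (simp add: norm_mult norm_power)
      also have "\<dots> \<le> 2 * W * T" by (rule F) auto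
      finally show ?thesis .
    qed
    have "(1 + (norm t)\<^sup>2) ^ M \<le> 2 ^ M * (1 ^ M + ((norm t)\<^sup>2) ^ M)" by (rule power_add_le) auto
    also have "((norm t)\<^sup>2) ^ M = norm t ^ (2 * M)" by (simp add: power_mult)
    also have "2 ^ M * (1 ^ M + \<dots>) \<le> 2 ^ M * (1 + real ?n ^ (2 * M) * (\<Sum>i\<in>UNIV. \<bar>t $ i\<bar> ^ (2 * M)))"
      using norm_power_le_sum[of t "2 * M"] by (intro mult_left_mono) auto
    finally have "(1 + (norm t)\<^sup>2) ^ M * norm (fourier f t) \<le>
        2 ^ M * (1 + real ?n ^ (2 * M) * (\<Sum>i\<in>UNIV. \<bar>t $ i\<bar> ^ (2 * M))) * norm (fourier f t)"
      by (intro mult_right_mono) auto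
    also have "\<dots> = 2 ^ M * (norm (fourier f t) + real ?n ^ (2 * M) * (\<Sum>i\<in>UNIV. \<bar>t $ i\<bar> ^ (2 * M) * norm (fourier f t)))"
      by (simp add: algebra_simps sum_distrib_left sum_distrib_right)
    also have "\<dots> \<le> 2 ^ M * (2 * W * T + real ?n ^ (2 * M) * (\<Sum>i\<in>(UNIV::'n set). 2 * W * T))"
      by (intro mult_left_mono add_mono sum_mono F0 Fi) auto
    also have "\<dots> = C * T" by (simp add: C_def algebra_simps)
    finally show ?thesis by (simp add: T_def)
  qed
  have "0 \<le> C" using W by (simp add: C_def)
  then show ?thesis using that[of K C] finK main by blast
qed

lemma rapid_fourier: assumes f: "schwartz f" shows "rapid (fourier f :: real^'n::finite \<Rightarrow> complex)"
  unfolding rapid_def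
proof
  fix m
  obtain C :: real and K :: "(nat \<times> 'n list) set" where
    "\<And>f t. schwartz f \<Longrightarrow>
      (1 + (norm (t::real^'n))\<^sup>2) ^ m * norm (fourier f t) \<le> C * (\<Sum>(m, \<alpha>)\<in>K. schwartz_seminorm m \<alpha> f)"
    using fourier_decay[of m] by metis
  note CK = this[OF f]
  have "norm t ^ m * norm (fourier f t) \<le> C * (\<Sum>(m, \<alpha>)\<in>K. schwartz_seminorm m \<alpha> f)" for t :: "real^'n"
  proof -
    have "2 * norm t \<le> (norm t)\<^sup>2 + 1" using zero_le_power2[of "norm t - 1"] by (simp add: power2_diff)
    then have "norm t \<le> 1 + (norm t)\<^sup>2" using norm_ge_zero[of t] by linarith
    then have "norm t ^ m * norm (fourier f t) \<le> (1 + (norm t)\<^sup>2) ^ m * norm (fourier f t)"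
      by (intro mult_right_mono power_mono) auto
    then show ?thesis using CK[of t] by linarith
  qed
  then show "\<exists>K. \<forall>t. norm t ^ m * norm (fourier f t) \<le> K" by blast
qed

text \<open>Transforms of Schwartz functions form a class closed under partial derivatives, because
  differentiation on the frequency side multiplies the original function by a coordinate.\<close>

lemma schwartz_fourier: "schwartz f \<Longrightarrow> schwartz (fourier f)"
proof (rule schwartz_coinduct[where C = "fourier ` Collect schwartz"])
  show "g differentiable (at x)" if "g \<in> fourier ` Collect schwartz" for g :: "real^'n \<Rightarrow> complex" and x
    using that fourier_has_derivative unfolding differentiable_def by blast
  show "rapid g" if "g \<in> fourier ` Collect schwartz" for g :: "real^'n \<Rightarrow> complex"
    using that rapid_fourier by blast
  show "dir_deriv i g \<in> fourier ` Collect schwartz" if g: "g \<in> fourier ` Collect schwartz" for g :: "real^'n \<Rightarrow> complex" and i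
  proof -
    obtain f where f: "g = fourier f" "schwartz f" using g by blast
    show ?thesis unfolding f(1) dir_deriv_fourier[OF f(2)] by (intro imageI CollectI schwartz_mult_coord f)
  qed
qed auto

section \<open>The Gaussian and Fourier inversion\<close>

lemma schwartz_gauss: "schwartz gauss" by (rule schwartz_intros)

text \<open>Its value is 1, but only its being nonzero matters below, so the Gaussian integral is never
  evaluated.\<close>

definition gauss_mass :: "'n::finite itself \<Rightarrow> complex" where
  "gauss_mass _ = integral\<^sup>L lborel (gauss :: real^'n \<Rightarrow> complex)"

lemma gauss_mass_nonzero: "gauss_mass TYPE('n::finite) \<noteq> 0"
proof
  assume "gauss_mass TYPE('n) = 0"
  moreover have int: "integrable lborel (\<lambda>x::real^'n. exp (- (pi * (x \<bullet> x))))"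
  proof -
    have "integrable lborel (\<lambda>x::real^'n. Re (gauss x))"
      by (rule integrable_Re[OF integrable_schwartz[OF schwartz_gauss]])
    then show ?thesis by (simp add: gauss_def)
  qed
  ultimately have "(LINT x|lborel. exp (- (pi * ((x::real^'n) \<bullet> x)))) = 0"
    by (simp add: gauss_mass_def gauss_def[abs_def])
  then have "AE x in lborel. exp (- (pi * ((x::real^'n) \<bullet> x))) = 0"
    using integral_nonneg_eq_0_iff_AE[OF int] by simp
  then have "AE x::real^'n in lborel. False" by simp
  then show False using ae_filter_eq_bot_iff[of "lborel :: (real^'n) measure"]
    by (simp add: eventually_False)
qed

text \<open>Each partial derivative of the Gaussian is -2 pi x_i times the Gaussian. Transforming
  this equation gives the same first-order equation for the transform \<open>u\<close>, so u(t)
  exp(pi |t|^2) has derivative zero and is constant.\<close>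

lemma fourier_gauss: "fourier gauss t = gauss_mass TYPE('n::finite) * gauss (t::real^'n)"
proof -
  define u :: "real^'n \<Rightarrow> complex" where "u = fourier gauss"
  have c0: "u 0 = gauss_mass TYPE('n)" by (simp add: u_def fourier_eq gauss_mass_def)
  have coef: "fourier (\<lambda>x. (- (2 * pi) * \<i>) * (of_real (x $ i) * gauss x)) t = of_real (- (2 * pi) * t $ i) * u t"
    for i :: 'n and t :: "real^'n"
  proof -
    have "fourier (\<lambda>x. (- (2 * pi) * \<i>) * (of_real (x $ i) * gauss x)) t = fourier (\<lambda>x. \<i> * dir_deriv i gauss x) t"
      unfolding dir_deriv_gauss by (rule arg_cong[where f = "\<lambda>f. fourier f t"]) (auto simp: mult_ac)
    also have "\<dots> = \<i> * ((2 * pi * \<i> * of_real (t $ i)) * fourier gauss t)"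
      by (simp only: fourier_cmult fourier_dir_deriv[OF schwartz_gauss])
    also have "\<dots> = of_real (- (2 * pi) * t $ i) * u t"
      by (simp add: u_def algebra_simps)
    finally show ?thesis .
  qed
  have D: "(u has_derivative (\<lambda>h. of_real (- (2 * pi) * (t \<bullet> h)) * u t)) (at t)" for t
  proof -
    have "(u has_derivative (\<lambda>h. \<Sum>i\<in>UNIV. of_real (h $ i) *
      fourier (\<lambda>x. (- (2 * pi) * \<i>) * (of_real (x $ i) * gauss x)) t)) (at t)"
      unfolding u_def by (rule fourier_has_derivative[OF schwartz_gauss])
    moreover have "(\<Sum>i\<in>UNIV. of_real (h $ i) * fourier (\<lambda>x. (- (2 * pi) * \<i>) * (of_real (x $ i) * gauss x)) t) =
        of_real (- (2 * pi) * (t \<bullet> h)) * u t" for h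
      unfolding coef by (simp add: inner_vec_def sum_distrib_left sum_distrib_right mult_ac sum_negf)
    ultimately show ?thesis by simp
  qed
  have E: "((\<lambda>t. complex_of_real (exp (pi * (t \<bullet> t)))) has_derivative (\<lambda>h. of_real ((2 * pi) * (t \<bullet> h) * exp (pi * (t \<bullet> t))))) (at t)"
    for t :: "real^'n"
    by (rule has_derivative_of_real) (auto intro!: derivative_eq_intros simp: inner_commute algebra_simps)
  have "((\<lambda>t. u t * of_real (exp (pi * (t \<bullet> t)))) has_derivative (\<lambda>h. 0)) (at t)" for t
    using has_derivative_mult[OF D E, of t] by (simp add: algebra_simps)
  then have "\<exists>c. \<forall>t\<in>UNIV. u t * of_real (exp (pi * (t \<bullet> t))) = c"
    by (intro has_derivative_zero_constant) auto
  then obtain c where c: "\<And>t. u t * of_real (exp (pi * (t \<bullet> t))) = c" by auto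
  have "c = gauss_mass TYPE('n)" using c[of 0] c0 by simp
  then have "u t * of_real (exp (pi * (t \<bullet> t))) * gauss t = gauss_mass TYPE('n) * gauss t" using c by simp
  moreover have "of_real (exp (pi * (t \<bullet> t))) * gauss t = 1"
    by (simp add: gauss_def flip: of_real_mult exp_add)
  ultimately show ?thesis by (simp add: u_def mult.assoc)
qed

lemma fourier_multiplication:
  fixes f g :: "real^'n::finite \<Rightarrow> complex"
  assumes f: "integrable lborel f" and g: "integrable lborel g"
  shows "(LINT t|lborel. fourier f t * g t) = (LINT x|lborel. f x * fourier g x)"
proof -
  let ?k = "\<lambda>x t. f x * g t * ee x t"
  have fm: "f \<in> borel_measurable lborel" and gm: "g \<in> borel_measurable lborel" using f g by auto
  have meas: "case_prod ?k \<in> borel_measurable (lborel \<Otimes>\<^sub>M lborel)"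
    unfolding case_prod_beta
    by (intro borel_measurable_times ee_measurable_pair measurable_compose[OF measurable_fst fm]
        measurable_compose[OF measurable_snd gm])
  have int: "integrable (lborel \<Otimes>\<^sub>M lborel) (case_prod ?k)"
  proof (rule lborel_pair.Fubini_integrable[OF meas])
    show "integrable lborel (\<lambda>x. LINT y|lborel. norm (case (x, y) of (x, t) \<Rightarrow> ?k x t))"
      using f by (simp add: norm_mult)
    have "integrable lborel (\<lambda>y. ?k x y)" for x
    proof -
      have "integrable lborel (\<lambda>y. f x * (g y * ee y x))"
        by (intro integrable_mult_right integrable_mult_ee g)
      then show ?thesis by (simp add: ee_commute mult.assoc)
    qed
    then show "AE x in lborel. integrable lborel (\<lambda>y. case (x, y) of (x, t) \<Rightarrow> ?k x t)" by simp
  qed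
  have "(LINT t|lborel. fourier f t * g t) = (LINT t|lborel. LINT x|lborel. ?k x t)"
  proof (rule Bochner_Integration.integral_cong)
    fix t
    have "(LINT x|lborel. ?k x t) = (LINT x|lborel. (f x * ee x t) * g t)"
      by (rule Bochner_Integration.integral_cong) (auto simp: mult_ac)
    also have "\<dots> = fourier f t * g t" by (simp add: fourier_eq)
    finally show "fourier f t * g t = (LINT x|lborel. ?k x t)" ..
  qed simp
  also have "\<dots> = (LINT x|lborel. LINT t|lborel. ?k x t)" by (rule lborel_pair.Fubini_integral[OF int])
  also have "\<dots> = (LINT x|lborel. f x * fourier g x)"
  proof (rule Bochner_Integration.integral_cong)
    fix x
    have "(LINT t|lborel. ?k x t) = (LINT t|lborel. f x * (g t * ee t x))"
      by (rule Bochner_Integration.integral_cong) (auto simp: mult_ac ee_commute)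
    then show "(LINT t|lborel. ?k x t) = f x * fourier g x" by (simp add: fourier_eq)
  qed simp
  finally show ?thesis .
qed

lemma norm_gauss_le_1: "norm (gauss x) \<le> 1"
  by (simp add: gauss_def)

text \<open>A dilated Gaussian is inserted into the integral of the transform, the multiplication
  formula moves the Fourier transform onto the Gaussian, and dominated convergence removes the
  dilation. One factor \<open>gauss_mass\<close> comes from the transform of the Gaussian and one
  from its integral.\<close>

lemma fourier_inversion_0:
  fixes f :: "real^'n::finite \<Rightarrow> complex"
  assumes f: "schwartz f"
  shows "integral\<^sup>L lborel (fourier f) = (gauss_mass TYPE('n))\<^sup>2 * f 0"
proof -
  define h where "h k = inverse (real (Suc k))" for k
  have h: "h k \<noteq> 0" "h k > 0" for k by (auto simp: h_def)
  have h0: "h \<longlonglongrightarrow> 0" unfolding h_def[abs_def] by (rule inverse_Suc_limits)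
  have fm [measurable]: "f \<in> borel_measurable borel" using f schwartz_measurable by blast
  have Ff: "schwartz (fourier f)" by (rule schwartz_fourier[OF f])
  have Fm [measurable]: "fourier f \<in> borel_measurable borel" using Ff schwartz_measurable by blast
  have gm [measurable]: "gauss \<in> borel_measurable borel" using schwartz_gauss schwartz_measurable by blast
  have contf: "isCont f x" for x using schwartz_differentiable[OF f] differentiable_imp_continuous_within by blast
  have contg: "isCont gauss x" for x
    using schwartz_differentiable[OF schwartz_gauss] differentiable_imp_continuous_within by blast
  \<comment> \<open>The substitution inside the transform contributes the n-th power of
    \<open>h k\<close>, the outer substitution its inverse, and the two cancel.\<close>
  have scaled: "(LINT t|lborel. fourier f t * gauss (h k *\<^sub>R t)) =
      gauss_mass TYPE('n) * (LINT y|lborel. f (h k *\<^sub>R y) * gauss y)" for k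
  proof -
    let ?e = "h k"
    define fe where "fe y = f (?e *\<^sub>R y)" for y
    have fe: "integrable lborel fe"
      unfolding fe_def using integrable_affine[OF integrable_schwartz[OF f] h(1), of 0 k] by simp
    have F: "fourier f ((1 / ?e) *\<^sub>R \<tau>) = of_real (?e ^ CARD('n)) * fourier fe \<tau>" for \<tau>
    proof -
      have m: "(\<lambda>x. f x * ee x ((1 / ?e) *\<^sub>R \<tau>)) \<in> borel_measurable borel" by measurable
      have "fourier f ((1 / ?e) *\<^sub>R \<tau>) = (?e ^ CARD('n)) *\<^sub>R (LINT y|lborel. f (?e *\<^sub>R y) * ee (?e *\<^sub>R y) ((1 / ?e) *\<^sub>R \<tau>))"
        unfolding fourier_eq using integral_affine[OF m h(1), of k 0] h(2)[of k] by simp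
      also have "(LINT y|lborel. f (?e *\<^sub>R y) * ee (?e *\<^sub>R y) ((1 / ?e) *\<^sub>R \<tau>)) = fourier fe \<tau>"
        unfolding fourier_eq fe_def ee_scale using h(1)[of k] by simp
      finally show ?thesis by (simp add: scaleR_conv_of_real)
    qed
    have m2: "(\<lambda>t. fourier f t * gauss (?e *\<^sub>R t)) \<in> borel_measurable borel" by measurable
    have "1 / ?e \<noteq> 0" using h(1)[of k] by simp
    then have "(LINT t|lborel. fourier f t * gauss (?e *\<^sub>R t)) =
        ((1 / ?e) ^ CARD('n)) *\<^sub>R (LINT \<tau>|lborel. fourier f ((1 / ?e) *\<^sub>R \<tau>) * gauss (?e *\<^sub>R ((1 / ?e) *\<^sub>R \<tau>)))"
      using integral_affine[OF m2, of "1 / ?e" 0] h(2)[of k] by simp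
    also have "\<dots> = ((1 / ?e) ^ CARD('n)) *\<^sub>R (LINT \<tau>|lborel. of_real (?e ^ CARD('n)) * (fourier fe \<tau> * gauss \<tau>))"
      unfolding F using h(1)[of k] by (simp add: mult.assoc)
    also have "\<dots> = (LINT \<tau>|lborel. fourier fe \<tau> * gauss \<tau>)"
      using h(1)[of k] by (simp add: scaleR_conv_of_real power_divide)
    also have "\<dots> = (LINT y|lborel. fe y * fourier gauss y)"
      by (rule fourier_multiplication[OF fe integrable_schwartz[OF schwartz_gauss]])
    also have "\<dots> = (LINT y|lborel. gauss_mass TYPE('n) * (fe y * gauss y))"
      unfolding fourier_gauss by (simp add: mult_ac)
    finally show ?thesis by (simp add: fe_def)
  qed
  have lim1: "(\<lambda>k. LINT t|lborel. fourier f t * gauss (h k *\<^sub>R t)) \<longlonglongrightarrow> (LINT t|lborel. fourier f t)"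
  proof (rule integral_dominated_convergence[where w = "\<lambda>t::real^'n. norm (fourier f t)"])
    show "integrable lborel (\<lambda>t::real^'n. norm (fourier f t))" by (intro integrable_norm integrable_schwartz Ff)
    show "AE t in lborel. (\<lambda>k. fourier f t * gauss (h k *\<^sub>R t)) \<longlonglongrightarrow> fourier f t"
    proof (rule AE_I2)
      fix t :: "real^'n"
      have "(\<lambda>k. gauss (h k *\<^sub>R t)) \<longlonglongrightarrow> gauss (0 *\<^sub>R t)"
        by (intro isCont_tendsto_compose[OF contg] tendsto_intros h0)
      then have "(\<lambda>k. fourier f t * gauss (h k *\<^sub>R t)) \<longlonglongrightarrow> fourier f t * gauss (0 *\<^sub>R t)"
        by (intro tendsto_mult_left)
      then show "(\<lambda>k. fourier f t * gauss (h k *\<^sub>R t)) \<longlonglongrightarrow> fourier f t" by (simp add: gauss_def)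
    qed
    show "AE t in lborel. norm (fourier f t * gauss (h k *\<^sub>R t)) \<le> norm (fourier f t)" for k
      by (intro AE_I2) (simp add: norm_mult mult_left_le norm_gauss_le_1)
  qed measurable
  obtain K where K: "\<And>x. norm x ^ 0 * norm (f x) \<le> K" using schwartz_rapid[OF f] unfolding rapid_def by metis
  have lim2: "(\<lambda>k. LINT y|lborel. f (h k *\<^sub>R y) * gauss y) \<longlonglongrightarrow> (LINT y::real^'n|lborel. f 0 * gauss y)"
  proof (rule integral_dominated_convergence[where w = "\<lambda>y::real^'n. K * norm (gauss y)"])
    show "integrable lborel (\<lambda>y::real^'n. K * norm (gauss y))"
      by (intro integrable_mult_right integrable_norm integrable_schwartz schwartz_gauss)
    show "AE y in lborel. (\<lambda>k. f (h k *\<^sub>R y) * gauss y) \<longlonglongrightarrow> f 0 * gauss y"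
    proof (rule AE_I2)
      fix y
      have "(\<lambda>k. f (h k *\<^sub>R y)) \<longlonglongrightarrow> f (0 *\<^sub>R y)"
        by (intro isCont_tendsto_compose[OF contf] tendsto_intros h0)
      then show "(\<lambda>k. f (h k *\<^sub>R y) * gauss y) \<longlonglongrightarrow> f 0 * gauss y"
        by (intro tendsto_mult_right) simp
    qed
    show "AE y in lborel. norm (f (h k *\<^sub>R y) * gauss y) \<le> K * norm (gauss y)" for k
      using K by (intro AE_I2) (simp add: norm_mult mult_right_mono)
  qed measurable
  have "(\<lambda>k. LINT t|lborel. fourier f t * gauss (h k *\<^sub>R t)) \<longlonglongrightarrow> gauss_mass TYPE('n) * (LINT y::real^'n|lborel. f 0 * gauss y)"
    unfolding scaled by (intro tendsto_mult_left lim2)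
  from LIMSEQ_unique[OF lim1 this] show ?thesis
    by (simp add: gauss_mass_def power2_eq_square mult_ac)
qed

text \<open>The character \<open>ee t x\<close> in the outer integral is absorbed by translating
  \<open>f\<close>, which moves the point of evaluation to the origin.\<close>

lemma fourier_fourier:
  fixes f :: "real^'n::finite \<Rightarrow> complex"
  assumes f: "schwartz f"
  shows "fourier (fourier f) x = (gauss_mass TYPE('n))\<^sup>2 * f (- x)"
proof -
  have tr: "schwartz (\<lambda>y. f (y + (- x)))" by (intro schwartz_intros f)
  have [measurable]: "f \<in> borel_measurable borel" using f schwartz_measurable by blast
  have "fourier f t * ee t x = fourier (\<lambda>y. f (y + (- x))) t" for t
  proof -
    have "fourier (\<lambda>y. f (y + (- x))) t = (LINT y|lborel. (\<lambda>z. f z * ee (z + x) t) (y + (- x)))"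
      by (simp add: fourier_eq)
    also have "\<dots> = (LINT z|lborel. f z * ee (z + x) t)"
    proof (rule integral_translate)
      show "(\<lambda>z. f z * ee (z + x) t) \<in> borel_measurable borel" unfolding ee_add by measurable
    qed
    also have "\<dots> = (LINT z|lborel. (f z * ee z t) * ee x t)" by (simp add: ee_add mult_ac)
    also have "\<dots> = fourier f t * ee t x" by (simp add: fourier_eq ee_commute)
    finally show ?thesis ..
  qed
  then have "fourier (fourier f) x = integral\<^sup>L lborel (fourier (\<lambda>y. f (y + (- x))))"
    by (simp add: fourier_eq[of "fourier f"])
  also have "\<dots> = (gauss_mass TYPE('n))\<^sup>2 * f (- x)"
    using fourier_inversion_0[OF tr] by simp
  finally show ?thesis .
qed

lemma integral_reflect:
  fixes f :: "'a::euclidean_space \<Rightarrow> 'b::{banach, second_countable_topology}"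
  assumes "f \<in> borel_measurable borel"
  shows "(LINT x|lborel. f (- x)) = integral\<^sup>L lborel f"
  using integral_affine[OF assms, of "-1" 0] by simp

lemma fourier_reflect:
  assumes f: "schwartz f"
  shows "fourier (\<lambda>x. f (- x)) t = fourier f (- t)"
proof -
  have [measurable]: "f \<in> borel_measurable borel" using f schwartz_measurable by blast
  have "(\<lambda>x. f x * ee x (- t)) \<in> borel_measurable borel" by measurable
  from integral_reflect[OF this] show ?thesis
    by (simp add: fourier_eq ee_def)
qed

text \<open>The scalar is the inverse of the constant in \<open>fourier_fourier\<close>, so that
  both inversion identities hold whatever the value of \<open>gauss_mass\<close>.\<close>

definition inv_fourier :: "(real^'n::finite \<Rightarrow> complex) \<Rightarrow> real^'n \<Rightarrow> complex" where
  "inv_fourier f = (\<lambda>t. inverse ((gauss_mass TYPE('n))\<^sup>2) * fourier f (- t))"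

lemma schwartz_inv_fourier: "schwartz f \<Longrightarrow> schwartz (inv_fourier f)"
  unfolding inv_fourier_def by (intro schwartz_intros schwartz_fourier)

lemma inv_fourier_fourier: "schwartz f \<Longrightarrow> inv_fourier (fourier f) = f"
  by (rule ext) (simp add: inv_fourier_def fourier_fourier gauss_mass_nonzero)

lemma fourier_inv_fourier:
  fixes f :: "real^'n::finite \<Rightarrow> complex"
  assumes "schwartz f" shows "fourier (inv_fourier f) = f"
proof
  fix x
  have "fourier (inv_fourier f) x = inverse ((gauss_mass TYPE('n))\<^sup>2) * fourier (\<lambda>t. fourier f (- t)) x"
    unfolding inv_fourier_def by (rule fourier_cmult)
  also have "\<dots> = f x"
    using assms gauss_mass_nonzero[where 'n = 'n] by (simp add: fourier_reflect schwartz_fourier fourier_fourier)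
  finally show "fourier (inv_fourier f) x = f x" .
qed

text \<open>Products of differences of steep \<open>tanh\<close> steps, times a Gaussian, are Schwartz functions
  converging to box indicators times the Gaussian.\<close>

definition step :: "nat \<Rightarrow> real \<Rightarrow> real \<Rightarrow> real \<Rightarrow> real" where
  "step m a b x = (tanh (real m * (x - a)) - tanh (real m * (x - b))) / 2"

lemma schwartz_step: "schwartz (\<lambda>x. of_real (\<Prod>i\<in>M. step m (a $ i) (b $ i) (x $ i)) * f x)"
  if "finite M" "schwartz f" for a b :: "real^'n::finite"
  using that(1)
proof (induction M rule: finite_induct)
  case (insert i M)
  let ?g = "\<lambda>x. of_real (\<Prod>i\<in>M. step m (a $ i) (b $ i) (x $ i)) * f x"
  have "schwartz (\<lambda>x. (1/2) * (of_real (tanh (real m * (x $ i - a $ i))) * ?g x) +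
      (-1/2) * (of_real (tanh (real m * (x $ i - b $ i))) * ?g x))"
    by (intro schwartz_intros insert.IH)
  then show ?case
    by (rule back_subst[where P = schwartz]) (use insert.hyps in \<open>auto simp: step_def fun_eq_iff algebra_simps diff_divide_distrib\<close>)
qed (use that in simp)

lemma tanh_step_limit: "(\<lambda>m. tanh (real m * x)) \<longlonglongrightarrow> sgn (x::real)"
proof -
  have pos: "(\<lambda>m. tanh (real m * x)) \<longlonglongrightarrow> 1" if "x > 0" for x :: real
  proof -
    have "filterlim (\<lambda>m. x * real m) at_top sequentially"
      using that filterlim_real_sequentially by (intro filterlim_tendsto_pos_mult_at_top[OF tendsto_const])
    then show ?thesis using filterlim_compose[OF tanh_real_at_top] by (simp add: mult.commute)
  qed
  consider "x > 0" | "x = 0" | "x < 0" by linarith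
  then show ?thesis
  proof cases
    case 3
    have "(\<lambda>m. - tanh (real m * (- x))) \<longlonglongrightarrow> - 1" by (intro tendsto_minus pos) (use 3 in simp)
    then show ?thesis using 3 by simp
  qed (use pos in auto)
qed

lemma step_limit:
  assumes "a < b" "x \<noteq> a" "x \<noteq> b"
  shows "(\<lambda>m. step m a b x) \<longlonglongrightarrow> (if a < x \<and> x < b then 1 else 0)"
proof -
  have "(\<lambda>m. step m a b x) \<longlonglongrightarrow> (sgn (x - a) - sgn (x - b)) / 2"
    unfolding step_def by (intro tendsto_divide tendsto_diff tanh_step_limit tendsto_const) auto
  moreover have "(sgn (x - a) - sgn (x - b)) / 2 = (if a < x \<and> x < b then 1 else 0)"
    using assms by (auto simp: sgn_if)
  ultimately show ?thesis by simp
qed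

lemma abs_step_le: "\<bar>step m a b x\<bar> \<le> 1"
  using tanh_real_bounds[of "real m * (x - a)"] tanh_real_bounds[of "real m * (x - b)"]
  unfolding step_def by (auto simp: abs_if)

section \<open>Uniqueness of the function representing a distribution\<close>

lemma AE_coord_neq: "AE x in lborel. (x::real^'n::finite) $ i \<noteq> c"
proof -
  have "{x::real^'n. x $ i = c} = {x. axis i 1 \<bullet> x = c}" by (simp add: inner_axis')
  moreover have "negligible {x::real^'n. axis i 1 \<bullet> x = c}"
    by (rule negligible_hyperplane) (simp add: axis_eq_0_iff)
  ultimately have "emeasure lebesgue {x::real^'n. x $ i = c} = 0"
    by (simp add: negligible_iff_null_sets null_setsD1)
  moreover have s: "{x::real^'n. x $ i = c} \<in> sets borel" by measurable
  ultimately have "emeasure lborel {x::real^'n. x $ i = c} = 0" by simp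
  then have "{x::real^'n. x $ i = c} \<in> null_sets lborel" using s by auto
  then show ?thesis by (rule AE_I') auto
qed

text \<open>The approximating test functions converge off the faces of the box, which lie in null
  hyperplanes. The step products are bounded by 1, so \<open>h x * gauss x\<close> is a majorant; it
  is integrable because the Gaussian is itself a test function.\<close>

lemma integral_box_eq_0:
  fixes h :: "real^'n::finite \<Rightarrow> complex"
  assumes h: "\<And>f. schwartz f \<Longrightarrow> integrable lborel (\<lambda>x. h x * f x) \<and> (LINT x|lborel. h x * f x) = 0"
    and [measurable]: "h \<in> borel_measurable borel"
  shows "(LINT x|lborel. indicator (box a b) x * (h x * gauss x)) = 0"
proof (cases "\<forall>i. a $ i < b $ i")
  case False
  then obtain i where "b $ i \<le> a $ i" by (auto simp: not_less)
  then have "x \<notin> box a b" for x using less_trans[of "a $ i" "x $ i" "b $ i"] by (auto simp: mem_box_cart intro!: exI[of _ i])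
  then have "box a b = {}" by blast
  then show ?thesis by simp
next
  case True
  let ?T = "\<lambda>m x. \<Prod>i\<in>UNIV. step m (a $ i) (b $ i) (x $ i)"
  have [measurable]: "gauss \<in> borel_measurable borel" using schwartz_gauss schwartz_measurable by blast
  have [measurable]: "?T m \<in> borel_measurable borel" for m
    unfolding step_def tanh_altdef by measurable
  have 0: "(LINT x|lborel. of_real (?T m x) * (h x * gauss x)) = 0" for m
    using h[OF schwartz_step[OF finite[of UNIV] schwartz_gauss, of m a b]] by (simp add: mult_ac)
  have "(\<lambda>m. LINT x|lborel. of_real (?T m x) * (h x * gauss x)) \<longlonglongrightarrow>
      (LINT x|lborel. indicator (box a b) x * (h x * gauss x))"
  proof (rule integral_dominated_convergence[where w = "\<lambda>x. norm (h x * gauss x)"])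
    show "integrable lborel (\<lambda>x. norm (h x * gauss x))"
      using h[OF schwartz_gauss] by (intro integrable_norm) blast
    have "AE x in lborel. \<forall>i\<in>UNIV. x $ i \<noteq> a $ i \<and> x $ i \<noteq> b $ i"
      using AE_coord_neq by (subst AE_ball_countable) (auto intro: AE_conjI)
    then show "AE x in lborel. (\<lambda>m. of_real (?T m x) * (h x * gauss x)) \<longlonglongrightarrow> indicator (box a b) x * (h x * gauss x)"
    proof (rule AE_mp, intro AE_I2 impI)
      fix x assume x: "\<forall>i\<in>UNIV. x $ i \<noteq> a $ i \<and> x $ i \<noteq> b $ i"
      have "(\<lambda>m. ?T m x) \<longlonglongrightarrow> (\<Prod>i\<in>UNIV. if a $ i < x $ i \<and> x $ i < b $ i then 1 else 0)"
        using x True by (intro tendsto_prod step_limit) auto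
      also have "(\<Prod>i\<in>UNIV. if a $ i < x $ i \<and> x $ i < b $ i then 1 else 0) = (indicator (box a b) x :: real)"
        by (auto simp: indicator_def mem_box_cart)
      finally have "(\<lambda>m. complex_of_real (?T m x)) \<longlonglongrightarrow> of_real (indicator (box a b) x)"
        by (rule tendsto_of_real)
      then show "(\<lambda>m. of_real (?T m x) * (h x * gauss x)) \<longlonglongrightarrow> indicator (box a b) x * (h x * gauss x)"
        by (intro tendsto_mult_right) (simp add: of_real_indicator)
    qed
    show "AE x in lborel. norm (of_real (?T m x) * (h x * gauss x)) \<le> norm (h x * gauss x)" for m
    proof (rule AE_I2)
      fix x
      have "\<bar>?T m x\<bar> \<le> 1" unfolding abs_prod by (intro prod_le_1) (simp add: abs_step_le)
      then show "norm (of_real (?T m x) * (h x * gauss x)) \<le> norm (h x * gauss x)"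
        by (simp add: norm_mult[of "of_real _"] mult_left_le_one_le del: of_real_prod)
    qed
  qed measurable
  then show ?thesis unfolding 0 by (simp add: LIMSEQ_const_iff)
qed

text \<open>The positive and negative parts of \<open>g\<close> define two densities that agree on
  boxes, an intersection-stable generator of the Borel sets, hence everywhere. Densities are unique
  almost everywhere, and the two parts of a real number coincide only at 0.\<close>

lemma AE_zero_of_integral_box:
  fixes g :: "'a::euclidean_space \<Rightarrow> real"
  assumes g: "integrable lborel g" and box: "\<And>a b. (LINT x|lborel. indicator (box a b) x * g x) = 0"
  shows "AE x in lborel. g x = 0"
proof -
  have gm [measurable]: "g \<in> borel_measurable borel" using g by auto
  let ?p = "\<lambda>x. ennreal (g x)" and ?q = "\<lambda>x. ennreal (- g x)"
  have fin: "(\<integral>\<^sup>+x. ?p x \<partial>lborel) \<noteq> \<infinity>" "(\<integral>\<^sup>+x. ?q x \<partial>lborel) \<noteq> \<infinity>"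
    using g unfolding real_integrable_def by auto
  have "density lborel ?p = density lborel ?q"
  proof (rule measure_eqI_generator_eq)
    let ?E = "range (\<lambda>(a, b). box a b::'a set)"
    show "Int_stable ?E" by (auto simp: Int_stable_def box_Int_box)
    show "?E \<subseteq> Pow UNIV" "sets (density lborel ?p) = sigma_sets UNIV ?E" "sets (density lborel ?q) = sigma_sets UNIV ?E"
      by (simp_all add: borel_eq_box)
    let ?A = "\<lambda>n::nat. box (- (real n *\<^sub>R One)) (real n *\<^sub>R One) :: 'a set"
    show "range ?A \<subseteq> ?E" "(\<Union>i. ?A i) = UNIV" unfolding UN_box_eq_UNIV by auto
    show "emeasure (density lborel ?p) (?A i) \<noteq> \<infinity>" for i
    proof -
      have "emeasure (density lborel ?p) (?A i) \<le> (\<integral>\<^sup>+x. ?p x \<partial>lborel)"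
        by (subst emeasure_density) (auto intro!: nn_integral_mono split: split_indicator)
      then show ?thesis using fin by (auto simp: top_unique)
    qed
    fix X :: "'a set" assume "X \<in> ?E"
    then obtain a b where X: "X = box a b" by auto
    let ?f = "\<lambda>x. indicator X x * g x"
    have int: "integrable lborel ?f" unfolding X by (rule integrable_mult_indicator[where 'b = real, simplified, OF _ g]) simp
    have "(LINT x|lborel. ?f x) = enn2real (\<integral>\<^sup>+x. ennreal (?f x) \<partial>lborel) - enn2real (\<integral>\<^sup>+x. ennreal (- ?f x) \<partial>lborel)"
      by (rule real_lebesgue_integral_def[OF int])
    then have eq: "enn2real (\<integral>\<^sup>+x. ennreal (?f x) \<partial>lborel) = enn2real (\<integral>\<^sup>+x. ennreal (- ?f x) \<partial>lborel)"
      using box[of a b] X by simp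
    have "(\<integral>\<^sup>+x. ennreal (?f x) \<partial>lborel) = (\<integral>\<^sup>+x. ennreal (- ?f x) \<partial>lborel)"
    proof -
      have "(\<integral>\<^sup>+x. ennreal (?f x) \<partial>lborel) < top" "(\<integral>\<^sup>+x. ennreal (- ?f x) \<partial>lborel) < top"
        using int unfolding real_integrable_def by (auto simp: less_top)
      note f = this[THEN ennreal_enn2real]
      show ?thesis using f(1)[unfolded eq] f(2) by (rule trans[OF sym])
    qed
    moreover have "(\<integral>\<^sup>+x. ennreal (?f x) \<partial>lborel) = (\<integral>\<^sup>+x. ?p x * indicator X x \<partial>lborel)"
      "(\<integral>\<^sup>+x. ennreal (- ?f x) \<partial>lborel) = (\<integral>\<^sup>+x. ?q x * indicator X x \<partial>lborel)"
      by (auto intro!: nn_integral_cong split: split_indicator)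
    ultimately show "emeasure (density lborel ?p) X = emeasure (density lborel ?q) X"
      unfolding X by (simp add: emeasure_density)
  qed
  then have "AE x in lborel. ?p x = ?q x" by (intro sigma_finite_measure.density_unique[OF sigma_finite_lborel]) auto
  then show ?thesis
  proof eventually_elim
    fix x assume "?p x = ?q x"
    then show "g x = 0" by (cases "g x \<ge> 0") (auto simp: ennreal_neg ennreal_eq_0_iff)
  qed
qed

text \<open>This makes \<open>fhat\<close> well defined up to null sets. Real and imaginary parts of
  the difference times the Gaussian vanish by integration over boxes, and the Gaussian has no
  zeros.\<close>

lemma represented_by_unique:
  fixes h1 h2 :: "real^'n::finite \<Rightarrow> complex"
  assumes "represented_by u h1" "represented_by u h2"
  shows "AE x in lborel. h1 x = h2 x"
proof -
  have [measurable]: "h1 \<in> borel_measurable borel" "h2 \<in> borel_measurable borel"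
    using assms unfolding represented_by_def by auto
  define h where "h x = h1 x - h2 x" for x
  have [measurable]: "h \<in> borel_measurable borel" unfolding h_def by measurable
  have h: "integrable lborel (\<lambda>x. h x * f x) \<and> (LINT x|lborel. h x * f x) = 0" if f: "schwartz f" for f
    using assms f unfolding represented_by_def h_def by (simp add: left_diff_distrib)
  have int: "integrable lborel (\<lambda>x. h x * gauss x)" using h[OF schwartz_gauss] by blast
  have intb: "integrable lborel (\<lambda>x. indicator (box a b) x * (h x * gauss x))" for a b
    using integrable_mult_indicator[OF _ int, of "box a b"] by (simp add: indicator_scaleR_eq_if mult.commute of_real_indicator scaleR_conv_of_real)
  note box0 = integral_box_eq_0[OF h, simplified]
  have "AE x in lborel. Re (h x * gauss x) = 0"
  proof (rule AE_zero_of_integral_box)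
    show "integrable lborel (\<lambda>x. Re (h x * gauss x))" by (rule integrable_Re[OF int])
    fix a b :: "real^'n"
    have "(LINT x|lborel. indicator (box a b) x * Re (h x * gauss x)) = Re (LINT x|lborel. indicator (box a b) x * (h x * gauss x))"
      by (subst integral_Re[OF intb, symmetric]) (auto intro!: Bochner_Integration.integral_cong split: split_indicator)
    then show "(LINT x|lborel. indicator (box a b) x * Re (h x * gauss x)) = 0" using integral_box_eq_0[of h a b] h by simp
  qed
  moreover have "AE x in lborel. Im (h x * gauss x) = 0"
  proof (rule AE_zero_of_integral_box)
    show "integrable lborel (\<lambda>x. Im (h x * gauss x))" by (rule integrable_Im[OF int])
    fix a b :: "real^'n"
    have "(LINT x|lborel. indicator (box a b) x * Im (h x * gauss x)) = Im (LINT x|lborel. indicator (box a b) x * (h x * gauss x))"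
      by (subst integral_Im[OF intb, symmetric]) (auto intro!: Bochner_Integration.integral_cong split: split_indicator)
    then show "(LINT x|lborel. indicator (box a b) x * Im (h x * gauss x)) = 0" using integral_box_eq_0[of h a b] h by simp
  qed
  ultimately show ?thesis
  proof eventually_elim
    fix x assume "Re (h x * gauss x) = 0" "Im (h x * gauss x) = 0"
    then have "h x * gauss x = 0" by (simp add: complex_eq_iff)
    then show "h1 x = h2 x" by (simp add: gauss_def h_def)
  qed
qed

section \<open>Sobolev spaces as weighted spaces of square-integrable functions\<close>

lemma mu_pos: "0 < mu s x"
  unfolding mu_def by (simp add: add_pos_nonneg add_nonneg_eq_0_iff)

lemma mu_nonzero [simp]: "mu s x \<noteq> 0" using mu_pos[of s x] by simp

lemma mu_measurable [measurable]: "mu s \<in> borel_measurable borel"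
  unfolding mu_def by measurable

text \<open>These are the functions that occur as Fourier transforms of elements of
  \<open>sobolev s\<close>; see \<open>dist_of_sobolev\<close> for one direction and
  \<open>sobolev_fhat\<close> for the other.\<close>

definition good :: "real \<Rightarrow> (real^'n::finite \<Rightarrow> complex) \<Rightarrow> bool" where
  "good s h \<longleftrightarrow> h \<in> borel_measurable borel \<and> integrable lborel (\<lambda>t. (norm (h t * of_real (mu s t)))\<^sup>2)"

lemma good_measurable: "good s h \<Longrightarrow> h \<in> borel_measurable borel"
  by (simp add: good_def)

text \<open>The order of decay that makes \<open>h\<close> integrable against \<open>(1 + |t|\<^sup>2)\<^sup>-\<^sup>M\<close> whenever \<open>h * mu s\<close> is
  square-integrable.\<close>

definition slow :: "real \<Rightarrow> 'n::finite itself \<Rightarrow> nat" where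
  "slow s _ = CARD('n) + nat \<lceil>\<bar>s\<bar>\<rceil>"

text \<open>The integrand is the product of |h| mu, which is square-integrable, and V/mu, where V is
  the inverse power. A product is at most the sum of the squares, and the exponent
  \<open>slow\<close> is large enough, for either sign of \<open>s\<close>, to give (V/mu)^2 <=
  \<open>weight\<close>.\<close>

lemma good_integrable_slow:
  fixes h :: "real^'n::finite \<Rightarrow> complex"
  assumes h: "good s h"
  shows "integrable lborel (\<lambda>t. norm (h t) * inverse ((1 + (norm t)\<^sup>2) ^ slow s TYPE('n)))"
proof -
  have [measurable]: "h \<in> borel_measurable borel" using h by (rule good_measurable)
  let ?V = "\<lambda>t::real^'n. inverse ((1 + (norm t)\<^sup>2) ^ slow s TYPE('n))"
  have "integrable lborel (\<lambda>t. (norm (h t * of_real (mu s t)))\<^sup>2 + weight t)"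
    using h integrable_weight unfolding good_def by (intro Bochner_Integration.integrable_add) auto
  then show ?thesis
  proof (rule Bochner_Integration.integrable_bound)
    show "AE t in lborel. norm (norm (h t) * ?V t) \<le> norm ((norm (h t * of_real (mu s t)))\<^sup>2 + weight t)"
    proof (rule AE_I2)
      fix t :: "real^'n"
      define r where "r = 1 + (norm t)\<^sup>2"
      have r: "r \<ge> 1" "r > 0" by (auto simp: r_def add_pos_nonneg)
      have m: "mu s t = r powr (s / 2)" by (simp add: mu_def r_def)
      have V: "?V t = r powr (- real (slow s TYPE('n)))"
        using r by (simp add: r_def powr_minus powr_realpow)
      have "(?V t / mu s t)\<^sup>2 = r powr (2 * (- real (slow s TYPE('n)) - s / 2))"
        unfolding V m by (simp add: powr_diff[symmetric] power2_eq_square powr_add[symmetric])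
      also have "\<dots> \<le> r powr (- real CARD('n))"
      proof (rule powr_mono)
        have "\<bar>s\<bar> \<le> real (nat \<lceil>\<bar>s\<bar>\<rceil>)" by (rule real_nat_ceiling_ge)
        then have "- s \<le> real (nat \<lceil>\<bar>s\<bar>\<rceil>)" using abs_ge_minus_self[of s] by linarith
        then show "2 * (- real (slow s TYPE('n)) - s / 2) \<le> - real CARD('n)"
          using of_nat_0_le_iff[of "nat \<lceil>\<bar>s\<bar>\<rceil>", where 'a = real] of_nat_0_le_iff[of "CARD('n)", where 'a = real]
          unfolding slow_def of_nat_add by argo
      qed (rule r)
      also have "\<dots> = weight t" using r by (simp add: weight_def r_def powr_minus powr_realpow)
      finally have w: "(?V t / mu s t)\<^sup>2 \<le> weight t" .
      let ?a = "norm (h t * of_real (mu s t))" and ?b = "?V t / mu s t"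
      have "norm (h t) * ?V t = ?a * ?b" using mu_pos[of s t] by (simp add: norm_mult)
      also have "\<dots> \<le> ?a\<^sup>2 + ?b\<^sup>2"
        using zero_le_power2[of "?a - ?b"] zero_le_power2[of ?a] zero_le_power2[of ?b]
        unfolding power2_diff by linarith
      finally have "norm (h t) * ?V t \<le> ?a\<^sup>2 + weight t" using w by linarith
      moreover have "0 \<le> norm (h t) * ?V t" by simp
      ultimately show "norm (norm (h t) * ?V t) \<le> norm (?a\<^sup>2 + weight t)" by simp
    qed
  qed measurable
qed

lemma good_integrable_schwartz:
  fixes h :: "real^'n::finite \<Rightarrow> complex"
  assumes h: "good s h" and f: "schwartz f"
  shows "integrable lborel (\<lambda>x. h x * f x)"
proof -
  have [measurable]: "h \<in> borel_measurable borel" "f \<in> borel_measurable borel"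
    using h f schwartz_measurable by (auto simp: good_def)
  obtain K where K: "0 \<le> K" "\<And>x. norm (f x) \<le> K * inverse ((1 + (norm x)\<^sup>2) ^ slow s TYPE('n))"
    using rapid_le_inverse_power[OF schwartz_rapid[OF f]] by metis
  have "integrable lborel (\<lambda>t. K * (norm (h t) * inverse ((1 + (norm t)\<^sup>2) ^ slow s TYPE('n))))"
    by (intro integrable_mult_right good_integrable_slow h)
  then show ?thesis
  proof (rule Bochner_Integration.integrable_bound)
    show "AE x in lborel. norm (h x * f x) \<le> norm (K * (norm (h x) * inverse ((1 + (norm x)\<^sup>2) ^ slow s TYPE('n))))"
    proof (rule AE_I2)
      fix x
      have "norm (h x * f x) \<le> norm (h x) * (K * inverse ((1 + (norm x)\<^sup>2) ^ slow s TYPE('n)))"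
        unfolding norm_mult by (intro mult_left_mono K) auto
      then show "norm (h x * f x) \<le> norm (K * (norm (h x) * inverse ((1 + (norm x)\<^sup>2) ^ slow s TYPE('n))))"
        using K(1) by (simp add: mult_ac)
    qed
  qed measurable
qed

text \<open>The inverse Fourier transform of \<open>h\<close> as a distribution, obtained by moving
  the transform to the test function.\<close>

definition dist_of :: "(real^'n::finite \<Rightarrow> complex) \<Rightarrow> 'n distribution" where
  "dist_of h = (\<lambda>f. if schwartz f then (LINT t|lborel. h t * inv_fourier f t) else 0)"

lemma fourier_dist_dist_of:
  "schwartz f \<Longrightarrow> fourier_dist (dist_of h) f = (LINT t|lborel. h t * f t)"
  by (simp add: fourier_dist_def dist_of_def schwartz_fourier inv_fourier_fourier)

lemma represented_by_dist_of: "good s h \<Longrightarrow> represented_by (fourier_dist (dist_of h)) h"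
  unfolding represented_by_def
  by (simp add: fourier_dist_dist_of good_integrable_schwartz good_measurable)

lemma inv_fourier_add:
  assumes "schwartz f" "schwartz g"
  shows "inv_fourier (\<lambda>x. f x + g x) t = inv_fourier f t + inv_fourier g t"
  using assms by (simp add: inv_fourier_def fourier_add integrable_schwartz distrib_left)

lemma inv_fourier_cmult: "inv_fourier (\<lambda>x. c * f x) t = c * inv_fourier f t"
  by (simp add: inv_fourier_def fourier_cmult)

lemma tempered_dist_of:
  fixes h :: "real^'n::finite \<Rightarrow> complex"
  assumes h: "good s h"
  shows "dist_of h \<in> tempered"
proof -
  let ?M = "slow s TYPE('n)"
  obtain C :: real and K :: "(nat \<times> 'n list) set" where K: "finite K" "0 \<le> C"
    and dec: "\<And>f t. schwartz f \<Longrightarrow>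
      (1 + (norm (t::real^'n))\<^sup>2) ^ ?M * norm (fourier f t) \<le> C * (\<Sum>(m, \<alpha>)\<in>K. schwartz_seminorm m \<alpha> f)"
    using fourier_decay[of ?M] by metis
  let ?g = "norm (inverse ((gauss_mass TYPE('n))\<^sup>2))"
  define D where "D = (LINT t|lborel. norm (h t) * inverse ((1 + (norm t)\<^sup>2) ^ ?M))"
  have bound: "norm (dist_of h f) \<le> (?g * C * D) * (\<Sum>(m, \<alpha>)\<in>K. schwartz_seminorm m \<alpha> f)"
    if f: "schwartz f" for f
  proof -
    define T where "T = (\<Sum>(m, \<alpha>)\<in>K. schwartz_seminorm m \<alpha> f)"
    have T: "0 \<le> T" unfolding T_def by (intro sum_nonneg) (auto simp: seminorm_nonneg f)
    have pt: "norm (h t * inv_fourier f t) \<le> (?g * C * T) * (norm (h t) * inverse ((1 + (norm t)\<^sup>2) ^ ?M))" for t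
    proof -
      have "0 < (1 + (norm t)\<^sup>2) ^ ?M" by (simp add: add_pos_nonneg)
      then have "norm (fourier f (- t)) \<le> C * T * inverse ((1 + (norm t)\<^sup>2) ^ ?M)"
        using dec[OF f, of "- t"] by (simp add: T_def field_simps)
      then have "norm (h t) * (?g * norm (fourier f (- t))) \<le> norm (h t) * (?g * (C * T * inverse ((1 + (norm t)\<^sup>2) ^ ?M)))"
        by (intro mult_left_mono) auto
      then show ?thesis unfolding inv_fourier_def norm_mult by (simp only: mult_ac)
    qed
    have "norm (dist_of h f) \<le> (LINT t|lborel. norm (h t * inv_fourier f t))"
      using f by (simp add: dist_of_def)
    also have "\<dots> \<le> (LINT t|lborel. (?g * C * T) * (norm (h t) * inverse ((1 + (norm t)\<^sup>2) ^ ?M)))"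
      by (intro integral_mono integrable_norm good_integrable_schwartz[OF h] schwartz_inv_fourier f
          integrable_mult_right good_integrable_slow[OF h] pt)
    also have "\<dots> = (?g * C * T) * D" unfolding D_def by (rule integral_mult_right_zero)
    finally show ?thesis by (simp add: T_def mult_ac)
  qed
  show ?thesis
    unfolding tempered_def
  proof (intro CollectI conjI)
    show "\<forall>f. \<not> schwartz f \<longrightarrow> dist_of h f = 0" by (simp add: dist_of_def)
    show "\<forall>f g. schwartz f \<longrightarrow> schwartz g \<longrightarrow> dist_of h (\<lambda>x. f x + g x) = dist_of h f + dist_of h g"
      by (auto simp: dist_of_def schwartz_intros inv_fourier_add distrib_left
          good_integrable_schwartz[OF h] schwartz_inv_fourier)
    show "\<forall>c f. schwartz f \<longrightarrow> dist_of h (\<lambda>x. c * f x) = c * dist_of h f"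
      by (auto simp: dist_of_def schwartz_intros inv_fourier_cmult mult.left_commute)
    show "\<exists>K C. finite K \<and> (\<forall>f. schwartz f \<longrightarrow> norm (dist_of h f) \<le> C * (\<Sum>(m, \<alpha>)\<in>K. schwartz_seminorm m \<alpha> f))"
      using K bound by blast
  qed
qed

lemma dist_of_sobolev: "good s h \<Longrightarrow> dist_of h \<in> sobolev s"
  unfolding sobolev_def using tempered_dist_of represented_by_dist_of good_def by blast

text \<open>By inversion every test function is the Fourier transform of a test function, so the
  transform determines the distribution on all of them; outside the Schwartz functions both sides
  are 0.\<close>

lemma represented_by_imp_dist_of:
  assumes "\<And>f. \<not> schwartz f \<Longrightarrow> u f = 0" and "represented_by (fourier_dist u) h"
  shows "u = dist_of h"
proof
  fix f
  show "u f = dist_of h f"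
  proof (cases "schwartz f")
    case True
    then have "u f = fourier_dist u (inv_fourier f)"
      by (simp add: fourier_dist_def schwartz_inv_fourier fourier_inv_fourier)
    also have "\<dots> = dist_of h f"
      using assms(2) True schwartz_inv_fourier unfolding represented_by_def dist_of_def by auto
    finally show ?thesis .
  qed (use assms(1) in \<open>auto simp: dist_of_def\<close>)
qed

lemma fhat_represents: "represented_by (fourier_dist u) h \<Longrightarrow> represented_by (fourier_dist u) (fhat u)"
  unfolding fhat_def by (rule someI[where P = "\<lambda>h. represented_by (fourier_dist u) h"])

text \<open>The function witnessing membership in \<open>sobolev s\<close> may differ from the one
  picked by \<open>fhat\<close>. Uniqueness almost everywhere transfers the weighted
  integrability.\<close>

lemma sobolev_fhat:
  assumes "u \<in> sobolev s"
  shows "represented_by (fourier_dist u) (fhat u)" "good s (fhat u)"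
proof -
  obtain h where h: "represented_by (fourier_dist u) h" "integrable lborel (\<lambda>t. (norm (h t * of_real (mu s t)))\<^sup>2)"
    using assms unfolding sobolev_def by blast
  show rep: "represented_by (fourier_dist u) (fhat u)" by (rule fhat_represents[OF h(1)])
  have m [measurable]: "fhat u \<in> borel_measurable borel" "h \<in> borel_measurable borel"
    using rep h(1) unfolding represented_by_def by auto
  have "AE t in lborel. h t = fhat u t" by (rule represented_by_unique[OF h(1) rep])
  then have "AE t in lborel. (norm (h t * of_real (mu s t)))\<^sup>2 = (norm (fhat u t * of_real (mu s t)))\<^sup>2"
    by eventually_elim simp
  then have "integrable lborel (\<lambda>t. (norm (h t * of_real (mu s t)))\<^sup>2) \<longleftrightarrow>
      integrable lborel (\<lambda>t. (norm (fhat u t * of_real (mu s t)))\<^sup>2)"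
    by (intro integrable_cong_AE) measurable
  then show "good s (fhat u)" using h(2) m by (simp add: good_def)
qed

lemma sobolev_eq_0: "u \<in> sobolev s \<Longrightarrow> \<not> schwartz f \<Longrightarrow> u f = 0"
  unfolding sobolev_def tempered_def by blast

text \<open>The working criterion for sums, multiples and translates: computing the transform on
  test functions yields both membership and \<open>fhat\<close> up to a null set.\<close>

lemma sobolevI:
  assumes "\<And>f. \<not> schwartz f \<Longrightarrow> u f = 0" and "good s h"
    and "\<And>f. schwartz f \<Longrightarrow> fourier_dist u f = (LINT t|lborel. h t * f t)"
  shows "u \<in> sobolev s" "AE t in lborel. fhat u t = h t"
proof -
  have rep: "represented_by (fourier_dist u) h"
    unfolding represented_by_def using assms good_integrable_schwartz good_measurable by auto
  have "u = dist_of h" using assms(1) rep by (rule represented_by_imp_dist_of)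
  then show "u \<in> sobolev s" using dist_of_sobolev[OF assms(2)] by simp
  show "AE t in lborel. fhat u t = h t" by (rule represented_by_unique[OF fhat_represents[OF rep] rep])
qed

lemma fhat_dist_of: "good s h \<Longrightarrow> AE t in lborel. fhat (dist_of h) t = h t"
  by (rule represented_by_unique[OF fhat_represents]) (auto intro: represented_by_dist_of)

lemma sobolev_eqI:
  assumes u: "u \<in> sobolev s" and v: "v \<in> sobolev s" and eq: "AE t in lborel. fhat u t = fhat v t"
  shows "u = v"
proof -
  have "u = dist_of (fhat u)"
    using sobolev_eq_0[OF u] sobolev_fhat(1)[OF u] by (rule represented_by_imp_dist_of)
  also have "\<dots> = dist_of (fhat v)"
  proof
    fix f
    have [measurable]: "fhat u \<in> borel_measurable borel" "fhat v \<in> borel_measurable borel"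
      using sobolev_fhat(2)[OF u] sobolev_fhat(2)[OF v] by (auto simp: good_def)
    show "dist_of (fhat u) f = dist_of (fhat v) f"
    proof (cases "schwartz f")
      case True
      have [measurable]: "inv_fourier f \<in> borel_measurable borel"
        by (rule schwartz_measurable[OF schwartz_inv_fourier[OF True]])
      have "(LINT t|lborel. fhat u t * inv_fourier f t) = (LINT t|lborel. fhat v t * inv_fourier f t)"
        by (rule integral_cong_AE) (measurable, use eq in eventually_elim, simp)
      then show ?thesis by (simp add: dist_of_def)
    qed (simp add: dist_of_def)
  qed
  also have "\<dots> = v"
    using sobolev_eq_0[OF v] sobolev_fhat(1)[OF v] by (rule represented_by_imp_dist_of[symmetric])
  finally show ?thesis .
qed

lemma good_add: assumes "good s g" "good s h" shows "good s (\<lambda>t. g t + h t)"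
proof -
  have [measurable]: "g \<in> borel_measurable borel" "h \<in> borel_measurable borel"
    using assms by (auto simp: good_def)
  have "L2 lborel (\<lambda>t. g t * of_real (mu s t) + h t * of_real (mu s t))"
    using assms by (intro L2_add) (simp_all add: good_def L2_def)
  then show ?thesis by (simp add: good_def L2_def distrib_right)
qed

lemma good_bounded_mult:
  assumes "good s h" and [measurable]: "g \<in> borel_measurable borel" and b: "\<And>t. norm (g t) \<le> b"
  shows "good s (\<lambda>t. g t * h t)"
proof -
  have [measurable]: "h \<in> borel_measurable borel" using assms by (auto simp: good_def)
  have "integrable lborel (\<lambda>t. b\<^sup>2 * (norm (h t * of_real (mu s t)))\<^sup>2)"
    using assms unfolding good_def by (intro integrable_mult_right) auto
  then have "integrable lborel (\<lambda>t. (norm (g t * h t * of_real (mu s t)))\<^sup>2)"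
  proof (rule Bochner_Integration.integrable_bound)
    show "AE t in lborel. norm ((norm (g t * h t * of_real (mu s t)))\<^sup>2) \<le> norm (b\<^sup>2 * (norm (h t * of_real (mu s t)))\<^sup>2)"
    proof (rule AE_I2)
      fix t
      have "(norm (g t))\<^sup>2 * (norm (h t * of_real (mu s t)))\<^sup>2 \<le> b\<^sup>2 * (norm (h t * of_real (mu s t)))\<^sup>2"
        by (intro mult_right_mono power_mono b) auto
      then show "norm ((norm (g t * h t * of_real (mu s t)))\<^sup>2) \<le> norm (b\<^sup>2 * (norm (h t * of_real (mu s t)))\<^sup>2)"
        by (simp add: norm_mult power_mult_distrib mult_ac)
    qed
  qed measurable
  then show ?thesis using assms by (simp add: good_def)
qed

lemma fourier_dist_fhat: "u \<in> sobolev s \<Longrightarrow> schwartz f \<Longrightarrow> fourier_dist u f = (LINT t|lborel. fhat u t * f t)"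
  using sobolev_fhat(1) unfolding represented_by_def by blast

lemma sobolev_add:
  assumes u: "u \<in> sobolev s" and v: "v \<in> sobolev s"
  shows "(\<lambda>f. u f + v f) \<in> sobolev s" "AE t in lborel. fhat (\<lambda>f. u f + v f) t = fhat u t + fhat v t"
proof -
  have *: "fourier_dist (\<lambda>f. u f + v f) f = (LINT t|lborel. (fhat u t + fhat v t) * f t)" if "schwartz f" for f
  proof -
    have "fourier_dist (\<lambda>f. u f + v f) f = fourier_dist u f + fourier_dist v f"
      by (simp add: fourier_dist_def)
    also have "\<dots> = (LINT t|lborel. (fhat u t + fhat v t) * f t)"
      using that u v
      by (simp add: fourier_dist_fhat distrib_right good_integrable_schwartz[OF sobolev_fhat(2)])
    finally show ?thesis .
  qed
  have 0: "u f + v f = 0" if "\<not> schwartz f" for f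
    using sobolev_eq_0[OF u that] sobolev_eq_0[OF v that] by simp
  show "(\<lambda>f. u f + v f) \<in> sobolev s" "AE t in lborel. fhat (\<lambda>f. u f + v f) t = fhat u t + fhat v t"
    using sobolevI[OF 0 good_add[OF sobolev_fhat(2)[OF u] sobolev_fhat(2)[OF v]] *] by auto
qed

lemma sobolev_scale:
  assumes u: "u \<in> sobolev s"
  shows "(\<lambda>f. c * u f) \<in> sobolev s" "AE t in lborel. fhat (\<lambda>f. c * u f) t = c * fhat u t"
proof -
  have *: "fourier_dist (\<lambda>f. c * u f) f = (LINT t|lborel. (c * fhat u t) * f t)" if "schwartz f" for f
  proof -
    have "fourier_dist (\<lambda>f. c * u f) f = c * fourier_dist u f"
      by (simp add: fourier_dist_def)
    then show ?thesis using that u by (simp add: fourier_dist_fhat mult.assoc)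
  qed
  have 0: "c * u f = 0" if "\<not> schwartz f" for f using sobolev_eq_0[OF u that] by simp
  have good: "good s (\<lambda>t. c * fhat u t)"
    by (rule good_bounded_mult[OF sobolev_fhat(2)[OF u], where b = "norm c"]) auto
  show "(\<lambda>f. c * u f) \<in> sobolev s" "AE t in lborel. fhat (\<lambda>f. c * u f) t = c * fhat u t"
    using sobolevI[OF 0 good *] by auto
qed

lemma sobolev_translate:
  fixes u :: "'n::finite distribution"
  assumes u: "u \<in> sobolev s"
  shows "translate k u \<in> sobolev s" "AE t in lborel. fhat (translate k u) t = ee t (ivec k) * fhat u t"
proof -
  have *: "fourier_dist (translate k u) f = (LINT t|lborel. (ee t (ivec k) * fhat u t) * f t)" if f: "schwartz f" for f
  proof -
    \<comment> \<open>A translation of the distribution shows up as a modulation of the test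
      function inside the transform. The character is built from \<open>cis\<close>, so this is an
      instance of the \<open>modulate\<close> rule with -2 pi \<open>ivec k\<close>.\<close>
    have mod: "schwartz (\<lambda>x. ee x (ivec k) * f x)" unfolding ee_def by (intro schwartz_intros f)
    have "ee y (x + ivec k) = ee y x * ee y (ivec k)" for x y :: "real^'n"
      using ee_add[of x "ivec k" y] by (simp only: ee_commute[of y])
    then have "(\<lambda>x. fourier f (x + ivec k)) = fourier (\<lambda>x. ee x (ivec k) * f x)"
      unfolding fourier_eq by (simp add: mult_ac)
    then have "fourier_dist (translate k u) f = fourier_dist u (\<lambda>x. ee x (ivec k) * f x)"
      using f mod by (simp add: fourier_dist_def translate_def schwartz_fourier)
    also have "\<dots> = (LINT t|lborel. fhat u t * (ee t (ivec k) * f t))" by (rule fourier_dist_fhat[OF u mod])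
    finally show ?thesis by (simp add: mult_ac)
  qed
  have 0: "translate k u f = 0" if "\<not> schwartz f" for f using that by (simp add: translate_def)
  have good: "good s (\<lambda>t. ee t (ivec k) * fhat u t)"
    by (rule good_bounded_mult[OF sobolev_fhat(2)[OF u], where b = 1]) auto
  show "translate k u \<in> sobolev s" "AE t in lborel. fhat (translate k u) t = ee t (ivec k) * fhat u t"
    using sobolevI[OF 0 good *] by auto
qed

section \<open>Fibers\<close>

definition fscale :: "complex \<Rightarrow> ('x \<Rightarrow> complex) \<Rightarrow> 'x \<Rightarrow> complex" where
  "fscale c f = (\<lambda>x. c * f x)"

lemma vector_space_fscale: "vector_space (fscale :: complex \<Rightarrow> ('x \<Rightarrow> complex) \<Rightarrow> 'x \<Rightarrow> complex)"
  by unfold_locales (auto simp: fscale_def fun_eq_iff algebra_simps)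

lemma sum_fun_apply: "sum E M x = (\<Sum>p\<in>M. E p x)" for E :: "'p \<Rightarrow> 'x \<Rightarrow> 'a::comm_monoid_add"
  by (induction M rule: infinite_finite_induct) auto

lemma lin_comb_eq: "lin_comb c E M = (\<Sum>p\<in>M. fscale (c p) (E p))"
  by (rule ext) (simp add: lin_comb_def sum_fun_apply fscale_def)

lemma fun_add_eq: "(\<lambda>x. f x + g x) = f + g" for f g :: "'x \<Rightarrow> complex"
  by (simp add: plus_fun_def)

lemma sobolev_subspace: "module.subspace fscale (sobolev s :: 'n::finite distribution set)"
proof -
  interpret vector_space fscale by (rule vector_space_fscale)
  have "dist_of (\<lambda>_. 0) \<in> (sobolev s :: 'n distribution set)" by (rule dist_of_sobolev) (simp add: good_def)
  moreover have "dist_of (\<lambda>_. 0) = (0 :: 'n distribution)" by (rule ext) (simp add: dist_of_def)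
  ultimately have "0 \<in> (sobolev s :: 'n distribution set)" by simp
  then show ?thesis
    using sobolev_add(1) sobolev_scale(1)
    by (auto simp: subspace_def fscale_def fun_add_eq[symmetric])
qed

lemma chilbert_sobolev: "chilbert fscale (sobolev s) (sobolev_inner s) (sobolev_norm s)"
proof (rule chilbert_L2[where M = lborel and J = "\<lambda>f t. fhat f t * of_real (mu s t)"])
  show "vector_space fscale" by (rule vector_space_fscale)
  show "module.subspace fscale (sobolev s)" by (rule sobolev_subspace)
  show "L2 lborel (\<lambda>t. fhat f t * of_real (mu s t))" if "f \<in> sobolev s" for f
    using sobolev_fhat(2)[OF that] by (auto simp: good_def L2_def)
  show "AE t in lborel. fhat (f + g) t * of_real (mu s t) = fhat f t * of_real (mu s t) + fhat g t * of_real (mu s t)"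
    if "f \<in> sobolev s" "g \<in> sobolev s" for f g
    using sobolev_add(2)[OF that] unfolding plus_fun_def by eventually_elim (simp add: algebra_simps)
  show "AE t in lborel. fhat (fscale c f) t * of_real (mu s t) = c * (fhat f t * of_real (mu s t))"
    if "f \<in> sobolev s" for c f
    using sobolev_scale(2)[OF that, of c] unfolding fscale_def by eventually_elim simp
  show "\<exists>f\<in>sobolev s. AE t in lborel. fhat f t * of_real (mu s t) = g t" if g: "L2 lborel g" for g
  proof -
    have [measurable]: "g \<in> borel_measurable borel" using L2_measurable[OF g] by simp
    have h: "good s (\<lambda>t. g t / of_real (mu s t))" using g by (simp add: good_def L2_def)
    show ?thesis
      by (rule bexI[OF _ dist_of_sobolev[OF h]]) (use fhat_dist_of[OF h] in eventually_elim, simp)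
  qed
  show "f = 0" if f: "f \<in> sobolev s" and z: "AE t in lborel. fhat f t * of_real (mu s t) = 0" for f
  proof (rule sobolev_eqI[OF f])
    interpret vector_space fscale by (rule vector_space_fscale)
    show 0: "0 \<in> sobolev s" using sobolev_subspace by (rule subspace_0)
    have "fscale 0 f = 0" by (simp add: fscale_def fun_eq_iff)
    then have "AE t in lborel. fhat 0 t = 0 * fhat f t" using sobolev_scale(2)[OF f, of 0] by (simp add: fscale_def)
    then show "AE t in lborel. fhat f t = fhat 0 t" using z by eventually_elim simp
  qed
  show "sobolev_inner s f g = (LINT t|lborel. fhat f t * of_real (mu s t) * cnj (fhat g t * of_real (mu s t)))" for f g
    unfolding sobolev_inner_def by (rule Bochner_Integration.integral_cong) (auto simp: power2_eq_square)
  show "sobolev_norm s f = sqrt (Re (sobolev_inner s f f))" for f by (rule sobolev_norm_def)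
qed

lemma l2s_L2: "c \<in> l2s s \<longleftrightarrow> L2 (count_space UNIV) (\<lambda>k. c k * of_real (mu s (ivec k)))"
proof -
  let ?f = "\<lambda>k. (norm (c k))\<^sup>2 * (mu s (ivec k))\<^sup>2"
  have "?f summable_on UNIV \<longleftrightarrow> Infinite_Sum.abs_summable_on ?f UNIV" by simp
  also have "\<dots> \<longleftrightarrow> integrable (count_space UNIV) ?f"
    by (simp only: abs_summable_equivalent Infinite_Set_Sum.abs_summable_on_def)
  finally have "?f summable_on UNIV \<longleftrightarrow> integrable (count_space UNIV) ?f" .
  moreover have "(norm (c k * of_real (mu s (ivec k))))\<^sup>2 = ?f k" for k
    by (simp add: norm_mult power_mult_distrib)
  ultimately show ?thesis unfolding l2s_def L2_def by simp
qed

lemma chilbert_l2s: "chilbert fscale (l2s s :: (int^'n::finite \<Rightarrow> complex) set) (l2s_inner s) (l2s_norm s)"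
proof (rule chilbert_L2[where M = "count_space UNIV" and J = "\<lambda>c k. c k * of_real (mu s (ivec k))"])
  show vs: "vector_space fscale" by (rule vector_space_fscale)
  interpret vector_space fscale by (rule vs)
  show "module.subspace fscale (l2s s)"
    unfolding subspace_def
  proof (intro conjI ballI allI)
    show "0 \<in> l2s s" by (simp add: l2s_def)
    show "x + y \<in> l2s s" if "x \<in> l2s s" "y \<in> l2s s" for x y
      using L2_add[of "count_space UNIV" "\<lambda>k. x k * of_real (mu s (ivec k))" "\<lambda>k. y k * of_real (mu s (ivec k))"] that
      by (simp add: l2s_L2 distrib_right)
    show "fscale c x \<in> l2s s" if "x \<in> l2s s" for c x
      using L2_cmult[of "count_space UNIV" "\<lambda>k. x k * of_real (mu s (ivec k))" c] that
      by (simp add: l2s_L2 fscale_def mult.assoc)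
  qed
  show "L2 (count_space UNIV) (\<lambda>k. c k * of_real (mu s (ivec k)))" if "c \<in> l2s s" for c using that l2s_L2 by blast
  show "\<exists>c\<in>l2s s. AE k in count_space UNIV. c k * of_real (mu s (ivec k)) = g k" if "L2 (count_space UNIV) g" for g
    by (rule bexI[of _ "\<lambda>k. g k / of_real (mu s (ivec k))"]) (use that in \<open>simp_all add: l2s_L2\<close>)
  show "f = 0" if "AE k in count_space UNIV. f k * of_real (mu s (ivec k)) = 0" for f :: "int^'n \<Rightarrow> complex"
    using that by (auto simp: AE_count_space fun_eq_iff)
  show "l2s_inner s f g = (LINT k|count_space UNIV. f k * of_real (mu s (ivec k)) * cnj (g k * of_real (mu s (ivec k))))"
    if fg: "f \<in> l2s s" "g \<in> l2s s" for f g
  proof -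
    let ?h = "\<lambda>k. f k * of_real (mu s (ivec k)) * cnj (g k * of_real (mu s (ivec k)))"
    have "Infinite_Set_Sum.abs_summable_on ?h UNIV"
      using L2_mult_integrable[OF fg[unfolded l2s_L2]] by (simp only: Infinite_Set_Sum.abs_summable_on_def)
    from infsetsum_infsum[OF this] show ?thesis
      by (simp add: infsetsum_def l2s_inner_def power2_eq_square mult_ac)
  qed
  show "l2s_norm s f = sqrt (Re (l2s_inner s f f))" for f by (rule l2s_norm_def)
qed (auto simp: fscale_def algebra_simps)

lemma bex_span_of:
  "(\<exists>g\<in>span_of E P. Q g) \<longleftrightarrow> (\<exists>c M. finite M \<and> M \<subseteq> P \<and> Q (\<Sum>p\<in>M. fscale (c p) (E p)))"
  unfolding span_of_def lin_comb_eq by auto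

lemma closed_span_sobolev: "closed_span (sobolev s) (sobolev_norm s) E P = chilbert.cspan fscale (sobolev s) (sobolev_norm s) E P"
  unfolding chilbert.cspan_def[OF chilbert_sobolev] closed_span_def bex_span_of fun_diff_def by (rule refl)

lemma closed_span_l2s: "closed_span (l2s s) (l2s_norm s) E P = chilbert.cspan fscale (l2s s) (l2s_norm s) E P"
  unfolding chilbert.cspan_def[OF chilbert_l2s] closed_span_def bex_span_of fun_diff_def by (rule refl)

lemma sobolev_has_sum_eq: "sobolev_has_sum s E P f = chilbert.usum (sobolev s) (sobolev_norm s) E P f"
proof -
  have "(\<lambda>\<psi>. f \<psi> - (\<Sum>p\<in>M. E p \<psi>)) = f - sum E M" for M by (simp add: fun_eq_iff sum_fun_apply)
  then show ?thesis unfolding sobolev_has_sum_def chilbert.usum_def[OF chilbert_sobolev] by simp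
qed

lemma sobolev_norm_sq_nn_integral:
  assumes "f \<in> sobolev s"
  shows "ennreal ((sobolev_norm s f)\<^sup>2) = (\<integral>\<^sup>+t. ennreal ((norm (fhat f t * of_real (mu s t)))\<^sup>2) \<partial>lborel)"
proof -
  interpret chilbert fscale "sobolev s" "sobolev_inner s" "sobolev_norm s" by (rule chilbert_sobolev)
  have int: "integrable lborel (\<lambda>t. (norm (fhat f t * of_real (mu s t)))\<^sup>2)"
    using sobolev_fhat(2)[OF assms] by (simp add: good_def)
  have "sobolev_inner s f f = (LINT t|lborel. of_real ((norm (fhat f t * of_real (mu s t)))\<^sup>2))"
    unfolding sobolev_inner_def complex_norm_square
    by (rule Bochner_Integration.integral_cong) (auto simp: power2_eq_square)
  then have "(sobolev_norm s f)\<^sup>2 = (LINT t|lborel. (norm (fhat f t * of_real (mu s t)))\<^sup>2)"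
    using nrm_sq[OF assms] by (simp only: integral_complex_of_real Re_complex_of_real)
  then show ?thesis using nn_integral_eq_integral[OF int] by simp
qed

lemma l2s_iff_nn_integral:
  "c \<in> l2s s \<longleftrightarrow> (\<integral>\<^sup>+k. ennreal ((norm (c k * of_real (mu s (ivec k))))\<^sup>2) \<partial>count_space UNIV) < \<infinity>"
  by (simp add: l2s_L2 L2_iff)

lemma l2s_norm_sq_nn_integral:
  assumes "c \<in> l2s s"
  shows "ennreal ((l2s_norm s c)\<^sup>2) = (\<integral>\<^sup>+k. ennreal ((norm (c k * of_real (mu s (ivec k))))\<^sup>2) \<partial>count_space UNIV)"
proof -
  interpret chilbert fscale "l2s s" "l2s_inner s" "l2s_norm s" by (rule chilbert_l2s)
  let ?h = "\<lambda>k. (norm (c k * of_real (mu s (ivec k))))\<^sup>2"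
  have int: "integrable (count_space UNIV) ?h" using assms by (simp add: l2s_L2 L2_def)
  have "Infinite_Set_Sum.abs_summable_on (\<lambda>k. complex_of_real (?h k)) UNIV"
    unfolding Infinite_Set_Sum.abs_summable_on_def using int by (intro integrable_of_real)
  from infsetsum_infsum[OF this]
  have "(\<Sum>\<^sub>\<infinity>k. complex_of_real (?h k)) = of_real (LINT k|count_space UNIV. ?h k)"
    by (simp only: infsetsum_def integral_complex_of_real)
  moreover have "l2s_inner s c c = (\<Sum>\<^sub>\<infinity>k. complex_of_real (?h k))"
    unfolding l2s_inner_def complex_norm_square by (simp add: power2_eq_square mult_ac)
  ultimately have "(l2s_norm s c)\<^sup>2 = (LINT k|count_space UNIV. ?h k)"
    using nrm_sq[OF assms] by simp
  then show ?thesis using nn_integral_eq_integral[OF int] by simp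
qed

section \<open>Tiling by the torus and the fiber isometry\<close>

lemma ivec_component [simp]: "ivec k $ i = real_of_int (k $ i)" by (simp add: ivec_def)

lemma torus_measurable [measurable]: "torus \<in> sets borel"
  unfolding torus_def by measurable

lemma torus_unique: "\<exists>!k. x - ivec k \<in> torus"
proof
  \<comment> \<open>The nearest integer in each coordinate with ties rounded up, which matches the
    half-open interval from -1/2 to 1/2.\<close>
  let ?k = "\<chi> i. \<lfloor>x $ i + 1/2\<rfloor>"
  show "x - ivec ?k \<in> torus" unfolding torus_def by (auto, linarith+)
  fix k assume "x - ivec k \<in> torus"
  then have b: "- 1/2 \<le> x $ i - real_of_int (k $ i)" "x $ i - real_of_int (k $ i) < 1/2" for i by (auto simp: torus_def)
  have "k $ i = \<lfloor>x $ i + 1/2\<rfloor>" for i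
    by (rule floor_unique[symmetric]) (use b[of i] in linarith)+
  then show "k = ?k" by (simp add: vec_eq_iff)
qed

lemma nn_integral_translate:
  fixes a :: "'a::euclidean_space"
  assumes [measurable]: "f \<in> borel_measurable borel"
  shows "(\<integral>\<^sup>+x. f (x + a) \<partial>lborel) = (\<integral>\<^sup>+x. f x \<partial>lborel)"
  by (subst (2) lborel_distr_plus[of a, symmetric], subst nn_integral_distr) (auto simp: add.commute)

text \<open>The integer translates of the torus partition the space, so 1 is the sum over k of the
  indicator of the torus at x - k. For nonnegative functions sum and integral may be interchanged,
  and each summand is translated back to the torus.\<close>

lemma nn_integral_tile:
  fixes g :: "real^'n::finite \<Rightarrow> ennreal"
  assumes [measurable]: "g \<in> borel_measurable borel"
  shows "(\<integral>\<^sup>+x. g x \<partial>lborel) = (\<integral>\<^sup>+t. indicator torus t * (\<integral>\<^sup>+k. g (t + ivec k) \<partial>count_space UNIV) \<partial>lborel)"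
proof -
  have c: "countable (UNIV :: (int^'n) set)" by simp
  have "g x = (\<integral>\<^sup>+k. indicator torus (x - ivec k) * g x \<partial>count_space UNIV)" for x
  proof -
    obtain k0 where k0: "\<And>k. x - ivec k \<in> torus \<longleftrightarrow> k = k0" using torus_unique[of x] by metis
    have "(\<integral>\<^sup>+k. indicator torus (x - ivec k) * g x \<partial>count_space UNIV) = (\<Sum>k\<in>{k0}. indicator torus (x - ivec k) * g x)"
      by (rule nn_integral_count_space') (auto simp: k0 indicator_def)
    then show ?thesis using k0 by simp
  qed
  then have "(\<integral>\<^sup>+x. g x \<partial>lborel) = (\<integral>\<^sup>+x. \<integral>\<^sup>+k. indicator torus (x - ivec k) * g x \<partial>count_space UNIV \<partial>lborel)"
    by (intro nn_integral_cong)
  also have "\<dots> = (\<integral>\<^sup>+k. \<integral>\<^sup>+x. indicator torus (x - ivec k) * g x \<partial>lborel \<partial>count_space UNIV)"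
    by (rule nn_integral_count_space_nn_integral[OF c]) measurable
  also have "\<dots> = (\<integral>\<^sup>+k. \<integral>\<^sup>+t. indicator torus t * g (t + ivec k) \<partial>lborel \<partial>count_space UNIV)"
  proof (rule nn_integral_cong)
    fix k :: "int^'n"
    have "(\<integral>\<^sup>+t. indicator torus (t + ivec k - ivec k) * g (t + ivec k) \<partial>lborel) = (\<integral>\<^sup>+x. indicator torus (x - ivec k) * g x \<partial>lborel)"
      by (rule nn_integral_translate[where f = "\<lambda>x. indicator torus (x - ivec k) * g x"]) measurable
    then show "(\<integral>\<^sup>+x. indicator torus (x - ivec k) * g x \<partial>lborel) = (\<integral>\<^sup>+t. indicator torus t * g (t + ivec k) \<partial>lborel)"
      by simp
  qed
  also have "\<dots> = (\<integral>\<^sup>+t. \<integral>\<^sup>+k. indicator torus t * g (t + ivec k) \<partial>count_space UNIV \<partial>lborel)"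
    by (rule nn_integral_count_space_nn_integral[OF c, symmetric]) measurable
  also have "\<dots> = (\<integral>\<^sup>+t. indicator torus t * (\<integral>\<^sup>+k. g (t + ivec k) \<partial>count_space UNIV) \<partial>lborel)"
    by (simp add: nn_integral_cmult)
  finally show ?thesis .
qed

text \<open>Countably many translates of a null set are null together. This turns an equation for
  \<open>fhat\<close> at almost every point into an equation for entire fibers.\<close>

lemma AE_translate_all:
  assumes "AE x in lborel. P (x :: real^'n::finite)"
  shows "AE t in lborel. \<forall>k. P (t + ivec k)"
proof (subst AE_all_countable, rule allI)
  fix k :: "int^'n"
  have "AE x in distr lborel borel ((+) (ivec k)). P x" using assms by (simp only: lborel_distr_plus)
  then have "AE t in lborel. P (ivec k + t)" by (rule AE_distrD[rotated]) simp
  then show "AE t in lborel. P (t + ivec k)" by (simp add: add.commute)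
qed

lemma fiber_AE:
  assumes "AE x in lborel. fhat f x = h x"
  shows "AE t in lborel. fiber s f t = (\<lambda>k. of_real (mu s (t + ivec k) / mu s (ivec k)) * h (t + ivec k))"
  using AE_translate_all[OF assms] by eventually_elim (simp add: fiber_def)

lemma fiber_add:
  assumes "f \<in> sobolev s" "g \<in> sobolev s"
  shows "AE t in lborel. fiber s (f + g) t = fiber s f t + fiber s g t"
  using fiber_AE[OF sobolev_add(2)[OF assms], of s] unfolding plus_fun_def
  by eventually_elim (simp add: fiber_def fun_eq_iff distrib_left add_divide_distrib)

lemma fiber_scale:
  assumes "f \<in> sobolev s"
  shows "AE t in lborel. fiber s (fscale c f) t = fscale c (fiber s f t)"
  using fiber_AE[OF sobolev_scale(2)[OF assms, of c], of s] unfolding fscale_def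
  by eventually_elim (simp add: fiber_def fun_eq_iff)

lemma ee_integer: "ee (ivec j) (ivec k) = 1"
proof -
  have "ivec j \<bullet> ivec k = of_int (\<Sum>i\<in>UNIV. j $ i * k $ i)" by (simp add: inner_vec_def)
  then have "ee (ivec j) (ivec k) = cis (2 * pi * of_int (- (\<Sum>i\<in>UNIV. j $ i * k $ i)))"
    by (simp add: ee_def)
  then show ?thesis by (simp only: cis_multiple_2pi[OF Ints_of_int])
qed

text \<open>The character with integer frequency takes the same value at t and at t + j for integer
  j, so a single scalar multiplies all coordinates of the fiber.\<close>

lemma fiber_translate:
  assumes "f \<in> sobolev s"
  shows "AE t in lborel. fiber s (translate k f) t = fscale (ee t (ivec k)) (fiber s f t)"
  using fiber_AE[OF sobolev_translate(2)[OF assms, of k], of s]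
  by eventually_elim (simp add: fiber_def fun_eq_iff fscale_def ee_add ee_integer)

text \<open>The squared \<open>l2s_norm\<close> of the fiber as an extended nonnegative number. It
  makes sense, and is measurable in \<open>t\<close>, before the fiber is known to lie in
  \<open>l2s s\<close>.\<close>

definition fiber_energy :: "real \<Rightarrow> 'n::finite distribution \<Rightarrow> real^'n \<Rightarrow> ennreal" where
  "fiber_energy s f t = (\<integral>\<^sup>+k. ennreal ((norm (fiber s f t k * of_real (mu s (ivec k))))\<^sup>2) \<partial>count_space UNIV)"

lemma fiber_energy_eq:
  "fiber_energy s f t = (\<integral>\<^sup>+k. ennreal ((norm (fhat f (t + ivec k) * of_real (mu s (t + ivec k))))\<^sup>2) \<partial>count_space UNIV)"
proof -
  have "fiber s f t k * of_real (mu s (ivec k)) = fhat f (t + ivec k) * of_real (mu s (t + ivec k))" for k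
    by (simp add: fiber_def)
  then show ?thesis unfolding fiber_energy_def by presburger
qed

lemma fiber_energy_measurable [measurable (raw)]:
  assumes "f \<in> sobolev s"
  shows "fiber_energy s f \<in> borel_measurable borel"
proof -
  have [measurable]: "fhat f \<in> borel_measurable borel" using sobolev_fhat(2)[OF assms] by (simp add: good_def)
  have "(\<lambda>t. \<integral>\<^sup>+k. ennreal ((norm (fhat f (t + ivec k) * of_real (mu s (t + ivec k))))\<^sup>2) \<partial>count_space UNIV) \<in> borel_measurable borel"
  proof (rule sigma_finite_measure.borel_measurable_nn_integral)
    show "sigma_finite_measure (count_space (UNIV :: (int^'n) set))"
      by (rule sigma_finite_measure_count_space_countable) simp
    show "(\<lambda>(t, k). ennreal ((norm (fhat f (t + ivec k) * of_real (mu s (t + ivec k))))\<^sup>2)) \<in> borel_measurable (borel \<Otimes>\<^sub>M count_space UNIV)"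
      unfolding case_prod_beta
      by (rule measurable_compose_countable[where g = snd and
          f = "\<lambda>k p. ennreal ((norm (fhat f (fst p + ivec k) * of_real (mu s (fst p + ivec k))))\<^sup>2)"])
         measurable
  qed
  then show ?thesis by (simp add: fiber_energy_eq[abs_def])
qed

lemma fiber_isometry:
  assumes "f \<in> sobolev s"
  shows "(\<integral>\<^sup>+t. indicator torus t * fiber_energy s f t \<partial>lborel) = ennreal ((sobolev_norm s f)\<^sup>2)"
proof -
  have [measurable]: "fhat f \<in> borel_measurable borel" using sobolev_fhat(2)[OF assms] by (simp add: good_def)
  show ?thesis unfolding sobolev_norm_sq_nn_integral[OF assms] fiber_energy_eq
    by (rule nn_integral_tile[symmetric]) measurable
qed

lemma fiber_in_l2s:
  assumes "f \<in> sobolev s"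
  shows "AE t in lborel. t \<in> torus \<longrightarrow> fiber s f t \<in> l2s s \<and> fiber_energy s f t = ennreal ((l2s_norm s (fiber s f t))\<^sup>2)"
proof -
  have "AE t in lborel. indicator torus t * fiber_energy s f t \<noteq> \<infinity>"
    using fiber_energy_measurable[OF assms] fiber_isometry[OF assms] by (intro nn_integral_PInf_AE) auto
  then show ?thesis
  proof eventually_elim
    case (elim t)
    show ?case
    proof
      assume "t \<in> torus"
      then have "fiber s f t \<in> l2s s"
        using elim unfolding l2s_iff_nn_integral fiber_energy_def by (simp add: less_top)
      then show "fiber s f t \<in> l2s s \<and> fiber_energy s f t = ennreal ((l2s_norm s (fiber s f t))\<^sup>2)"
        using l2s_norm_sq_nn_integral[of "fiber s f t" s] unfolding fiber_energy_def by simp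
    qed
  qed
qed

section \<open>Trigonometric polynomials on the torus\<close>

inductive trig :: "(real^'n::finite \<Rightarrow> complex) \<Rightarrow> bool" where
  monomial: "trig (\<lambda>t. c * ee t (ivec k))"
| add: "trig f \<Longrightarrow> trig g \<Longrightarrow> trig (\<lambda>t. f t + g t)"

lemma ivec_add: "ivec (j + k) = ivec j + ivec k" by (simp add: vec_eq_iff)

lemma ivec_zero [simp]: "ivec 0 = 0" by (simp add: vec_eq_iff)

lemma ivec_minus: "ivec (- k) = - ivec k" by (simp add: vec_eq_iff)

lemma ee_add_right: "ee t (x + y) = ee t x * ee t y"
  using ee_add[of x y t] by (simp add: ee_commute[of t])

lemma ee_minus_right: "ee t (- x) = cnj (ee t x)"
  using ee_minus[of x t] by (simp add: ee_commute[of t])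

lemma trig_const: "trig (\<lambda>t. c)"
  using trig.monomial[of c 0] by simp

lemma trig_mult: "trig f \<Longrightarrow> trig g \<Longrightarrow> trig (\<lambda>t. f t * g t)"
proof (induction f rule: trig.induct)
  case (monomial c k)
  show ?case using monomial
  proof (induction g rule: trig.induct)
    case (monomial d j)
    have "(\<lambda>t. c * ee t (ivec k) * (d * ee t (ivec j))) = (\<lambda>t. (c * d) * ee t (ivec (k + j)))"
      by (simp add: fun_eq_iff ivec_add ee_add_right mult_ac)
    then show ?case using trig.monomial by metis
  next
    case (add f g)
    then show ?case using trig.add by (simp add: distrib_left)
  qed
next
  case (add f g)
  then show ?case using trig.add by (simp add: distrib_right)
qed

lemma trig_sum: "finite M \<Longrightarrow> (\<And>i. i \<in> M \<Longrightarrow> trig (f i)) \<Longrightarrow> trig (\<lambda>t. \<Sum>i\<in>M. f i t)"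
  by (induction M rule: finite_induct) (auto simp: trig_const intro: trig.add)

lemma trig_form: "trig f \<Longrightarrow> \<exists>M p. finite M \<and> f = (\<lambda>t. \<Sum>k\<in>M. p k * ee t (ivec k))"
proof (induction rule: trig.induct)
  case (monomial c k)
  show ?case by (rule exI[of _ "{k}"], rule exI[of _ "\<lambda>_. c"]) simp
next
  case (add f g)
  then obtain M p N q where M: "finite M" "f = (\<lambda>t. \<Sum>k\<in>M. p k * ee t (ivec k))"
    and N: "finite N" "g = (\<lambda>t. \<Sum>k\<in>N. q k * ee t (ivec k))" by blast
  have "f t = (\<Sum>k\<in>M \<union> N. (if k \<in> M then p k else 0) * ee t (ivec k))" for t
    unfolding M(2) using M(1) N(1) by (intro sum.mono_neutral_cong_left) auto
  moreover have "g t = (\<Sum>k\<in>M \<union> N. (if k \<in> N then q k else 0) * ee t (ivec k))" for t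
    unfolding N(2) using M(1) N(1) by (intro sum.mono_neutral_cong_left) auto
  ultimately have "(\<lambda>t. f t + g t) = (\<lambda>t. \<Sum>k\<in>M \<union> N. ((if k \<in> M then p k else 0) + (if k \<in> N then q k else 0)) * ee t (ivec k))"
    by (simp add: fun_eq_iff sum.distrib distrib_right)
  then show ?case using M(1) N(1)
    by (intro exI[of _ "M \<union> N"] exI[of _ "\<lambda>k. (if k \<in> M then p k else 0) + (if k \<in> N then q k else 0)"]) simp
qed

text \<open>The quotient map onto the standard torus inside \<open>\<complex>\<^sup>n\<close>, where polynomials become
  trigonometric polynomials.\<close>

definition circ :: "real^'n::finite \<Rightarrow> complex^'n" where
  "circ t = (\<chi> i. ee t (axis i 1))"

lemma axis_eq_ivec: "axis i 1 = ivec (axis i 1)"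
  by (simp add: vec_eq_iff axis_def)

lemma trig_circ: "trig (\<lambda>t. circ t $ i)" "trig (\<lambda>t. cnj (circ t $ i))"
proof -
  show "trig (\<lambda>t. circ t $ i)"
    using trig.monomial[of 1 "axis i 1"] by (simp add: circ_def axis_eq_ivec)
  have "trig (\<lambda>t. 1 * ee t (ivec (- axis i 1)))" by (rule trig.monomial)
  then show "trig (\<lambda>t. cnj (circ t $ i))"
    by (simp add: circ_def axis_eq_ivec ivec_minus ee_minus_right)
qed

text \<open>Only linear functionals need work: a real-linear functional on complex n-space is a
  combination of the coordinates and their conjugates, and along \<open>circ\<close> both are
  characters. Sums and products stay inside \<open>trig\<close>.\<close>

lemma trig_polynomial:
  assumes "real_polynomial_function P"
  shows "trig (\<lambda>t::real^'n::finite. of_real (P (circ t)))"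
  using assms
proof (induction rule: real_polynomial_function.induct)
  case (linear h)
  interpret h: bounded_linear h by (rule linear)
  have "complex_of_real (h (circ t)) = (\<Sum>i\<in>UNIV. (1/2 * h (axis i 1) + (- \<i> / 2) * h (axis i \<i>)) * circ t $ i +
      (1/2 * h (axis i 1) - (- \<i> / 2) * h (axis i \<i>)) * cnj (circ t $ i))" for t :: "real^'n"
  proof -
    have "circ t = (\<Sum>i\<in>UNIV. Re (circ t $ i) *\<^sub>R axis i 1 + Im (circ t $ i) *\<^sub>R axis i \<i>)"
      by (simp add: vec_eq_iff complex_eq_iff axis_def if_distrib[of "(*\<^sub>R) _"] if_distrib[of Re] if_distrib[of Im] sum.distrib cong: if_cong)
    then have "h (circ t) = h (\<Sum>i\<in>UNIV. Re (circ t $ i) *\<^sub>R axis i 1 + Im (circ t $ i) *\<^sub>R axis i \<i>)" by simp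
    also have "\<dots> = (\<Sum>i\<in>UNIV. Re (circ t $ i) * h (axis i 1) + Im (circ t $ i) * h (axis i \<i>))"
      by (simp add: h.sum h.add h.scaleR)
    finally have "complex_of_real (h (circ t)) = (\<Sum>i\<in>UNIV. of_real (Re (circ t $ i) * h (axis i 1) + Im (circ t $ i) * h (axis i \<i>)))"
      by (simp only: of_real_sum)
    also have "\<dots> = (\<Sum>i\<in>UNIV. (1/2 * h (axis i 1) + (- \<i> / 2) * h (axis i \<i>)) * circ t $ i +
      (1/2 * h (axis i 1) - (- \<i> / 2) * h (axis i \<i>)) * cnj (circ t $ i))"
      by (rule sum.cong) (auto simp: complex_eq_iff algebra_simps)
    finally show ?thesis .
  qed
  then show ?case by (simp only:) (intro trig_sum trig.add trig_mult trig_const trig_circ finite)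
next
  case (const c)
  show ?case by (rule trig_const)
next
  case (add f g)
  then show ?case using trig.add by simp
next
  case (mult f g)
  then show ?case using trig_mult by simp
qed

text \<open>Equal images under \<open>circ\<close> mean that the coordinates differ by integers, and
  an integer of modulus less than 1 is 0.\<close>

lemma circ_eq_imp:
  assumes "circ t = circ c" and "\<And>i. \<bar>t $ i - c $ i\<bar> < 1"
  shows "t = c"
proof -
  have "t $ i = c $ i" for i
  proof -
    have "cis (- (2 * pi * t $ i)) = cis (- (2 * pi * c $ i))"
      using arg_cong[OF assms(1), of "\<lambda>z. z $ i"] by (simp add: circ_def ee_def inner_axis)
    then have "sin (- (2 * pi * t $ i)) = sin (- (2 * pi * c $ i)) \<and> cos (- (2 * pi * t $ i)) = cos (- (2 * pi * c $ i))"
      by (simp add: complex_eq_iff)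
    then obtain n :: int where "- (2 * pi * t $ i) = - (2 * pi * c $ i) + 2 * pi * n"
      unfolding sin_cos_eq_iff by blast
    then have "2 * pi * (c $ i - t $ i) = 2 * pi * n" by (simp add: algebra_simps)
    then have n: "c $ i - t $ i = n" by simp
    then have "\<bar>real_of_int n\<bar> < 1" using assms(2)[of i] by linarith
    then have "n = 0" by linarith
    then show ?thesis using n by simp
  qed
  then show ?thesis by (simp add: vec_eq_iff)
qed

lemma continuous_on_circ: "continuous_on S circ"
  unfolding circ_def ee_def cis_conv_exp by (intro continuous_intros)

definition torus_interior :: "(real^'n::finite) set" where
  "torus_interior = box (\<chi> i. - 1/2) (\<chi> i. 1/2)"

lemma torus_interior_iff: "t \<in> torus_interior \<longleftrightarrow> (\<forall>i. - 1/2 < t $ i \<and> t $ i < 1/2)"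
  by (simp add: torus_interior_def mem_box_cart)

lemma torus_interior_subset: "torus_interior \<subseteq> torus"
  by (auto simp: torus_interior_iff torus_def less_imp_le)

lemma AE_torus_interior: "AE t in lborel. t \<in> torus \<longrightarrow> (t::real^'n::finite) \<in> torus_interior"
proof -
  have "AE t in lborel. \<forall>i\<in>UNIV. (t::real^'n) $ i \<noteq> - 1/2"
    by (subst AE_ball_countable) (auto intro: AE_coord_neq)
  then show ?thesis
    by eventually_elim (auto simp: torus_interior_iff torus_def less_le)
qed

text \<open>The indicator of \<open>U\<close> is a bounded pointwise limit of squares of trigonometric polynomials:
  take Stone--Weierstrass approximations of the square roots of \<open>min 1 (j * infdist z (circ ` C))\<close>,
  where \<open>C\<close> is the rest of the closed cube.\<close>

lemma integral_open_nonneg: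
  fixes w :: "real^'n::finite \<Rightarrow> real"
  assumes int: "integrable lborel (\<lambda>t. indicator torus t * w t)"
    and pos: "\<And>q. trig q \<Longrightarrow> 0 \<le> (LINT t|lborel. (norm (q t))\<^sup>2 * (indicator torus t * w t))"
    and U: "open U" "U \<subseteq> torus_interior"
  shows "0 \<le> (LINT t|lborel. indicator U t * w t)"
proof -
  let ?T = "cbox (\<chi> i. - 1/2) (\<chi> i. 1/2) :: (real^'n) set"
  define C where "C = ?T - U"
  have TT: "torus \<subseteq> ?T" by (auto simp: torus_def mem_box_cart less_imp_le)
  have "compact C" unfolding C_def using U(1) by (intro compact_diff compact_cbox)
  then have cC: "compact (circ ` C)" by (intro compact_continuous_image continuous_on_circ)
  have cT: "compact (circ ` ?T)" by (intro compact_continuous_image continuous_on_circ compact_cbox)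
  \<comment> \<open>The distance \<open>infdist\<close> to an empty set is 0 by convention, so
    \<open>C\<close> must have a point. A corner of the closed cube is never in \<open>U\<close>,
    which lies in the interior.\<close>
  have "(\<chi> i. 1/2) \<in> C" using U(2) by (auto simp: C_def mem_box_cart torus_interior_iff)
  then have ne: "circ ` C \<noteq> {}" by blast
  define g where "g j z = sqrt (min 1 (real j * infdist z (circ ` C)))" for j z
  have "continuous_on (circ ` ?T) (g j)" for j
    unfolding g_def by (intro continuous_intros)
  then have "\<exists>P. real_polynomial_function P \<and> (\<forall>x\<in>circ ` ?T. \<bar>g j x - P x\<bar> < inverse (real (Suc j)))" for j
    using Stone_Weierstrass_real_polynomial_function[OF cT, of "g j" "inverse (real (Suc j))"] by (metis inverse_positive_iff_positive of_nat_0_less_iff zero_less_Suc)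
  then obtain P where P: "\<And>j. real_polynomial_function (P j)"
    and app: "\<And>j x. x \<in> circ ` ?T \<Longrightarrow> \<bar>g j x - P j x\<bar> < inverse (real (Suc j))" by metis
  have g01: "0 \<le> g j z" "g j z \<le> 1" for j z unfolding g_def by (auto simp: infdist_nonneg)
  have mem: "circ t \<in> circ ` C \<longleftrightarrow> t \<notin> U" if t: "t \<in> torus" for t
  proof
    assume "circ t \<in> circ ` C"
    then obtain c where c: "c \<in> C" "circ t = circ c" by auto
    show "t \<notin> U"
    proof
      assume "t \<in> U"
      then have "\<bar>t $ i - c $ i\<bar> < 1" for i
        using U(2) c(1) unfolding C_def by (auto simp: torus_interior_iff mem_box_cart abs_less_iff subset_iff)
          (smt (verit, best) field_sum_of_halves)+
      from circ_eq_imp[OF c(2) this] show False using \<open>t \<in> U\<close> c(1) by (simp add: C_def)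
    qed
  next
    assume "t \<notin> U"
    then show "circ t \<in> circ ` C" using t TT by (auto simp: C_def)
  qed
  have glim: "(\<lambda>j. g j (circ t)) \<longlonglongrightarrow> indicator U t" if t: "t \<in> torus" for t
  proof (cases "t \<in> U")
    case True
    then have "infdist (circ t) (circ ` C) \<noteq> 0"
      using mem[OF t] in_closed_iff_infdist_zero[OF compact_imp_closed[OF cC] ne] by blast
    then have d: "infdist (circ t) (circ ` C) > 0" using infdist_nonneg[of "circ t" "circ ` C"] by linarith
    obtain N :: nat where N: "1 / infdist (circ t) (circ ` C) < N" using reals_Archimedean2 by blast
    have "g j (circ t) = 1" if "j \<ge> N" for j
    proof -
      have "1 / infdist (circ t) (circ ` C) \<le> j" using N that by linarith
      then have "1 \<le> real j * infdist (circ t) (circ ` C)" using d by (simp add: field_simps)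
      then show ?thesis by (simp add: g_def)
    qed
    then have "\<forall>\<^sub>F j in sequentially. g j (circ t) = indicator U t"
      unfolding eventually_sequentially using True by auto
    then show ?thesis by (rule tendsto_eventually)
  next
    case False
    then have "circ t \<in> circ ` C" using mem[OF t] by blast
    then have "infdist (circ t) (circ ` C) = 0" by simp
    then show ?thesis using False by (simp add: g_def)
  qed
  have inT: "circ t \<in> circ ` ?T" if "t \<in> torus" for t using that TT by blast
  have Plim: "(\<lambda>j. P j (circ t)) \<longlonglongrightarrow> indicator U t" if t: "t \<in> torus" for t
  proof -
    have "(\<lambda>j. g j (circ t) - P j (circ t)) \<longlonglongrightarrow> 0"
    proof (rule Lim_null_comparison[OF _ LIMSEQ_inverse_real_of_nat])
      show "\<forall>\<^sub>F j in sequentially. norm (g j (circ t) - P j (circ t)) \<le> inverse (real (Suc j))"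
        using app[OF inT[OF t]] by (intro always_eventually) (simp add: less_imp_le)
    qed
    from tendsto_diff[OF glim[OF t] this] show ?thesis by simp
  qed
  \<comment> \<open>The function \<open>g j\<close> takes values between 0 and 1 and the
    approximation error is below 1. The square of this bound 2 is the constant 4 in the
    majorant.\<close>
  have Pb: "\<bar>P j (circ t)\<bar> \<le> 2" if t: "t \<in> torus" for j t
  proof -
    have "inverse (real (Suc j)) \<le> 1" by (simp add: inverse_le_1_iff)
    then show ?thesis using app[OF inT[OF t], of j] g01[of j "circ t"] by (simp add: abs_if split: if_splits)
  qed
  have circm: "circ \<in> borel_measurable borel"
    by (rule borel_measurable_continuous_onI[OF continuous_on_circ])
  have Pm: "P j \<in> borel_measurable borel" for j
    by (rule borel_measurable_continuous_onI)
       (use P continuous_on_polymonial_function real_polynomial_function_eq in blast)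
  have [measurable]: "(\<lambda>t. P j (circ t)) \<in> borel_measurable borel" for j
    by (rule measurable_compose[OF circm Pm])
  have wm: "(\<lambda>t. indicator torus t * w t) \<in> borel_measurable borel"
    using int by auto
  have Um [measurable]: "U \<in> sets borel" using U(1) by simp
  \<comment> \<open>The indicator is squared so that the right side is visibly the limit of the
    expressions with the square of \<open>P j\<close>.\<close>
  have Ueq: "indicator U t * w t = (indicator U t)\<^sup>2 * (indicator torus t * w t)" for t
    using U(2) torus_interior_subset by (auto simp: indicator_def)
  have "(\<lambda>j. LINT t|lborel. (P j (circ t))\<^sup>2 * (indicator torus t * w t)) \<longlonglongrightarrow> (LINT t|lborel. indicator U t * w t)"
  proof (rule integral_dominated_convergence[where w = "\<lambda>t. 4 * norm (indicator torus t * w t)"])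
    show "integrable lborel (\<lambda>t. 4 * norm (indicator torus t * w t))"
      by (intro integrable_mult_right integrable_norm int)
    show "(\<lambda>t. indicator U t * w t) \<in> borel_measurable lborel"
      unfolding Ueq using wm by measurable
    show "(\<lambda>t. (P j (circ t))\<^sup>2 * (indicator torus t * w t)) \<in> borel_measurable lborel" for j
      using wm by measurable
    show "AE t in lborel. (\<lambda>j. (P j (circ t))\<^sup>2 * (indicator torus t * w t)) \<longlonglongrightarrow> indicator U t * w t"
    proof (rule AE_I2)
      fix t
      show "(\<lambda>j. (P j (circ t))\<^sup>2 * (indicator torus t * w t)) \<longlonglongrightarrow> indicator U t * w t"
      proof (cases "t \<in> torus")
        case True
        show ?thesis unfolding Ueq[of t] by (intro tendsto_mult tendsto_power Plim[OF True] tendsto_const)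
      next
        case False
        then have "t \<notin> U" using U(2) torus_interior_subset by blast
        then show ?thesis using False by simp
      qed
    qed
    show "AE t in lborel. norm ((P j (circ t))\<^sup>2 * (indicator torus t * w t)) \<le> 4 * norm (indicator torus t * w t)" for j
    proof (rule AE_I2)
      fix t
      show "norm ((P j (circ t))\<^sup>2 * (indicator torus t * w t)) \<le> 4 * norm (indicator torus t * w t)"
      proof (cases "t \<in> torus")
        case True
        have "(P j (circ t))\<^sup>2 \<le> 2\<^sup>2" using Pb[OF True, of j] by (metis abs_ge_zero power2_abs power_mono)
        then have "(P j (circ t))\<^sup>2 * norm (indicator torus t * w t) \<le> 4 * norm (indicator torus t * w t)"
          by (intro mult_right_mono) auto
        then show ?thesis by (simp add: abs_mult)
      qed simp
    qed
  qed
  moreover have "0 \<le> (LINT t|lborel. (P j (circ t))\<^sup>2 * (indicator torus t * w t))" for j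
    using pos[OF trig_polynomial[OF P[of j]]] by simp
  ultimately show ?thesis by (intro LIMSEQ_le_const) auto
qed

text \<open>The two parts of \<open>w\<close> on the open cube become the densities of
  \<open>M1\<close> and \<open>M2\<close>. On open sets \<open>M2\<close> is at most
  \<open>M1\<close>; outer regularity of the finite measure \<open>M1\<close> extends this to the
  Borel set \<open>N\<close> where the function is negative. There \<open>M1\<close> vanishes, so
  \<open>M2\<close> does too. The boundary of the cube is null.\<close>

lemma AE_nonneg_of_trig:
  fixes w :: "real^'n::finite \<Rightarrow> real"
  assumes int: "integrable lborel (\<lambda>t. indicator torus t * w t)"
    and wm [measurable]: "w \<in> borel_measurable borel"
    and pos: "\<And>q. trig q \<Longrightarrow> 0 \<le> (LINT t|lborel. (norm (q t))\<^sup>2 * (indicator torus t * w t))"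
  shows "AE t in lborel. t \<in> torus \<longrightarrow> 0 \<le> w t"
proof -
  let ?I = "torus_interior :: (real^'n) set"
  have oI: "open ?I" unfolding torus_interior_def by (rule open_box)
  then have [measurable]: "?I \<in> sets borel" by simp
  define f where "f t = indicator ?I t * w t" for t
  have [measurable]: "f \<in> borel_measurable borel" unfolding f_def by measurable
  have f: "integrable lborel f"
    using int by (rule Bochner_Integration.integrable_bound)
      (use torus_interior_subset in \<open>auto simp: f_def indicator_def\<close>)
  define M1 where "M1 = density lborel (\<lambda>t. ennreal (f t))"
  define M2 where "M2 = density lborel (\<lambda>t. ennreal (- f t))"
  have fin: "(\<integral>\<^sup>+t. ennreal (f t) \<partial>lborel) \<noteq> \<infinity>" "(\<integral>\<^sup>+t. ennreal (- f t) \<partial>lborel) \<noteq> \<infinity>"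
    using f unfolding real_integrable_def by auto
  have open_le: "emeasure M2 V \<le> emeasure M1 V" if V: "open V" for V
  proof -
    have [measurable]: "V \<in> sets borel" using V by simp
    let ?h = "\<lambda>t. indicator V t * f t"
    have h: "integrable lborel ?h" using f by (rule Bochner_Integration.integrable_bound) (auto simp: indicator_def)
    have eq: "indicator (V \<inter> ?I) t * w t = ?h t" for t by (simp add: f_def indicator_def)
    have "0 \<le> (LINT t|lborel. indicator (V \<inter> ?I) t * w t)"
      by (rule integral_open_nonneg[OF int pos]) (use V oI in auto)
    then have "0 \<le> (LINT t|lborel. ?h t)" unfolding eq .
    then have le: "enn2real (\<integral>\<^sup>+t. ennreal (- ?h t) \<partial>lborel) \<le> enn2real (\<integral>\<^sup>+t. ennreal (?h t) \<partial>lborel)"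
      unfolding real_lebesgue_integral_def[OF h] by simp
    have "(\<integral>\<^sup>+t. ennreal (- ?h t) \<partial>lborel) < top" "(\<integral>\<^sup>+t. ennreal (?h t) \<partial>lborel) < top"
      using h unfolding real_integrable_def by (auto simp: less_top)
    note fin = this[THEN ennreal_enn2real]
    have "(\<integral>\<^sup>+t. ennreal (- ?h t) \<partial>lborel) \<le> (\<integral>\<^sup>+t. ennreal (?h t) \<partial>lborel)"
      using ennreal_leI[OF le] unfolding fin .
    moreover have "(\<integral>\<^sup>+t. ennreal (- ?h t) \<partial>lborel) = emeasure M2 V" "(\<integral>\<^sup>+t. ennreal (?h t) \<partial>lborel) = emeasure M1 V"
      unfolding M1_def M2_def by (auto simp: emeasure_density intro!: nn_integral_cong split: split_indicator)
    ultimately show ?thesis by simp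
  qed
  define N where "N = {t. f t < 0}"
  have [measurable]: "N \<in> sets borel" unfolding N_def by measurable
  have "emeasure M2 N \<le> emeasure M1 N"
  proof -
    have sb: "sets M1 = sets borel" by (simp add: M1_def)
    have "emeasure M1 (space M1) = (\<integral>\<^sup>+t. ennreal (f t) \<partial>lborel)"
      unfolding M1_def by (simp add: emeasure_density)
    then have finM: "emeasure M1 (space M1) \<noteq> \<infinity>" using fin by simp
    have outer: "emeasure M1 N = (INF U \<in> {U. N \<subseteq> U \<and> open U}. emeasure M1 U)"
      by (rule outer_regular[OF sb finM]) measurable
    show ?thesis unfolding outer
    proof (rule INF_greatest)
      fix U assume U: "U \<in> {U. N \<subseteq> U \<and> open U}"
      have "emeasure M2 N \<le> emeasure M2 U" using U by (intro emeasure_mono) (auto simp: M2_def)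
      also have "\<dots> \<le> emeasure M1 U" using U by (intro open_le) auto
      finally show "emeasure M2 N \<le> emeasure M1 U" .
    qed
  qed
  also have "emeasure M1 N = 0"
    unfolding M1_def by (subst emeasure_density) (auto simp: N_def nn_integral_0_iff_AE ennreal_neg split: split_indicator)
  finally have "(\<integral>\<^sup>+t. ennreal (- f t) * indicator N t \<partial>lborel) = 0"
    unfolding M2_def by (simp add: emeasure_density)
  then have "AE t in lborel. ennreal (- f t) * indicator N t = 0"
    by (subst (asm) nn_integral_0_iff_AE) auto
  then show ?thesis using AE_torus_interior
  proof eventually_elim
    case (elim t)
    show ?case
    proof
      assume "t \<in> torus"
      then have t: "t \<in> ?I" using elim by blast
      show "0 \<le> w t"
      proof (rule ccontr)
        assume "\<not> 0 \<le> w t"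
        then have "f t < 0" using t by (simp add: f_def)
        then show False using elim(1) by (simp add: N_def indicator_def)
      qed
    qed
  qed
qed

section \<open>Range operators\<close>

context chilbert
begin

lemma cspan_cong:
  fixes E D :: "'p \<Rightarrow> 'v"
  shows "(\<And>p. p \<in> P \<Longrightarrow> E p = D p) \<Longrightarrow> cspan E P = cspan D P"
proof -
  have sub: "cspan E P \<subseteq> cspan D P" if eq: "\<And>p. p \<in> P \<Longrightarrow> E p = D p" for E D :: "'p \<Rightarrow> 'v"
  proof
    fix f assume f: "f \<in> cspan E P"
    have "\<exists>c M. finite M \<and> M \<subseteq> P \<and> nrm (f - (\<Sum>p\<in>M. c p *\<^sub>C D p)) < \<epsilon>" if pos: "\<epsilon> > 0" for \<epsilon>
    proof -
      obtain c M where M: "finite M" "M \<subseteq> P" "nrm (f - (\<Sum>p\<in>M. c p *\<^sub>C E p)) < \<epsilon>"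
        using cspan_approx[OF f pos] .
      moreover have "(\<Sum>p\<in>M. c p *\<^sub>C E p) = (\<Sum>p\<in>M. c p *\<^sub>C D p)"
        using M(2) eq by (intro sum.cong) auto
      ultimately show ?thesis by (intro exI[of _ c] exI[of _ M]) simp
    qed
    then show "f \<in> cspan D P" using f unfolding cspan_def by simp
  qed
  assume "\<And>p. p \<in> P \<Longrightarrow> E p = D p"
  then show ?thesis using sub[of E D] sub[of D E] by (simp add: subset_antisym)
qed

lemma usum_cong: "(\<And>p. p \<in> P \<Longrightarrow> E p = D p) \<Longrightarrow> usum E P f \<longleftrightarrow> usum D P f"
proof -
  assume eq: "\<And>p. p \<in> P \<Longrightarrow> E p = D p"
  have "sum E M = sum D M" if "M \<subseteq> P" for M
    using that eq by (intro sum.cong) auto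
  then show ?thesis unfolding usum_def
    by (intro conj_cong refl tendsto_cong eventually_finite_subsets_at_top_weakI) simp
qed

lemma nrm_sum_le: "(\<And>i. i \<in> M \<Longrightarrow> E i \<in> H) \<Longrightarrow> nrm (sum E M) \<le> (\<Sum>i\<in>M. nrm (E i))"
proof (induction M rule: infinite_finite_induct)
  case (insert i M)
  then have "nrm (E i + sum E M) \<le> nrm (E i) + nrm (sum E M)" by (intro nrm_triangle sum_in) auto
  then show ?case using insert by fastforce
qed auto

text \<open>The lower bound gives injectivity. For surjectivity, approximate solutions exist by
  density, the lower bound makes them a Cauchy sequence, and the upper bound identifies the image of
  their limit.\<close>

lemma bounded_below_bij:
  assumes E: "\<And>i. i \<in> I \<Longrightarrow> E i \<in> H"
    and R: "\<And>a. a \<in> cspan E I \<Longrightarrow> R a \<in> cspan E I"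
    and Radd: "\<And>a b. \<lbrakk>a \<in> cspan E I; b \<in> cspan E I\<rbrakk> \<Longrightarrow> R (a + b) = R a + R b"
    and Rscale: "\<And>c a. a \<in> cspan E I \<Longrightarrow> R (c *\<^sub>C a) = c *\<^sub>C R a"
    and bound: "\<And>a. a \<in> cspan E I \<Longrightarrow> nrm (R a) \<le> C * nrm a"
    and A: "0 < A" and below: "\<And>a. a \<in> cspan E I \<Longrightarrow> A * nrm a \<le> nrm (R a)"
    and onto: "\<And>i. i \<in> I \<Longrightarrow> \<exists>a\<in>cspan E I. R a = E i"
  shows "bij_betw R (cspan E I) (cspan E I)"
proof -
  let ?J = "cspan E I"
  have sub: "subspace ?J" by (rule subspace_cspan[OF E])
  have Jdiff: "a - b \<in> ?J" if "a \<in> ?J" "b \<in> ?J" for a b using sub that by (rule subspace_diff)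
  have Rdiff: "R (a - b) = R a - R b" if "a \<in> ?J" "b \<in> ?J" for a b
    using Radd[OF Jdiff[OF that] that(2)] by simp
  have inj: "inj_on R ?J"
  proof (rule inj_onI)
    fix x y assume x: "x \<in> ?J" and y: "y \<in> ?J" and eq: "R x = R y"
    have "A * nrm (x - y) \<le> 0" using below[OF Jdiff[OF x y]] eq by (simp add: Rdiff x y)
    then have "nrm (x - y) \<le> 0" using A by (simp add: mult_le_0_iff)
    moreover have "0 \<le> nrm (x - y)" using x y by simp
    ultimately have "nrm (x - y) = 0" by linarith
    then show "x = y" using nrm_eq_0[of "x - y"] x y by simp
  qed
  \<comment> \<open>Combinations of chosen preimages of the generators are mapped exactly to the
    corresponding combinations of generators, so the range of \<open>R\<close> is dense.\<close>
  obtain e where e: "\<And>i. i \<in> I \<Longrightarrow> e i \<in> ?J \<and> R (e i) = E i" using onto by metis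
  have comb: "(\<Sum>i\<in>M. c i *\<^sub>C e i) \<in> ?J \<and> R (\<Sum>i\<in>M. c i *\<^sub>C e i) = (\<Sum>i\<in>M. c i *\<^sub>C E i)"
    if "finite M" "M \<subseteq> I" for c M
    using that
  proof (induction M rule: finite_induct)
    case empty
    have z: "0 \<in> ?J" using sub by (rule subspace_0)
    then show ?case using Rscale[OF z, of 0] by simp
  next
    case (insert i M)
    have i: "c i *\<^sub>C e i \<in> ?J" using e[of i] insert.prems by (intro subspace_scale[OF sub]) simp
    then show ?case using insert e[of i] by (auto simp: Radd Rscale intro: subspace_add[OF sub])
  qed
  have surj: "\<exists>x\<in>?J. R x = b" if b: "b \<in> ?J" for b
  proof -
    have bH: "b \<in> H" using b by simp
    have "\<exists>x\<in>?J. nrm (R x - b) < inverse (real (Suc n))" for n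
    proof -
      have pos: "0 < inverse (real (Suc n))" by simp
      obtain c M where M: "finite M" "M \<subseteq> I" "nrm (b - (\<Sum>i\<in>M. c i *\<^sub>C E i)) < inverse (real (Suc n))"
        using cspan_approx[OF b pos] .
      note cM = comb[OF M(1,2), of c]
      have "(\<Sum>i\<in>M. c i *\<^sub>C E i) \<in> H" using M(2) E by (intro sum_in) auto
      then show ?thesis using M(3) cM nrm_minus_commute[OF bH] by (intro bexI[of _ "\<Sum>i\<in>M. c i *\<^sub>C e i"]) auto
    qed
    then obtain x where x: "\<And>n. x n \<in> ?J" "\<And>n. nrm (R (x n) - b) < inverse (real (Suc n))" by metis
    have xH: "x n \<in> H" and RxH: "R (x n) \<in> H" for n using x(1) R cspan_in_H by blast+
    have "\<exists>y\<in>H. (\<lambda>n. nrm (x n - y)) \<longlonglongrightarrow> 0"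
    proof (rule complete[OF xH])
      fix \<epsilon> :: real assume "\<epsilon> > 0"
      then obtain m where m: "inverse (real (Suc m)) < A * \<epsilon> / 2" using reals_Archimedean[of "A * \<epsilon> / 2"] A by auto
      have "nrm (x i - x j) < \<epsilon>" if "i \<ge> m" "j \<ge> m" for i j
      proof -
        have "inverse (real (Suc i)) \<le> inverse (real (Suc m))" "inverse (real (Suc j)) \<le> inverse (real (Suc m))"
          using that by (auto intro!: le_imp_inverse_le)
        moreover have "nrm (R (x i) - R (x j)) \<le> nrm (R (x i) - b) + nrm (R (x j) - b)"
          using nrm_triangle_via[OF RxH bH RxH, of i j] nrm_minus_commute[OF bH RxH, of j] by simp
        ultimately have "nrm (R (x i) - R (x j)) < A * \<epsilon>" using x(2)[of i] x(2)[of j] m by linarith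
        then have "A * nrm (x i - x j) < A * \<epsilon>" using below[OF Jdiff[OF x(1) x(1)], of i j] by (simp add: Rdiff x(1))
        then show ?thesis using A by simp
      qed
      then show "\<exists>m. \<forall>i\<ge>m. \<forall>j\<ge>m. nrm (x i - x j) < \<epsilon>" by blast
    qed
    then obtain y where y: "y \<in> H" "(\<lambda>n. nrm (x n - y)) \<longlonglongrightarrow> 0" by blast
    have yJ: "y \<in> ?J"
    proof (rule cspan_closed[OF E y(1)])
      fix \<epsilon> :: real assume "\<epsilon> > 0"
      from order_tendstoD(2)[OF y(2) this] obtain n where "nrm (x n - y) < \<epsilon>"
        using eventually_happens'[OF sequentially_bot] by blast
      then show "\<exists>g\<in>?J. nrm (y - g) < \<epsilon>" using x(1) nrm_minus_commute[OF y(1) xH] by metis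
    qed
    have RyH: "R y \<in> H" using R[OF yJ] by simp
    have "nrm (R y - b) \<le> C * nrm (x n - y) + inverse (real (Suc n))" for n
    proof -
      have "nrm (R y - R (x n)) \<le> C * nrm (y - x n)"
        using bound[OF Jdiff[OF yJ x(1)], of n] by (simp add: Rdiff yJ x(1))
      then show ?thesis using nrm_triangle_via[OF RyH RxH bH, of n] x(2)[of n] nrm_minus_commute[OF y(1) xH, of n] by simp
    qed
    moreover have "(\<lambda>n. C * nrm (x n - y) + inverse (real (Suc n))) \<longlonglongrightarrow> C * 0 + 0"
      by (intro tendsto_intros y(2) LIMSEQ_inverse_real_of_nat)
    ultimately have "nrm (R y - b) \<le> C * 0 + 0" by (intro LIMSEQ_le_const) auto
    moreover have "0 \<le> nrm (R y - b)" using RyH bH by simp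
    ultimately have "nrm (R y - b) = 0" by linarith
    then have "R y = b" using nrm_eq_0[of "R y - b"] RyH bH by simp
    then show ?thesis using yJ by blast
  qed
  then show ?thesis using inj R by (auto simp: bij_betw_def image_iff)
qed

end

definition crat :: "rat \<times> rat \<Rightarrow> complex" where
  "crat q = Complex (of_rat (fst q)) (of_rat (snd q))"

lemma crat_dense: "d > 0 \<Longrightarrow> \<exists>q. norm (z - crat q) < d"
proof -
  assume d: "d > 0"
  obtain p q :: rat where p: "Re z - d/2 < of_rat p" "of_rat p < Re z" and q: "Im z - d/2 < of_rat q" "of_rat q < Im z"
    using of_rat_dense[of "Re z - d/2" "Re z"] of_rat_dense[of "Im z - d/2" "Im z"] d by auto
  have "norm (z - crat (p, q)) \<le> \<bar>Re (z - crat (p, q))\<bar> + \<bar>Im (z - crat (p, q))\<bar>" by (rule cmod_le)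
  also have "\<dots> < d" using p q by (simp add: crat_def)
  finally show ?thesis by blast
qed

context chilbert
begin

text \<open>Entry \<open>i\<close> of the list is the coefficient of \<open>E i\<close>, and
  positions outside \<open>I\<close> are skipped. Lists of pairs of rationals form a countable type,
  so statements about all such combinations can be made off one null set.\<close>

definition rat_comb :: "nat set \<Rightarrow> (nat \<Rightarrow> 'v) \<Rightarrow> (rat \<times> rat) list \<Rightarrow> 'v" where
  "rat_comb I E xs = (\<Sum>i\<in>I \<inter> {..<length xs}. crat (xs ! i) *\<^sub>C E i)"

lemma rat_comb_in_cspan: "(\<And>i. i \<in> I \<Longrightarrow> E i \<in> H) \<Longrightarrow> rat_comb I E xs \<in> cspan E I"
  unfolding rat_comb_def by (rule comb_in_cspan) auto

lemma rat_comb_dense: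
  assumes E: "\<And>i. i \<in> I \<Longrightarrow> E i \<in> H" and a: "a \<in> cspan E I" and "\<epsilon> > 0"
  shows "\<exists>xs. nrm (a - rat_comb I E xs) < \<epsilon>"
proof -
  have "\<epsilon> / 2 > 0" using assms(3) by simp
  obtain c M where M: "finite M" "M \<subseteq> I" "nrm (a - (\<Sum>i\<in>M. c i *\<^sub>C E i)) < \<epsilon> / 2"
    using cspan_approx[OF a \<open>\<epsilon> / 2 > 0\<close>] .
  obtain n where n: "M \<subseteq> {..<n}" using M(1) finite_nat_iff_bounded by blast
  let ?K = "I \<inter> {..<n}"
  define N where "N = (\<Sum>i\<in>?K. nrm (E i))"
  have N: "N \<ge> 0" unfolding N_def by (intro sum_nonneg) (simp add: E)
  \<comment> \<open>The total norm \<open>N\<close> may be 0; adding 1 makes it a legitimate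
    divisor.\<close>
  define K where "K = N + 1"
  have K: "K > 0" "N \<le> K" using N by (simp_all add: K_def)
  define d where "d = \<epsilon> / (2 * K)"
  have d: "d > 0" using assms(3) K by (simp add: d_def)
  \<comment> \<open>A list prescribes coefficients for every index of \<open>I\<close> below
    \<open>n\<close>, so those outside \<open>M\<close> are set to 0 before being approximated by
    rationals.\<close>
  define c' where "c' i = (if i \<in> M then c i else 0)" for i
  have "\<forall>i. \<exists>q. norm (c' i - crat q) < d" using crat_dense[OF d] by blast
  then obtain q where q: "\<And>i. norm (c' i - crat (q i)) < d" by metis
  define xs where "xs = map q [0..<n]"
  have xs: "rat_comb I E xs = (\<Sum>i\<in>?K. crat (q i) *\<^sub>C E i)"
    unfolding rat_comb_def xs_def by (rule sum.cong) auto
  have cM: "(\<Sum>i\<in>M. c i *\<^sub>C E i) = (\<Sum>i\<in>?K. c' i *\<^sub>C E i)"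
    unfolding c'_def using M n by (intro sum.mono_neutral_cong_left) auto
  have in1: "(\<Sum>i\<in>?K. c' i *\<^sub>C E i) \<in> H" "(\<Sum>i\<in>?K. crat (q i) *\<^sub>C E i) \<in> H" using E by (auto intro!: sum_in)
  have "(\<Sum>i\<in>?K. c' i *\<^sub>C E i) - (\<Sum>i\<in>?K. crat (q i) *\<^sub>C E i) = (\<Sum>i\<in>?K. (c' i - crat (q i)) *\<^sub>C E i)"
    by (simp add: sum_subtractf scale_left_diff_distrib)
  also have "nrm \<dots> \<le> (\<Sum>i\<in>?K. nrm ((c' i - crat (q i)) *\<^sub>C E i))" using E by (intro nrm_sum_le) auto
  also have "\<dots> \<le> (\<Sum>i\<in>?K. d * nrm (E i))"
  proof (rule sum_mono)
    fix i assume "i \<in> ?K"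
    then have "E i \<in> H" using E by blast
    then show "nrm ((c' i - crat (q i)) *\<^sub>C E i) \<le> d * nrm (E i)"
      unfolding nrm_scale[OF \<open>E i \<in> H\<close>] by (intro mult_right_mono less_imp_le[OF q] nrm_ge_0)
  qed
  also have "\<dots> = d * N" by (simp add: N_def sum_distrib_left)
  also have "\<dots> \<le> d * K" using d K by simp
  also have "\<dots> = \<epsilon> / 2" using K by (simp add: d_def)
  finally have "nrm ((\<Sum>i\<in>?K. c' i *\<^sub>C E i) - (\<Sum>i\<in>?K. crat (q i) *\<^sub>C E i)) \<le> \<epsilon> / 2" .
  moreover have "a \<in> H" using a by simp
  ultimately have "nrm (a - rat_comb I E xs) < \<epsilon>"
    using nrm_triangle_via[of a "\<Sum>i\<in>?K. c' i *\<^sub>C E i" "\<Sum>i\<in>?K. crat (q i) *\<^sub>C E i"] in1 M(3)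
    unfolding xs cM by linarith
  then show ?thesis by blast
qed

lemma bounded_below_of_rat_comb:
  assumes E: "\<And>i. i \<in> I \<Longrightarrow> E i \<in> H"
    and R: "\<And>a. a \<in> cspan E I \<Longrightarrow> R a \<in> cspan E I"
    and Radd: "\<And>a b. \<lbrakk>a \<in> cspan E I; b \<in> cspan E I\<rbrakk> \<Longrightarrow> R (a + b) = R a + R b"
    and bound: "\<And>a. a \<in> cspan E I \<Longrightarrow> nrm (R a) \<le> C * nrm a"
    and below: "\<And>xs. A * nrm (rat_comb I E xs) \<le> nrm (R (rat_comb I E xs))"
    and A: "0 < A" and a: "a \<in> cspan E I"
  shows "A * nrm a \<le> nrm (R a)"
proof (rule field_le_epsilon)
  fix \<epsilon> :: real assume \<epsilon>: "\<epsilon> > 0"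
  \<comment> \<open>The approximation error enters once with factor \<open>A\<close>, through the
    norm of \<open>a\<close>, and once with factor at most |C|, through the image of
    \<open>a - ?x\<close>. The absolute value is taken because the sign of \<open>C\<close> is not
    prescribed.\<close>
  define d where "d = \<epsilon> / (A + \<bar>C\<bar> + 1)"
  have d: "d > 0" using \<epsilon> A by (simp add: d_def add_pos_nonneg)
  obtain xs where xs: "nrm (a - rat_comb I E xs) < d" using rat_comb_dense[OF E a d] by blast
  let ?x = "rat_comb I E xs"
  have x: "?x \<in> cspan E I" by (rule rat_comb_in_cspan[OF E])
  have ax: "a - ?x \<in> cspan E I" using subspace_cspan[OF E] a x by (rule subspace_diff)
  have H: "a \<in> H" "?x \<in> H" "R a \<in> H" "R ?x \<in> H" "a - ?x \<in> H" "R (a - ?x) \<in> H"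
    using a x ax R cspan_in_H by blast+
  have "R a = R ?x + R (a - ?x)" using Radd[OF x ax] by simp
  then have "nrm (R ?x) \<le> nrm (R a) + nrm (R (a - ?x))"
    using nrm_triangle_diff[of "R ?x" "R a"] H nrm_scale[of "R (a - ?x)" "- 1"] by simp
  moreover have "nrm (R (a - ?x)) \<le> \<bar>C\<bar> * d"
  proof -
    have "nrm (R (a - ?x)) \<le> C * nrm (a - ?x)" by (rule bound[OF ax])
    also have "\<dots> \<le> \<bar>C\<bar> * nrm (a - ?x)" using H by (intro mult_right_mono) auto
    also have "\<dots> \<le> \<bar>C\<bar> * d" using xs by (intro mult_left_mono) auto
    finally show ?thesis .
  qed
  moreover have "A * nrm a \<le> A * (d + nrm ?x)"
    using nrm_triangle_diff[of a ?x] H xs A by (intro mult_left_mono) auto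
  moreover have "A * (d + nrm ?x) = A * d + A * nrm ?x" by (simp add: distrib_left)
  ultimately have "A * nrm a \<le> nrm (R a) + (A * d + \<bar>C\<bar> * d)" using below[of xs] by linarith
  also have "A * d + \<bar>C\<bar> * d \<le> (A + \<bar>C\<bar> + 1) * d" using d by (simp add: algebra_simps)
  also have "\<dots> = \<epsilon>" using A by (simp add: d_def add_pos_nonneg less_imp_neq[symmetric])
  finally show "A * nrm a \<le> nrm (R a) + \<epsilon>" by simp
qed

end

section \<open>Fibers of combinations and of elements of the shift space\<close>

lemma fiber_zero: "AE t in lborel. fiber s 0 t = 0"
proof -
  interpret chilbert fscale "sobolev s" "sobolev_inner s" "sobolev_norm s" by (rule chilbert_sobolev)
  have z: "fscale 0 g = 0" for g :: "'x \<Rightarrow> complex" by (simp add: fscale_def fun_eq_iff)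
  show ?thesis using fiber_scale[OF zero_in, of 0] by (simp only: z)
qed

lemma fiber_sum:
  assumes "finite M" "\<And>p. p \<in> M \<Longrightarrow> E p \<in> sobolev s"
  shows "AE t in lborel. fiber s (sum E M) t = (\<Sum>p\<in>M. fiber s (E p) t)"
  using assms
proof (induction M rule: finite_induct)
  case empty
  show ?case unfolding sum.empty by (rule fiber_zero)
next
  case (insert p M)
  interpret chilbert fscale "sobolev s" "sobolev_inner s" "sobolev_norm s" by (rule chilbert_sobolev)
  have "AE t in lborel. fiber s (E p + sum E M) t = fiber s (E p) t + fiber s (sum E M) t"
    using insert.prems by (intro fiber_add sum_in) auto
  moreover have "AE t in lborel. fiber s (sum E M) t = (\<Sum>p\<in>M. fiber s (E p) t)" using insert by simp
  ultimately show ?case unfolding sum.insert[OF insert.hyps] by eventually_elim (simp only:)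
qed

lemma fiber_comb:
  assumes "finite M" "\<And>p. p \<in> M \<Longrightarrow> E p \<in> sobolev s"
  shows "AE t in lborel. fiber s (\<Sum>p\<in>M. fscale (c p) (E p)) t = (\<Sum>p\<in>M. fscale (c p) (fiber s (E p) t))"
proof -
  interpret chilbert fscale "sobolev s" "sobolev_inner s" "sobolev_norm s" by (rule chilbert_sobolev)
  have "AE t in lborel. fiber s (\<Sum>p\<in>M. fscale (c p) (E p)) t = (\<Sum>p\<in>M. fiber s (fscale (c p) (E p)) t)"
    using assms by (intro fiber_sum) auto
  moreover have "AE t in lborel. \<forall>p\<in>M. fiber s (fscale (c p) (E p)) t = fscale (c p) (fiber s (E p) t)"
    using assms by (intro AE_finite_allI fiber_scale) auto
  ultimately show ?thesis by eventually_elim simp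
qed

lemma fiber_trig:
  assumes g: "g \<in> sobolev s" and M: "finite M"
  shows "AE t in lborel. fiber s (\<Sum>k\<in>M. fscale (p k) (translate k g)) t =
    fscale (\<Sum>k\<in>M. p k * ee t (ivec k)) (fiber s g t)"
proof -
  have "AE t in lborel. fiber s (\<Sum>k\<in>M. fscale (p k) (translate k g)) t = (\<Sum>k\<in>M. fscale (p k) (fiber s (translate k g) t))"
    using M sobolev_translate(1)[OF g] by (intro fiber_comb) auto
  moreover have "AE t in lborel. \<forall>k\<in>M. fiber s (translate k g) t = fscale (ee t (ivec k)) (fiber s g t)"
    using M by (intro AE_finite_allI fiber_translate[OF g]) auto
  ultimately show ?thesis
    by eventually_elim (simp add: fun_eq_iff sum_fun_apply fscale_def sum_distrib_right mult.assoc)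
qed

lemma fiber_energy_fscale:
  assumes "fiber s f t = fscale z (fiber s g t)"
  shows "fiber_energy s f t = ennreal ((norm z)\<^sup>2) * fiber_energy s g t"
  unfolding fiber_energy_def assms
  by (subst nn_integral_cmult[symmetric])
     (auto simp: fscale_def norm_mult power_mult_distrib ennreal_mult'[symmetric] mult_ac intro!: nn_integral_cong)

lemma fiber_energy_integral:
  assumes f: "f \<in> sobolev s"
  shows "integrable lborel (\<lambda>t. indicator torus t * enn2real (fiber_energy s f t))"
    and "(LINT t|lborel. indicator torus t * enn2real (fiber_energy s f t)) = (sobolev_norm s f)\<^sup>2"
proof -
  note [measurable] = fiber_energy_measurable[OF f]
  have "AE t in lborel. t \<in> torus \<longrightarrow> fiber_energy s f t < top"
    using fiber_in_l2s[OF f] by eventually_elim auto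
  then have "(\<integral>\<^sup>+t. ennreal (indicator torus t * enn2real (fiber_energy s f t)) \<partial>lborel) =
      (\<integral>\<^sup>+t. indicator torus t * fiber_energy s f t \<partial>lborel)"
  proof (intro nn_integral_cong_AE, eventually_elim)
    case (elim t)
    then show ?case by (cases "t \<in> torus") (auto simp: ennreal_enn2real)
  qed
  then have eq: "(\<integral>\<^sup>+t. ennreal (indicator torus t * enn2real (fiber_energy s f t)) \<partial>lborel) = ennreal ((sobolev_norm s f)\<^sup>2)"
    by (simp add: fiber_isometry[OF f])
  show int: "integrable lborel (\<lambda>t. indicator torus t * enn2real (fiber_energy s f t))"
    by (rule integrableI_nonneg) (auto simp: eq)
  show "(LINT t|lborel. indicator torus t * enn2real (fiber_energy s f t)) = (sobolev_norm s f)\<^sup>2"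
    by (subst integral_eq_nn_integral) (auto simp: eq)
qed

text \<open>Applying a trigonometric polynomial in the translations multiplies the fibers by its value
  \<open>q t\<close>, so the hypothesis says that \<open>\<parallel>fiber h\<parallel>\<^sup>2 - A\<^sup>2 \<parallel>fiber g\<parallel>\<^sup>2\<close> has a nonnegative integral against
  every weight \<open>|q|\<^sup>2\<close>.\<close>

lemma fiber_lower_bound:
  assumes g: "g \<in> sobolev s" and h: "h \<in> sobolev s" and A: "0 \<le> A"
    and below: "\<And>M p. finite M \<Longrightarrow> A * sobolev_norm s (\<Sum>k\<in>M. fscale (p k) (translate k g)) \<le>
      sobolev_norm s (\<Sum>k\<in>M. fscale (p k) (translate k h))"
  shows "AE t in lborel. t \<in> torus \<longrightarrow> A * l2s_norm s (fiber s g t) \<le> l2s_norm s (fiber s h t)"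
proof -
  interpret sob: chilbert fscale "sobolev s" "sobolev_inner s" "sobolev_norm s" by (rule chilbert_sobolev)
  interpret l2: chilbert fscale "l2s s" "l2s_inner s" "l2s_norm s" by (rule chilbert_l2s)
  \<comment> \<open>\<open>enn2real\<close> sends an infinite energy to 0; on the torus this happens
    only on a null set.\<close>
  let ?G = "\<lambda>t. enn2real (fiber_energy s g t)" and ?H = "\<lambda>t. enn2real (fiber_energy s h t)"
  define w where "w t = ?H t - A\<^sup>2 * ?G t" for t
  have [measurable]: "fiber_energy s g \<in> borel_measurable borel" "fiber_energy s h \<in> borel_measurable borel"
    using g h by (auto intro: fiber_energy_measurable)
  have w_eq: "indicator torus t * w t = indicator torus t * ?H t - A\<^sup>2 * (indicator torus t * ?G t)" for t
    by (simp add: w_def algebra_simps)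
  have iw: "integrable lborel (\<lambda>t. indicator torus t * w t)"
    unfolding w_eq by (intro Bochner_Integration.integrable_diff integrable_mult_right fiber_energy_integral(1) g h)
  have "AE t in lborel. t \<in> torus \<longrightarrow> 0 \<le> w t"
  proof (rule AE_nonneg_of_trig[OF iw])
    show "w \<in> borel_measurable borel" unfolding w_def by measurable
    fix q :: "real^'a \<Rightarrow> complex" assume "trig q"
    then obtain M p where M: "finite M" and q: "q = (\<lambda>t. \<Sum>k\<in>M. p k * ee t (ivec k))" using trig_form by blast
    have energy: "integrable lborel (\<lambda>t. (norm (q t))\<^sup>2 * (indicator torus t * enn2real (fiber_energy s f t)))"
      "(LINT t|lborel. (norm (q t))\<^sup>2 * (indicator torus t * enn2real (fiber_energy s f t))) =
        (sobolev_norm s (\<Sum>k\<in>M. fscale (p k) (translate k f)))\<^sup>2" if f: "f \<in> sobolev s" for f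
    proof -
      let ?f = "\<Sum>k\<in>M. fscale (p k) (translate k f)"
      have f': "?f \<in> sobolev s" using sobolev_translate(1)[OF f] by (intro sob.sum_in) auto
      note [measurable] = fiber_energy_measurable[OF f] fiber_energy_measurable[OF f']
      have [measurable]: "q \<in> borel_measurable borel" unfolding q by measurable
      have [measurable]: "(\<lambda>t::real^'a. indicator torus t :: real) \<in> borel_measurable borel"
        by (rule borel_measurable_indicator[OF torus_measurable])
      have m: "(\<lambda>t. (norm (q t))\<^sup>2 * (indicator torus t * enn2real (fiber_energy s f t))) \<in> borel_measurable lborel"
        "(\<lambda>t. indicator torus t * enn2real (fiber_energy s ?f t)) \<in> borel_measurable lborel"
        by measurable
      have "AE t in lborel. indicator torus t * enn2real (fiber_energy s ?f t) =
          (norm (q t))\<^sup>2 * (indicator torus t * enn2real (fiber_energy s f t))"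
        using fiber_trig[OF f M, of p]
        by eventually_elim (simp add: fiber_energy_fscale enn2real_mult q)
      note ae = this
      show "integrable lborel (\<lambda>t. (norm (q t))\<^sup>2 * (indicator torus t * enn2real (fiber_energy s f t)))"
        by (rule integrable_cong_AE_imp[OF fiber_energy_integral(1)[OF f'] m(1)]) (rule ae)
      have "(LINT t|lborel. (norm (q t))\<^sup>2 * (indicator torus t * enn2real (fiber_energy s f t))) =
          (LINT t|lborel. indicator torus t * enn2real (fiber_energy s ?f t))"
        by (rule integral_cong_AE[OF m]) (use ae in eventually_elim, erule sym)
      then show "(LINT t|lborel. (norm (q t))\<^sup>2 * (indicator torus t * enn2real (fiber_energy s f t))) =
        (sobolev_norm s ?f)\<^sup>2" using fiber_energy_integral(2)[OF f'] by simp
    qed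
    have "(norm (q t))\<^sup>2 * (indicator torus t * w t) =
        (norm (q t))\<^sup>2 * (indicator torus t * ?H t) - A\<^sup>2 * ((norm (q t))\<^sup>2 * (indicator torus t * ?G t))" for t
      by (simp add: w_def algebra_simps)
    then have "(LINT t|lborel. (norm (q t))\<^sup>2 * (indicator torus t * w t)) =
        (sobolev_norm s (\<Sum>k\<in>M. fscale (p k) (translate k h)))\<^sup>2 - A\<^sup>2 * (sobolev_norm s (\<Sum>k\<in>M. fscale (p k) (translate k g)))\<^sup>2"
      using energy[OF g] energy[OF h] by simp
    moreover have "(A * sobolev_norm s (\<Sum>k\<in>M. fscale (p k) (translate k g)))\<^sup>2 \<le>
        (sobolev_norm s (\<Sum>k\<in>M. fscale (p k) (translate k h)))\<^sup>2"
      using below[OF M, of p] A sobolev_translate(1)[OF g]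
      by (intro power_mono mult_nonneg_nonneg sob.nrm_ge_0 sob.sum_in) auto
    ultimately show "0 \<le> (LINT t|lborel. (norm (q t))\<^sup>2 * (indicator torus t * w t))"
      by (simp add: power_mult_distrib)
  qed
  then show ?thesis using fiber_in_l2s[OF g] fiber_in_l2s[OF h]
  proof eventually_elim
    case (elim t)
    show ?case
    proof
      assume t: "t \<in> torus"
      have G: "?G t = (l2s_norm s (fiber s g t))\<^sup>2" and H: "?H t = (l2s_norm s (fiber s h t))\<^sup>2"
        using elim t by auto
      have "(A * l2s_norm s (fiber s g t))\<^sup>2 \<le> (l2s_norm s (fiber s h t))\<^sup>2"
        using elim(1) t unfolding w_def G H by (simp add: power_mult_distrib)
      then show "A * l2s_norm s (fiber s g t) \<le> l2s_norm s (fiber s h t)"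
        by (rule power2_le_imp_le) (use elim t in simp)
    qed
  qed
qed

lemma range_fun_eq: "range_fun s I \<phi> t = chilbert.cspan fscale (l2s s) (l2s_norm s) (\<lambda>i. fiber s (\<phi> i) t) I"
  unfolding range_fun_def by (rule closed_span_l2s)

lemma shift_space_eq: "shift_space s I \<phi> = chilbert.cspan fscale (sobolev s) (sobolev_norm s) (shifts \<phi>) (UNIV \<times> I)"
  unfolding shift_space_def by (rule closed_span_sobolev)

lemma shifts_in_sobolev: "\<lbrakk>\<forall>i\<in>I. \<phi> i \<in> sobolev s; p \<in> UNIV \<times> I\<rbrakk> \<Longrightarrow> shifts \<phi> p \<in> sobolev s"
  unfolding shifts_def by (auto simp: sobolev_translate(1))

text \<open>Finite combinations of shifts approximate \<open>f\<close> at rate 2^-n. By the fiber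
  isometry the squared fiber errors have a summable integral over the torus, so almost everywhere
  they tend to 0 along the whole sequence, and the fiber of \<open>f\<close> is a limit of vectors
  of the closed fiber space.\<close>

lemma fiber_in_range_fun:
  assumes \<phi>: "\<forall>i\<in>I. \<phi> i \<in> sobolev s" and f: "f \<in> shift_space s I \<phi>"
  shows "AE t in lborel. t \<in> torus \<longrightarrow> fiber s f t \<in> range_fun s I \<phi> t"
proof -
  interpret sob: chilbert fscale "sobolev s" "sobolev_inner s" "sobolev_norm s" by (rule chilbert_sobolev)
  interpret l2: chilbert fscale "l2s s" "l2s_inner s" "l2s_norm s" by (rule chilbert_l2s)
  have E: "shifts \<phi> p \<in> sobolev s" if "p \<in> UNIV \<times> I" for p using shifts_in_sobolev[OF \<phi> that] .
  have fS: "f \<in> sob.cspan (shifts \<phi>) (UNIV \<times> I)" using f by (simp add: shift_space_eq)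
  then have fH: "f \<in> sobolev s" by simp
  have "\<forall>n::nat. \<exists>x. finite (snd x) \<and> snd x \<subseteq> UNIV \<times> I \<and>
      sobolev_norm s (f - (\<Sum>p\<in>snd x. fscale (fst x p) (shifts \<phi> p))) < (1/2) ^ n"
  proof
    fix n :: nat
    have pos: "0 < (1/2 :: real) ^ n" by simp
    obtain c M where "finite M" "M \<subseteq> UNIV \<times> I" "sobolev_norm s (f - (\<Sum>p\<in>M. fscale (c p) (shifts \<phi> p))) < (1/2) ^ n"
      using sob.cspan_approx[OF fS pos] .
    then show "\<exists>x. finite (snd x) \<and> snd x \<subseteq> UNIV \<times> I \<and>
        sobolev_norm s (f - (\<Sum>p\<in>snd x. fscale (fst x p) (shifts \<phi> p))) < (1/2) ^ n"
      by (intro exI[of _ "(c, M)"]) simp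
  qed
  from choice[OF this] obtain X where X: "\<forall>n::nat. finite (snd (X n)) \<and> snd (X n) \<subseteq> UNIV \<times> I \<and>
      sobolev_norm s (f - (\<Sum>p\<in>snd (X n). fscale (fst (X n) p) (shifts \<phi> p))) < (1/2) ^ n" ..
  define c where "c n = fst (X n)" for n
  define M where "M n = snd (X n)" for n
  have M: "finite (M n)" "M n \<subseteq> UNIV \<times> I"
    and close: "sobolev_norm s (f - (\<Sum>p\<in>M n. fscale (c n p) (shifts \<phi> p))) < (1/2) ^ n" for n
    using X by (auto simp: c_def M_def)
  define g where "g n = (\<Sum>p\<in>M n. fscale (c n p) (shifts \<phi> p))" for n
  have gH: "g n \<in> sobolev s" for n unfolding g_def using E M(2) by (intro sob.sum_in sob.scale_in) blast
  have dH: "f - g n \<in> sobolev s" for n using fH gH by simp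
  note [measurable] = fiber_energy_measurable[OF dH]
  have "(\<integral>\<^sup>+t. (\<Sum>n. indicator torus t * fiber_energy s (f - g n) t) \<partial>lborel) =
      (\<Sum>n. \<integral>\<^sup>+t. indicator torus t * fiber_energy s (f - g n) t \<partial>lborel)"
    by (rule nn_integral_suminf) measurable
  also have "\<dots> = (\<Sum>n. ennreal ((sobolev_norm s (f - g n))\<^sup>2))" by (simp add: fiber_isometry[OF dH])
  also have "\<dots> \<le> (\<Sum>n. ennreal ((1/4) ^ n))"
  proof (intro suminf_le ennreal_leI)
    fix n
    have "(sobolev_norm s (f - g n))\<^sup>2 \<le> ((1/2) ^ n)\<^sup>2"
      using close[of n] dH[of n] by (intro power_mono) (auto simp: g_def less_imp_le)
    also have "\<dots> = ((1/2)\<^sup>2) ^ n" by (simp only: power_mult[symmetric] mult.commute)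
    also have "\<dots> = (1/4) ^ n" by (simp add: power2_eq_square)
    finally show "(sobolev_norm s (f - g n))\<^sup>2 \<le> (1/4) ^ n" .
  qed auto
  also have "\<dots> = ennreal (\<Sum>n. (1/4) ^ n)" by (intro suminf_ennreal2) (auto simp: summable_geometric)
  also have "\<dots> < \<infinity>" by simp
  finally have fin: "AE t in lborel. (\<Sum>n. indicator torus t * fiber_energy s (f - g n) t) \<noteq> \<infinity>"
    by (intro nn_integral_PInf_AE) auto
  have a1: "AE t in lborel. \<forall>n. t \<in> torus \<longrightarrow> fiber s (f - g n) t \<in> l2s s \<and>
      fiber_energy s (f - g n) t = ennreal ((l2s_norm s (fiber s (f - g n) t))\<^sup>2)"
    by (subst AE_all_countable, intro allI fiber_in_l2s[OF dH])
  have a2: "AE t in lborel. \<forall>n. fiber s f t = fiber s (f - g n) t + fiber s (g n) t"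
    unfolding AE_all_countable
  proof
    fix n
    show "AE t in lborel. fiber s f t = fiber s (f - g n) t + fiber s (g n) t"
      using fiber_add[OF dH[of n] gH[of n]] by simp
  qed
  have a3: "AE t in lborel. \<forall>n. fiber s (g n) t = (\<Sum>p\<in>M n. fscale (c n p) (fiber s (shifts \<phi> p) t))"
    unfolding AE_all_countable g_def using M E by (intro allI fiber_comb) blast+
  \<comment> \<open>A shift acts on fibers by a scalar, so the fibers of all shifts lie in the span
    of the fibers of the generators alone.\<close>
  have a4: "AE t in lborel. \<forall>p\<in>UNIV \<times> I. fiber s (shifts \<phi> p) t = fscale (ee t (ivec (fst p))) (fiber s (\<phi> (snd p)) t)"
  proof (subst AE_ball_countable)
    show "countable (UNIV \<times> I :: ((int^'a) \<times> nat) set)" by simp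
    show "\<forall>p\<in>UNIV \<times> I. AE t in lborel. fiber s (shifts \<phi> p) t = fscale (ee t (ivec (fst p))) (fiber s (\<phi> (snd p)) t)"
      using \<phi> by (auto simp: shifts_def intro: fiber_translate)
  qed
  have a5: "AE t in lborel. \<forall>i\<in>I. t \<in> torus \<longrightarrow> fiber s (\<phi> i) t \<in> l2s s"
  proof (subst AE_ball_countable)
    show "\<forall>i\<in>I. AE t in lborel. t \<in> torus \<longrightarrow> fiber s (\<phi> i) t \<in> l2s s"
    proof
      fix i assume "i \<in> I"
      then have "\<phi> i \<in> sobolev s" using \<phi> by blast
      from fiber_in_l2s[OF this] show "AE t in lborel. t \<in> torus \<longrightarrow> fiber s (\<phi> i) t \<in> l2s s"
        by eventually_elim auto
    qed
  qed simp
  show ?thesis using fin a1 a2 a3 a4 a5 fiber_in_l2s[OF fH]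
  proof eventually_elim
    case (elim t)
    show ?case
    proof
      assume t: "t \<in> torus"
      let ?J = "l2.cspan (\<lambda>i. fiber s (\<phi> i) t) I"
      have El: "fiber s (\<phi> i) t \<in> l2s s" if "i \<in> I" for i using elim(6) that t by blast
      have sub: "l2.subspace ?J" by (rule l2.subspace_cspan) (rule El)
      let ?a = "\<lambda>n. (l2s_norm s (fiber s (f - g n) t))\<^sup>2"
      have "(\<Sum>n. ennreal (?a n)) \<noteq> top" using elim(1,2) t by simp
      then have "summable ?a" by (intro summable_suminf_not_top) auto
      then have "?a \<longlonglongrightarrow> 0" by (rule summable_LIMSEQ_zero)
      then have "(\<lambda>n. sqrt (?a n)) \<longlonglongrightarrow> sqrt 0" by (rule tendsto_real_sqrt)
      then have lim: "(\<lambda>n. l2s_norm s (fiber s (f - g n) t)) \<longlonglongrightarrow> 0" using elim(2) t by simp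
      have gJ: "fiber s (g n) t \<in> ?J" for n
      proof -
        have "fiber s (g n) t = (\<Sum>p\<in>M n. fscale (c n p) (fscale (ee t (ivec (fst p))) (fiber s (\<phi> (snd p)) t)))"
          unfolding elim(4)[rule_format] using elim(5) M(2)[of n] by (intro sum.cong) auto
        also have "\<dots> \<in> ?J"
        proof (intro l2.subspace_sum[OF sub] l2.subspace_scale[OF sub])
          fix p assume "p \<in> M n"
          then have "snd p \<in> I" using M(2)[of n] by auto
          then show "fiber s (\<phi> (snd p)) t \<in> ?J" by (intro l2.generator_in_cspan[where E = "\<lambda>i. fiber s (\<phi> i) t"] El)
        qed
        finally show ?thesis .
      qed
      have "fiber s f t \<in> ?J"
      proof (rule l2.cspan_closed)
        show "fiber s f t \<in> l2s s" using elim(7) t by blast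
        fix \<epsilon> :: real assume "\<epsilon> > 0"
        from order_tendstoD(2)[OF lim this] obtain n where n: "l2s_norm s (fiber s (f - g n) t) < \<epsilon>"
          using eventually_happens'[OF sequentially_bot] by blast
        have "fiber s (f - g n) t = fiber s f t - fiber s (g n) t" using elim(3)[rule_format, of n] by (simp add: algebra_simps)
        then show "\<exists>h\<in>?J. l2s_norm s (fiber s f t - h) < \<epsilon>" using n gJ[of n] by (intro bexI[of _ "fiber s (g n) t"]) simp_all
      qed (rule El)
      then show "fiber s f t \<in> range_fun s I \<phi> t" by (simp add: range_fun_eq)
    qed
  qed
qed

section \<open>Canonical duals of shift systems\<close>

lemma shifts_apply: "shifts \<psi> (k, i) = translate k (\<psi> i)"
  by (simp add: shifts_def)

lemma translate_add: "translate k (f + g) = translate k f + translate k g"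
  by (rule ext) (simp add: translate_def)

lemma translate_fscale: "translate k (fscale c f) = fscale c (translate k f)"
  by (rule ext) (simp add: translate_def fscale_def)

lemma translate_translate: "translate k (translate j f) = translate (k + j) f"
proof
  fix \<psi>
  have "schwartz (\<lambda>x. \<psi> (x + ivec k))" if "schwartz \<psi>" using that by (rule schwartz_intros)
  then show "translate k (translate j f) \<psi> = translate (k + j) f \<psi>"
    by (simp add: translate_def ivec_add ac_simps)
qed

lemma translate_zero: "f \<in> sobolev s \<Longrightarrow> translate 0 f = f"
  by (rule ext) (simp add: translate_def sobolev_eq_0)

lemma translate_image:
  fixes k :: "int^'n::finite"
  shows "translate k ` sobolev s = sobolev s"
proof
  show "translate k ` sobolev s \<subseteq> sobolev s" using sobolev_translate(1) by blast
  show "sobolev s \<subseteq> translate k ` sobolev s"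
  proof
    fix f :: "'n distribution" assume f: "f \<in> sobolev s"
    have "f = translate k (translate (- k) f)" using f by (simp add: translate_translate translate_zero)
    then show "f \<in> translate k ` sobolev s" using sobolev_translate(1)[OF f] by blast
  qed
qed

lemma sobolev_inner_translate:
  assumes f: "f \<in> sobolev s" and g: "g \<in> sobolev s"
  shows "sobolev_inner s (translate k f) (translate k g) = sobolev_inner s f g"
  unfolding sobolev_inner_def
proof (rule integral_cong_AE)
  have [measurable]: "fhat h \<in> borel_measurable borel" if "h \<in> sobolev s" for h
    using sobolev_fhat(2)[OF that] by (simp add: good_def)
  note tr = sobolev_translate(1)[OF f, of k] sobolev_translate(1)[OF g, of k]
  show "(\<lambda>t. fhat (translate k f) t * cnj (fhat (translate k g) t) * of_real ((mu s t)\<^sup>2)) \<in> borel_measurable lborel"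
    using tr by measurable
  show "(\<lambda>t. fhat f t * cnj (fhat g t) * of_real ((mu s t)\<^sup>2)) \<in> borel_measurable lborel"
    using f g by measurable
  have unit: "ee t (ivec k) * cnj (ee t (ivec k)) = 1" for t
    by (simp flip: complex_norm_square)
  show "AE t in lborel. fhat (translate k f) t * cnj (fhat (translate k g) t) * of_real ((mu s t)\<^sup>2) =
      fhat f t * cnj (fhat g t) * of_real ((mu s t)\<^sup>2)"
    using sobolev_translate(2)[OF f, of k] sobolev_translate(2)[OF g, of k]
  proof eventually_elim
    case (elim t)
    have "ee t (ivec k) * fhat f t * cnj (ee t (ivec k) * fhat g t) = (ee t (ivec k) * cnj (ee t (ivec k))) * (fhat f t * cnj (fhat g t))"
      by (simp add: mult_ac)
    then show ?case unfolding elim by (simp only: unit mult_1_left)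
  qed
qed

lemma AE_torusI:
  assumes "AE t in lborel. t \<in> torus \<longrightarrow> P t"
  shows "AE t in lebesgue_on torus. P t"
proof -
  have "torus \<in> sets lebesgue" using torus_measurable by (simp add: sets_completionI_sets)
  then show ?thesis using AE_completion[OF assms] by (subst AE_restrict_space_iff) auto
qed

text \<open>The common setting of both hypotheses: a frame enters directly, a Riesz family through
  \<open>riesz_imp_frame\<close>.\<close>

locale shift_frame = cframe fscale "sobolev s :: 'n::finite distribution set" "sobolev_inner s" "sobolev_norm s"
    "shifts \<phi>" "UNIV \<times> I" A B
  for s :: real and I :: "nat set" and \<phi> :: "nat \<Rightarrow> 'n::finite distribution" and A B :: real +
  assumes generators: "\<forall>i\<in>I. \<phi> i \<in> sobolev s"
begin

abbreviation F where "F \<equiv> frame_operator s I \<phi>"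
abbreviation \<theta> where "\<theta> \<equiv> canonical_dual s I \<phi>"

lemma shift_space_S: "shift_space s I \<phi> = S"
  by (rule shift_space_eq)

lemma frame_operator_eq: "F = fop"
  by (rule ext) (simp only: frame_operator_def fop_def sobolev_has_sum_eq fscale_def)

lemma canonical_dual_eq: "\<theta> i = finv (\<phi> i)"
  by (simp only: canonical_dual_def finv_def frame_operator_eq shift_space_S)

lemma generator_eq: "i \<in> I \<Longrightarrow> shifts \<phi> (0, i) = \<phi> i"
  using generators translate_zero[of "\<phi> i" s] by (simp add: shifts_def)

lemma generator_in_S: "i \<in> I \<Longrightarrow> \<phi> i \<in> S"
  using E_in_S[of "(0, i)"] generator_eq by simp

lemma dual_generator_in_S: "i \<in> I \<Longrightarrow> \<theta> i \<in> S"
  by (simp add: canonical_dual_eq finv_in_S generator_in_S)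

lemma shift_index_bij: "bij_betw (\<lambda>(j, i). (k + j, i)) (UNIV \<times> I) (UNIV \<times> I)"
  for k :: "int^'n"
  by (rule bij_betwI[where g = "\<lambda>(j, i). (j - k, i)"]) auto

lemma translate_shifts: "p \<in> UNIV \<times> I \<Longrightarrow> translate k (shifts \<phi> p) = shifts \<phi> ((\<lambda>(j, i). (k + j, i)) p)"
  by (auto simp: shifts_def translate_translate)

lemmas translate_unitary = sobolev_translate(1) translate_add translate_fscale sobolev_inner_translate translate_image

lemma translate_fop:
  assumes f: "f \<in> S"
  shows "translate k f \<in> S" "fop (translate k f) = translate k (fop f)"
  using fop_commute[where U = "translate k", OF translate_unitary shift_index_bij translate_shifts f] by auto

lemma translate_finv: "f \<in> S \<Longrightarrow> finv (translate k f) = translate k (finv f)"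
  using finv_commute[where U = "translate k", OF translate_unitary shift_index_bij translate_shifts] by auto

lemma shifts_dual: assumes "p \<in> UNIV \<times> I" shows "shifts \<theta> p = finv (shifts \<phi> p)"
proof -
  obtain k i where p: "p = (k, i)" "i \<in> I" using assms by auto
  show ?thesis by (simp only: p(1) shifts_apply canonical_dual_eq translate_finv[OF generator_in_S[OF p(2)]])
qed

lemma shift_space_dual: "shift_space s I \<theta> = S"
proof -
  have "cspan (shifts \<theta>) (UNIV \<times> I) = cspan (\<lambda>p. finv (shifts \<phi> p)) (UNIV \<times> I)"
    by (rule cspan_cong) (rule shifts_dual)
  then show ?thesis by (simp add: shift_space_eq cspan_dual)
qed

lemma dual_expansion_\<theta>: "dual_expansion s I \<phi> \<theta>"
  unfolding dual_expansion_def shift_space_S sobolev_has_sum_eq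
proof (intro ballI conjI)
  fix f assume f: "f \<in> S"
  have "usum (\<lambda>p. fscale (sobolev_inner s f (shifts \<theta> p)) (shifts \<phi> p)) (UNIV \<times> I) f"
    by (rule usum_cong[THEN iffD1, OF _ dual_expansion_1[OF f]]) (simp add: shifts_dual)
  then show "usum (\<lambda>p \<psi>. sobolev_inner s f (shifts \<theta> p) * shifts \<phi> p \<psi>) (UNIV \<times> I) f"
    by (simp only: fscale_def)
  have "usum (\<lambda>p. fscale (sobolev_inner s f (shifts \<phi> p)) (shifts \<theta> p)) (UNIV \<times> I) f"
    by (rule usum_cong[THEN iffD1, OF _ dual_expansion_2[OF f]]) (simp add: shifts_dual)
  then show "usum (\<lambda>p \<psi>. sobolev_inner s f (shifts \<phi> p) * shifts \<theta> p \<psi>) (UNIV \<times> I) f"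
    by (simp only: fscale_def)
qed

lemma dual_frame: "is_dual_frame s I \<phi> \<theta> (inverse B) (inverse A)"
  unfolding is_dual_frame_def
proof (intro conjI ballI dual_expansion_\<theta>)
  show "\<theta> i \<in> shift_space s I \<phi>" if "i \<in> I" for i
    using dual_generator_in_S[OF that] by (simp add: shift_space_S)
  show "is_frame s I \<theta> (shift_space s I \<phi>) (inverse B) (inverse A)"
    unfolding is_frame_def shift_space_S shift_space_dual
  proof (intro conjI ballI refl)
    fix f assume f: "f \<in> S"
    have eq: "(\<Sum>\<^sub>\<infinity>p\<in>UNIV \<times> I. (cmod (sobolev_inner s f (shifts \<theta> p)))\<^sup>2) =
        (\<Sum>\<^sub>\<infinity>p\<in>UNIV \<times> I. (cmod (sobolev_inner s f (finv (shifts \<phi> p))))\<^sup>2)"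
      by (rule infsum_cong) (simp add: shifts_dual)
    have "(\<lambda>p. (cmod (sobolev_inner s f (finv (shifts \<phi> p))))\<^sup>2) summable_on (UNIV \<times> I)"
      using dual_energy[OF f] by (rule has_sum_imp_summable)
    then show "(\<lambda>p. (cmod (sobolev_inner s f (shifts \<theta> p)))\<^sup>2) summable_on (UNIV \<times> I)"
      by (rule summable_on_cong[THEN iffD1, rotated]) (simp add: shifts_dual)
    show "inverse B * (sobolev_norm s f)\<^sup>2 \<le> (\<Sum>\<^sub>\<infinity>p\<in>UNIV \<times> I. (cmod (sobolev_inner s f (shifts \<theta> p)))\<^sup>2)"
      "(\<Sum>\<^sub>\<infinity>p\<in>UNIV \<times> I. (cmod (sobolev_inner s f (shifts \<theta> p)))\<^sup>2) \<le> inverse A * (sobolev_norm s f)\<^sup>2"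
      unfolding eq by (rule dual_bounds[OF f])+
  qed
qed

lemma dual_riesz:
  assumes riesz: "is_riesz s I \<phi> (shift_space s I \<phi>) A B"
  shows "is_dual_riesz s I \<phi> \<theta> (inverse B) (inverse A)"
  unfolding is_dual_riesz_def
proof (intro conjI ballI dual_expansion_\<theta>)
  show "\<theta> i \<in> shift_space s I \<phi>" if "i \<in> I" for i
    using dual_generator_in_S[OF that] by (simp add: shift_space_S)
  have low: "A * (\<Sum>p\<in>M. (cmod (c p))\<^sup>2) \<le> (sobolev_norm s (\<Sum>p\<in>M. fscale (c p) (shifts \<phi> p)))\<^sup>2"
    if "finite M" "M \<subseteq> UNIV \<times> I" for c M
    using riesz that unfolding is_riesz_def lin_comb_eq by blast
  show "is_riesz s I \<theta> (shift_space s I \<phi>) (inverse B) (inverse A)"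
    unfolding is_riesz_def shift_space_S shift_space_dual
  proof (intro conjI allI impI refl)
    fix c M assume M: "finite M" "M \<subseteq> (UNIV :: (int^'n) set) \<times> I"
    have eq: "lin_comb c (shifts \<theta>) M = (\<Sum>p\<in>M. fscale (c p) (finv (shifts \<phi> p)))"
      unfolding lin_comb_eq using M(2) by (intro sum.cong) (auto simp: shifts_dual subset_iff)
    show "inverse B * (\<Sum>p\<in>M. (cmod (c p))\<^sup>2) \<le> (sobolev_norm s (lin_comb c (shifts \<theta>) M))\<^sup>2"
      unfolding eq by (rule riesz_dual(1)[OF low M])
    show "(sobolev_norm s (lin_comb c (shifts \<theta>) M))\<^sup>2 \<le> inverse A * (\<Sum>p\<in>M. (cmod (c p))\<^sup>2)"
      unfolding eq by (rule riesz_dual(2)[OF low M])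
  qed
qed

lemma fop_comb:
  assumes "finite M" "\<And>p. p \<in> M \<Longrightarrow> D p \<in> S"
  shows "fop (\<Sum>p\<in>M. fscale (c p) (D p)) = (\<Sum>p\<in>M. fscale (c p) (fop (D p))) \<and> (\<Sum>p\<in>M. fscale (c p) (D p)) \<in> S"
  using assms
proof (induction M rule: finite_induct)
  case empty
  have "fop 0 = 0" using fop_scale[OF S_zero, of 0] by simp
  then show ?case using S_zero by (simp only: sum.empty simp_thms)
next
  case (insert p M)
  have p: "fscale (c p) (D p) \<in> S" "fop (fscale (c p) (D p)) = fscale (c p) (fop (D p))"
    using insert.prems[of p] by (auto intro: S_scale fop_scale)
  have M: "fop (\<Sum>p\<in>M. fscale (c p) (D p)) = (\<Sum>p\<in>M. fscale (c p) (fop (D p)))" "(\<Sum>p\<in>M. fscale (c p) (D p)) \<in> S"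
    using insert by auto
  show ?case unfolding sum.insert[OF insert.hyps] using fop_add[OF p(1) M(2)] S_add[OF p(1) M(2)] p(2) M(1) by (simp only: simp_thms)
qed

text \<open>Because \<open>fop\<close> commutes with translations, it maps a combination of
  translates of \<open>f\<close> to the same combination of translates of \<open>fop f\<close>.
  Applying \<open>fop_below\<close> to these combinations is exactly the hypothesis of
  \<open>fiber_lower_bound\<close>.\<close>

lemma fiber_fop_lower:
  assumes f: "f \<in> S"
  shows "AE t in lborel. t \<in> torus \<longrightarrow> A * l2s_norm s (fiber s f t) \<le> l2s_norm s (fiber s (fop f) t)"
proof (rule fiber_lower_bound)
  show "f \<in> sobolev s" "fop f \<in> sobolev s" "0 \<le> A" using f A_pos by auto
  fix M :: "(int^'n) set" and p assume M: "finite M"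
  have tr: "translate k f \<in> S" "fop (translate k f) = translate k (fop f)" for k using translate_fop[OF f] by auto
  have c: "fop (\<Sum>k\<in>M. fscale (p k) (translate k f)) = (\<Sum>k\<in>M. fscale (p k) (translate k (fop f)))"
    "(\<Sum>k\<in>M. fscale (p k) (translate k f)) \<in> S"
    using fop_comb[OF M, of "\<lambda>k. translate k f" p] tr by auto
  show "A * sobolev_norm s (\<Sum>k\<in>M. fscale (p k) (translate k f)) \<le> sobolev_norm s (\<Sum>k\<in>M. fscale (p k) (translate k (fop f)))"
    using fop_below[OF c(2)] unfolding c(1) .
qed

text \<open>Only countably many distributions are tested: the generators, their duals and the
  rational combinations of the generators. All the required fiber identities then hold off one null
  set, and at each remaining \<open>t\<close> the claim is a statement about one bounded operator on
  one closed subspace.\<close>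

lemma range_operator_inverse:
  assumes R: "range_operator s I \<phi> F R"
  shows "AE t in lebesgue_on torus. bij_betw (R t) (range_fun s I \<phi> t) (range_fun s I \<phi> t) \<and>
    (\<forall>i\<in>I. fiber s (\<theta> i) t = inv_into (range_fun s I \<phi> t) (R t) (fiber s (\<phi> i) t))"
proof -
  interpret l2: chilbert fscale "l2s s :: (int^'n \<Rightarrow> complex) set" "l2s_inner s" "l2s_norm s" by (rule chilbert_l2s)
  \<comment> \<open>Combinations of the generators without shifts are enough, since their fibers are
    the rational combinations of the generator fibers, which are dense in
    \<open>range_fun s I \<phi> t\<close>.\<close>
  let ?q = "\<lambda>xs. rat_comb I \<phi> xs"
  have qS: "?q xs \<in> S" for xs
    unfolding rat_comb_def
    by (intro subspace_sum[OF subspace_S] S_scale generator_in_S) auto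
  have a1: "AE t in lebesgue_on torus. bounded_operator_on s (range_fun s I \<phi> t) (R t)"
    using R unfolding range_operator_def by blast
  have Rf: "AE t in lebesgue_on torus. fiber s (fop f) t = R t (fiber s f t)" if "f \<in> S" for f
    using R that unfolding range_operator_def shift_space_S frame_operator_eq by blast
  have a2: "AE t in lebesgue_on torus. \<forall>i\<in>I. fiber s (\<phi> i) t \<in> l2s s"
  proof (subst AE_ball_countable, simp, intro ballI AE_torusI)
    fix i assume "i \<in> I"
    then have "\<phi> i \<in> sobolev s" using generators by blast
    from fiber_in_l2s[OF this] show "AE t in lborel. t \<in> torus \<longrightarrow> fiber s (\<phi> i) t \<in> l2s s"
      by eventually_elim auto
  qed
  \<comment> \<open>The equation F \<theta>_i = \<phi>_i read on fibers. It supplies the preimages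
    that make \<open>R t\<close> onto, and, once \<open>R t\<close> is injective, the formula for
    the fibers of the dual generators.\<close>
  have a3: "AE t in lebesgue_on torus. \<forall>i\<in>I. fiber s (\<phi> i) t = R t (fiber s (\<theta> i) t)"
  proof (subst AE_ball_countable, simp, intro ballI)
    fix i assume i: "i \<in> I"
    have "fop (\<theta> i) = \<phi> i" unfolding canonical_dual_eq by (rule fop_finv[OF generator_in_S[OF i]])
    then show "AE t in lebesgue_on torus. fiber s (\<phi> i) t = R t (fiber s (\<theta> i) t)"
      using Rf[OF dual_generator_in_S[OF i]] by simp
  qed
  have a4: "AE t in lebesgue_on torus. \<forall>i\<in>I. fiber s (\<theta> i) t \<in> range_fun s I \<phi> t"
    by (subst AE_ball_countable, simp, intro ballI AE_torusI fiber_in_range_fun generators)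
       (simp add: shift_space_S dual_generator_in_S)
  have a5: "AE t in lebesgue_on torus. \<forall>xs. fiber s (fop (?q xs)) t = R t (fiber s (?q xs) t)"
    by (subst AE_all_countable) (intro allI Rf qS)
  have a6: "AE t in lebesgue_on torus. \<forall>xs. A * l2s_norm s (fiber s (?q xs) t) \<le> l2s_norm s (fiber s (fop (?q xs)) t)"
    by (subst AE_all_countable) (intro allI AE_torusI fiber_fop_lower qS)
  have a7: "AE t in lebesgue_on torus. \<forall>xs. fiber s (?q xs) t = l2.rat_comb I (\<lambda>i. fiber s (\<phi> i) t) xs"
  proof (subst AE_all_countable, intro allI AE_torusI)
    fix xs
    have "AE t in lborel. fiber s (?q xs) t = l2.rat_comb I (\<lambda>i. fiber s (\<phi> i) t) xs"
      unfolding rat_comb_def l2.rat_comb_def using generators by (intro fiber_comb) auto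
    then show "AE t in lborel. t \<in> torus \<longrightarrow> fiber s (?q xs) t = l2.rat_comb I (\<lambda>i. fiber s (\<phi> i) t) xs"
      by eventually_elim simp
  qed
  show ?thesis using a1 a2 a3 a4 a5 a6 a7
  proof eventually_elim
    case (elim t)
    let ?E = "\<lambda>i. fiber s (\<phi> i) t"
    let ?J = "l2.cspan ?E I"
    have J: "range_fun s I \<phi> t = ?J" by (rule range_fun_eq)
    have E: "?E i \<in> l2s s" if "i \<in> I" for i using elim(2) that by blast
    have RJ: "R t a \<in> ?J" if "a \<in> ?J" for a using elim(1) that unfolding bounded_operator_on_def J by blast
    have Radd: "R t (a + b) = R t a + R t b" if "a \<in> ?J" "b \<in> ?J" for a b
      using elim(1) that unfolding bounded_operator_on_def J plus_fun_def by blast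
    have Rscale: "R t (fscale c a) = fscale c (R t a)" if "a \<in> ?J" for c a
      using elim(1) that unfolding bounded_operator_on_def J fscale_def by blast
    obtain C where C: "\<And>a. a \<in> ?J \<Longrightarrow> l2s_norm s (R t a) \<le> C * l2s_norm s a"
      using elim(1) unfolding bounded_operator_on_def J by blast
    have below_rat: "A * l2s_norm s (l2.rat_comb I ?E xs) \<le> l2s_norm s (R t (l2.rat_comb I ?E xs))" for xs
      using elim(6)[rule_format, of xs] unfolding elim(5)[rule_format] elim(7)[rule_format] .
    have below: "A * l2s_norm s a \<le> l2s_norm s (R t a)" if "a \<in> ?J" for a
      by (rule l2.bounded_below_of_rat_comb[OF E RJ Radd C below_rat A_pos that])
    have onto: "\<exists>a\<in>?J. R t a = ?E i" if "i \<in> I" for i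
      using elim(3,4) that unfolding J by metis
    have bij: "bij_betw (R t) ?J ?J"
      by (rule l2.bounded_below_bij[OF E RJ Radd Rscale C A_pos below onto])
    have "fiber s (\<theta> i) t = inv_into ?J (R t) (?E i)" if i: "i \<in> I" for i
    proof -
      have "fiber s (\<theta> i) t \<in> ?J" using elim(4) i unfolding J by blast
      then have "inv_into ?J (R t) (R t (fiber s (\<theta> i) t)) = fiber s (\<theta> i) t"
        using bij by (intro inv_into_f_f) (auto simp: bij_betw_def)
      then show ?thesis using elim(3) i by simp
    qed
    then show ?case using bij unfolding J by blast
  qed
qed

end

lemma shift_frame_of_frame:
  assumes "0 < A" "A \<le> B" "\<forall>i\<in>I. \<phi> i \<in> sobolev s" "is_frame s I \<phi> (shift_space s I \<phi>) A B"
  shows "shift_frame s I \<phi> A B"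
proof -
  interpret chilbert fscale "sobolev s" "sobolev_inner s" "sobolev_norm s" by (rule chilbert_sobolev)
  show ?thesis
    by unfold_locales
       (use assms shifts_in_sobolev in \<open>auto simp: is_frame_def shift_space_eq\<close>)
qed

lemma shift_frame_of_riesz:
  assumes "0 < A" "A \<le> B" "\<forall>i\<in>I. \<phi> i \<in> sobolev s" "is_riesz s I \<phi> (shift_space s I \<phi>) A B"
  shows "shift_frame s I \<phi> A B"
proof -
  interpret chilbert fscale "sobolev s" "sobolev_inner s" "sobolev_norm s" by (rule chilbert_sobolev)
  have "cframe fscale (sobolev s) (sobolev_inner s) (sobolev_norm s) (shifts \<phi>) (UNIV \<times> I) A B"
  proof (rule riesz_imp_frame)
    show "shifts \<phi> p \<in> sobolev s" if "p \<in> UNIV \<times> I" for p using shifts_in_sobolev[OF assms(3) that] .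
    show "A * (\<Sum>p\<in>M. (cmod (c p))\<^sup>2) \<le> (sobolev_norm s (\<Sum>p\<in>M. fscale (c p) (shifts \<phi> p)))\<^sup>2 \<and>
      (sobolev_norm s (\<Sum>p\<in>M. fscale (c p) (shifts \<phi> p)))\<^sup>2 \<le> B * (\<Sum>p\<in>M. (cmod (c p))\<^sup>2)"
      if "finite M" "M \<subseteq> UNIV \<times> I" for c M
      using assms(4) that unfolding is_riesz_def lin_comb_eq by blast
  qed (use assms in auto)
  then show ?thesis using assms(3) by (simp add: shift_frame_def shift_frame_axioms_def)
qed

theorem theorem3p4:
  fixes s A B :: real and I :: "nat set" and \<phi> :: "nat \<Rightarrow> 'n::finite distribution"
  assumes "0 < A" and "A \<le> B"
    and "\<forall>i\<in>I. \<phi> i \<in> sobolev s"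
  shows "(is_frame s I \<phi> (shift_space s I \<phi>) A B \<longrightarrow>
            is_dual_frame s I \<phi> (canonical_dual s I \<phi>) (inverse B) (inverse A)) \<and>
         (is_riesz s I \<phi> (shift_space s I \<phi>) A B \<longrightarrow>
            is_dual_riesz s I \<phi> (canonical_dual s I \<phi>) (inverse B) (inverse A)) \<and>
         (is_frame s I \<phi> (shift_space s I \<phi>) A B \<or> is_riesz s I \<phi> (shift_space s I \<phi>) A B \<longrightarrow>
            bij_betw (frame_operator s I \<phi>) (shift_space s I \<phi>) (shift_space s I \<phi>) \<and>
            (\<forall>R. range_operator s I \<phi> (frame_operator s I \<phi>) R \<longrightarrow>
               (AE t in lebesgue_on torus.
                  bij_betw (R t) (range_fun s I \<phi> t) (range_fun s I \<phi> t)) \<and>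
               (\<forall>i\<in>I. AE t in lebesgue_on torus.
                  fiber s (canonical_dual s I \<phi> i) t
                    = inv_into (range_fun s I \<phi> t) (R t) (fiber s (\<phi> i) t))))"
proof (intro conjI impI)
  note frame = shift_frame_of_frame[OF assms] and riesz = shift_frame_of_riesz[OF assms]
  show "is_dual_frame s I \<phi> (canonical_dual s I \<phi>) (inverse B) (inverse A)"
    if "is_frame s I \<phi> (shift_space s I \<phi>) A B"
    by (rule shift_frame.dual_frame[OF frame[OF that]])
  show "is_dual_riesz s I \<phi> (canonical_dual s I \<phi>) (inverse B) (inverse A)"
    if "is_riesz s I \<phi> (shift_space s I \<phi>) A B"
    by (rule shift_frame.dual_riesz[OF riesz[OF that] that])
  assume "is_frame s I \<phi> (shift_space s I \<phi>) A B \<or> is_riesz s I \<phi> (shift_space s I \<phi>) A B"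
  \<comment> \<open>Either hypothesis leads to the same setting, so invertibility and the range
    operator are treated without distinguishing the two cases.\<close>
  then interpret shift_frame s I \<phi> A B using frame riesz by blast
  show "bij_betw (frame_operator s I \<phi>) (shift_space s I \<phi>) (shift_space s I \<phi>)"
    unfolding frame_operator_eq shift_space_S by (rule fop_bij)
  show "\<forall>R. range_operator s I \<phi> (frame_operator s I \<phi>) R \<longrightarrow>
               (AE t in lebesgue_on torus.
                  bij_betw (R t) (range_fun s I \<phi> t) (range_fun s I \<phi> t)) \<and>
               (\<forall>i\<in>I. AE t in lebesgue_on torus.
                  fiber s (canonical_dual s I \<phi> i) t
                    = inv_into (range_fun s I \<phi> t) (R t) (fiber s (\<phi> i) t))"
  proof (intro allI impI conjI ballI)
    fix R assume R: "range_operator s I \<phi> (frame_operator s I \<phi>) R"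
    note AE = range_operator_inverse[OF R]
    show "AE t in lebesgue_on torus. bij_betw (R t) (range_fun s I \<phi> t) (range_fun s I \<phi> t)"
      using AE by eventually_elim blast
    show "AE t in lebesgue_on torus. fiber s (canonical_dual s I \<phi> i) t
        = inv_into (range_fun s I \<phi> t) (R t) (fiber s (\<phi> i) t)" if "i \<in> I" for i
      using AE by eventually_elim (use that in blast)
  qed
qed

end
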